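(* Let $N$ be a prime number. Let $K$ be a simplicial complex with a fixed total order on its vertices, and let $f,g:K\to\mathbb{R}$ be real-valued functions on the set of simplices of $K$ such that $f(\sigma)\le f(\tau)$ and $g(\sigma)\le g(\tau)$ whenever $\sigma$ is a face of $\tau$, and such that all sublevel complexes $\{\sigma\in K: f(\sigma)\le a\}$ and $\{\sigma\in K: g(\sigma)\le a\}$, $a\in\mathbb{R}$, are finite. For $1\le q\le N-1$ let $\mathcal{D}_q(K,f)$ and $\mathcal{D}_q(K,g)$ be the Mayer persistence diagrams of $K$ filtered by $f$ and $g$. Then $$d_B\big(\{\mathcal{D}_q(K,f)\}_{1\le q\le N-1},\{\mathcal{D}_q(K,g)\}_{1\le q\le N-1}\big)\le \|f-g\|_\infty,$$ where $\|f-g\|_\infty=\sup_{\sigma\in K}|f(\sigma)-g(\sigma)|$.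
   Context: Let $\xi=e^{2\pi\sqrt{-1}/N}$. For a simplicial complex $L$ with totally ordered vertex set, $C_n(L;\mathbb{C})$ is the $\mathbb{C}$-vector space with basis the $n$-simplices of $L$ ($C_n=0$ for $n<0$), each simplex written $\langle v_0,\dots,v_n\rangle$ with $v_0<\dots<v_n$. The linear map $d_n:C_n(L;\mathbb{C})\to C_{n-1}(L;\mathbb{C})$ is $d_n\langle v_0,\dots,v_n\rangle=\sum_{i=0}^n\xi^i\langle v_0,\dots,\hat{v_i},\dots,v_n\rangle$ for $n\ge1$, and $d_0=0$; these maps satisfy $d^N=0$. For $1\le q\le N-1$ and $n\ge0$, the Mayer homology is $H_{n,q}(L;\mathbb{C})=Z_{n,q}/B_{n,q}$, where $Z_{n,q}=\{x\in C_n(L;\mathbb{C}): d^qx=0\}$ and $B_{n,q}=\{d^{N-q}x: x\in C_{n+N-q}(L;\mathbb{C})\}$. Put $H_{*,q}(L;\mathbb{C})=\bigoplus_{n\ge0}H_{n,q}(L;\mathbb{C})$. An inclusion of a subcomplex (with the induced vertex order) induces a linear map on $H_{*,q}$. For $f$ as in the claim, let $K^f_a=\{\sigma\in K: f(\sigma)\le a\}$. The vector spaces $H_{*,q}(K^f_a;\mathbb{C})$, $a\in\mathbb{R}$, with the maps induced by the inclusions $K^f_a\subseteq K^f_b$ for $a\le b$, form a pointwise finite-dimensional persistence module $\mathbf{H}_q(K,f)$ indexed by $\mathbb{R}$. $\mathcal{D}_q(K,f)$ is its persistence diagram: the multiset of pairs (birth, death), with death possibly $\infty$, of the intervals in its barcode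 decomposition. For families of persistence diagrams, the bottleneck distance is $$d_B(\{\mathcal{D}_q\}_{1\le q\le N-1},\{\mathcal{D}'_q\}_{1\le q\le N-1})=\sup_{1\le q\le N-1}\ \inf_{\gamma:\mathcal{D}_q\to\mathcal{D}'_q}\ \sup_{x\in\mathcal{D}_q}|x-\gamma(x)|,$$ where the infimum is over all matchings between the two diagrams in the usual sense of the bottleneck distance: distances are measured in the $\ell^\infty$ norm on the (extended) plane, and points of either diagram may be left unmatched, i.e. matched to the diagonal, at cost equal to their $\ell^\infty$ distance to the diagonal. *)

theory Defs
  imports "HOL-Analysis.Analysis" "HOL-Algebra.Module" "HOL-Algebra.AbelCoset"
    "HOL-Computational_Algebra.Primes"
begin

section \<open>Complex vector spaces with carrier\<close>

text \<open>
  Vector spaces over the complex numbers are module records of HOL-Algebra with scalars of type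
  complex; only the fields carrier, zero, add and smult matter, and the ring fields mult and one
  are left undefined.
\<close>

definition linear_isos ::
  "(complex, 'x) module \<Rightarrow> (complex, 'y) module \<Rightarrow> ('x \<Rightarrow> 'y) set" where
  "linear_isos M M' = {h. bij_betw h (carrier M) (carrier M') \<and>
     h \<in> hom (add_monoid M) (add_monoid M') \<and>
     (\<forall>c. \<forall>x\<in>carrier M. h (c \<odot>\<^bsub>M\<^esub> x) = c \<odot>\<^bsub>M'\<^esub> h x)}"

text \<open>
  In the quotient by a subspace B, the summand B in the scalar multiplication is only needed for
  the scalar 0, where the elementwise multiples of a coset would collapse to the zero vector.
\<close>

definition quotient_module :: "(complex, 'x) module \<Rightarrow> 'x set \<Rightarrow> (complex, 'x set) module" where
  "quotient_module M B =
     \<lparr>carrier = a_rcosets\<^bsub>M\<^esub> B, mult = undefined, one = undefined,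
      zero = B, add = (\<lambda>X Y. X <+>\<^bsub>M\<^esub> Y),
      smult = (\<lambda>c X. B <+>\<^bsub>M\<^esub> ((\<lambda>x. c \<odot>\<^bsub>M\<^esub> x) ` X))\<rparr>"

definition module_sum :: "'i set \<Rightarrow> ('i \<Rightarrow> (complex, 'x) module) \<Rightarrow> (complex, 'i \<Rightarrow> 'x) module" where
  "module_sum J A =
     \<lparr>carrier = {x \<in> (\<Pi>\<^sub>E j\<in>J. carrier (A j)). finite {j \<in> J. x j \<noteq> \<zero>\<^bsub>A j\<^esub>}},
      mult = undefined, one = undefined,
      zero = (\<lambda>j\<in>J. \<zero>\<^bsub>A j\<^esub>),
      add = (\<lambda>x y. \<lambda>j\<in>J. x j \<oplus>\<^bsub>A j\<^esub> y j),
      smult = (\<lambda>c x. \<lambda>j\<in>J. c \<odot>\<^bsub>A j\<^esub> x j)\<rparr>"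


section \<open>Persistence modules over the reals and their barcodes\<close>

text \<open>\<open>pm_map M a b\<close> is the structure map from index a to index b; it is relevant only for
  \<open>a \<le> b\<close> and on the carrier of \<open>pm_space M a\<close>.\<close>

record 'x persistence_module =
  pm_space :: "real \<Rightarrow> (complex, 'x) module"
  pm_map :: "real \<Rightarrow> real \<Rightarrow> 'x \<Rightarrow> 'x"

definition pm_isomorphic :: "'x persistence_module \<Rightarrow> 'y persistence_module \<Rightarrow> bool" where
  "pm_isomorphic M M' \<longleftrightarrow>
     (\<exists>\<phi>. (\<forall>a. \<phi> a \<in> linear_isos (pm_space M a) (pm_space M' a)) \<and>
          (\<forall>a b. a \<le> b \<longrightarrow> (\<forall>x\<in>carrier (pm_space M a).
             \<phi> b (pm_map M a b x) = pm_map M' a b (\<phi> a x))))"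

definition pm_sum :: "'i set \<Rightarrow> ('i \<Rightarrow> 'x persistence_module) \<Rightarrow> ('i \<Rightarrow> 'x) persistence_module" where
  "pm_sum J M =
     \<lparr>pm_space = (\<lambda>a. module_sum J (\<lambda>j. pm_space (M j) a)),
      pm_map = (\<lambda>a b x. \<lambda>j\<in>J. pm_map (M j) a b (x j))\<rparr>"

definition interval_module :: "real set \<Rightarrow> complex persistence_module" where
  "interval_module I =
     \<lparr>pm_space = (\<lambda>a. \<lparr>carrier = (if a \<in> I then UNIV else {0}), mult = undefined, one = undefined,
                     zero = 0, add = (+), smult = (*)\<rparr>),
      pm_map = (\<lambda>a b x. if a \<in> I \<and> b \<in> I then x else 0)\<rparr>"

text \<open>A multiset of intervals is given by its multiplicity function; its elements are indexed by
  the pairs \<open>(I, i)\<close> with \<open>i\<close> below the multiplicity of \<open>I\<close>.  (Multisets in the sense of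
  HOL-Library are finite, whereas a barcode may be infinite.)\<close>

definition is_barcode :: "'x persistence_module \<Rightarrow> (real set \<Rightarrow> nat) \<Rightarrow> bool" where
  "is_barcode M m \<longleftrightarrow>
     (\<forall>I. m I > 0 \<longrightarrow> I \<noteq> {} \<and> is_interval I) \<and>
     pm_isomorphic M (pm_sum {(I, i). i < m I} (\<lambda>(I, i). interval_module I))"

definition barcode :: "'x persistence_module \<Rightarrow> real set \<Rightarrow> nat" where
  "barcode M = (THE m. is_barcode M m)"

definition intervals_between :: "ereal \<Rightarrow> ereal \<Rightarrow> real set set" where
  "intervals_between b d = {I. I \<noteq> {} \<and> is_interval I \<and> Inf (ereal ` I) = b \<and> Sup (ereal ` I) = d}"

text \<open>A diagram is the multiplicity function of a multiset of pairs (birth, death).  The sum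
  adds up the intervals that differ only in which of their endpoints they contain.\<close>

type_synonym diagram = "ereal \<times> ereal \<Rightarrow> nat"

definition persistence_diagram :: "'x persistence_module \<Rightarrow> diagram" where
  "persistence_diagram M = (\<lambda>(b, d). \<Sum>I\<in>intervals_between b d. barcode M I)"

lemma finite_intervals_between: "finite (intervals_between b d)"
proof -
  let ?S = "{x. b < ereal x \<and> ereal x < d}"
  have "intervals_between b d \<subseteq> (\<lambda>E. ?S \<union> E) ` Pow {real_of_ereal b, real_of_ereal d}"
  proof
    fix I assume "I \<in> intervals_between b d"
    then have I: "is_interval I" "(INF x\<in>I. ereal x) = b" "(SUP x\<in>I. ereal x) = d"
      by (simp_all add: intervals_between_def)
    have 1: "?S \<subseteq> I"
    proof
      fix x assume "x \<in> ?S"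
      then have "(INF x\<in>I. ereal x) < ereal x" "ereal x < (SUP x\<in>I. ereal x)"
        using I(2,3) by simp_all
      then obtain y z where "y \<in> I" "y < x" "z \<in> I" "x < z"
        unfolding INF_less_iff less_SUP_iff less_ereal.simps by blast
      then show "x \<in> I" using I(1) unfolding is_interval_1 by (meson less_imp_le)
    qed
    have 2: "I - ?S \<subseteq> {real_of_ereal b, real_of_ereal d}"
    proof
      fix x assume x: "x \<in> I - ?S"
      then have "b \<le> ereal x" "ereal x \<le> d"
        unfolding I(2)[symmetric] I(3)[symmetric] by (blast intro: INF_lower SUP_upper)+
      then have "b = ereal x \<or> d = ereal x" using x unfolding order_le_less by blast
      then show "x \<in> {real_of_ereal b, real_of_ereal d}" by (elim disjE) simp_all
    qed
    from 1 have "I = ?S \<union> (I - ?S)" by blast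
    with 2 show "I \<in> (\<lambda>E. ?S \<union> E) ` Pow {real_of_ereal b, real_of_ereal d}" by blast
  qed
  then show ?thesis by (rule finite_subset) simp
qed


section \<open>Bottleneck distance\<close>

definition ext_dist :: "ereal \<Rightarrow> ereal \<Rightarrow> ennreal" where
  "ext_dist x y = (if x = y then 0 else e2ennreal \<bar>x - y\<bar>)"
  \<comment> \<open>the case distinction is needed because \<open>\<infinity> - \<infinity> = \<infinity>\<close> in ereal\<close>

definition linf_dist :: "ereal \<times> ereal \<Rightarrow> ereal \<times> ereal \<Rightarrow> ennreal" where
  "linf_dist p p' = max (ext_dist (fst p) (fst p')) (ext_dist (snd p) (snd p'))"

definition diagonal_dist :: "ereal \<times> ereal \<Rightarrow> ennreal" where
  "diagonal_dist p = (INF t::real. linf_dist p (ereal t, ereal t))"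

definition diagram_points :: "diagram \<Rightarrow> ((ereal \<times> ereal) \<times> nat) set" where
  "diagram_points D = {(p, i). i < D p}"

text \<open>A matching is a partial bijection between the points, counted with multiplicity; all other
  points are matched to the diagonal.\<close>

definition matchings ::
  "diagram \<Rightarrow> diagram \<Rightarrow> (((ereal \<times> ereal) \<times> nat) \<times> ((ereal \<times> ereal) \<times> nat)) set set" where
  "matchings D D' = {\<gamma>. \<gamma> \<subseteq> diagram_points D \<times> diagram_points D' \<and>
     single_valued \<gamma> \<and> single_valued (\<gamma>\<inverse>)}"

definition matching_cost ::
  "diagram \<Rightarrow> diagram \<Rightarrow> (((ereal \<times> ereal) \<times> nat) \<times> ((ereal \<times> ereal) \<times> nat)) set \<Rightarrow> ennreal" where
  "matching_cost D D' \<gamma> = Sup (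
     {linf_dist (fst x) (fst y) | x y. (x, y) \<in> \<gamma>} \<union>
     {diagonal_dist (fst x) | x. x \<in> diagram_points D - Domain \<gamma>} \<union>
     {diagonal_dist (fst y) | y. y \<in> diagram_points D' - Range \<gamma>})"

definition bottleneck_distance ::
  "'q set \<Rightarrow> ('q \<Rightarrow> diagram) \<Rightarrow> ('q \<Rightarrow> diagram) \<Rightarrow> ennreal" where
  "bottleneck_distance Q D D' =
     (SUP q\<in>Q. INF \<gamma>\<in>matchings (D q) (D' q). matching_cost (D q) (D' q) \<gamma>)"


section \<open>Simplicial complexes and Mayer homology\<close>

text \<open>A simplex is identified with its finite nonempty vertex set; its dimension is one less
  than its cardinality, and its \<open>i\<close>-th vertex is \<open>sorted_list_of_set \<sigma> ! i\<close>.\<close>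

definition abstract_simplicial_complex :: "'v set set \<Rightarrow> bool" where
  "abstract_simplicial_complex K \<longleftrightarrow>
     (\<forall>\<sigma>\<in>K. finite \<sigma> \<and> \<sigma> \<noteq> {} \<and> (\<forall>\<tau>. \<tau> \<subseteq> \<sigma> \<and> \<tau> \<noteq> {} \<longrightarrow> \<tau> \<in> K))"

definition sublevel :: "'v set set \<Rightarrow> ('v set \<Rightarrow> real) \<Rightarrow> real \<Rightarrow> 'v set set" where
  "sublevel K f a = {\<sigma>\<in>K. f \<sigma> \<le> a}"

text \<open>A chain is the function assigning to each simplex its coefficient.\<close>

type_synonym 'v chain = "'v set \<Rightarrow> complex"

definition chains :: "'v set set \<Rightarrow> nat \<Rightarrow> 'v chain set" where
  "chains L n = {x. finite {\<sigma>. x \<sigma> \<noteq> 0} \<and> {\<sigma>. x \<sigma> \<noteq> 0} \<subseteq> {\<sigma>\<in>L. card \<sigma> = n + 1}}"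

definition chain_module :: "'v set set \<Rightarrow> nat \<Rightarrow> (complex, 'v chain) module" where
  "chain_module L n =
     \<lparr>carrier = chains L n, mult = undefined, one = undefined,
      zero = (\<lambda>\<sigma>. 0), add = (\<lambda>x y \<sigma>. x \<sigma> + y \<sigma>), smult = (\<lambda>c x \<sigma>. c * x \<sigma>)\<rparr>"

definition xi :: "nat \<Rightarrow> complex" where
  "xi N = exp (2 * of_real pi * \<i> / of_nat N)"

definition simplex_boundary :: "nat \<Rightarrow> 'v::linorder set \<Rightarrow> 'v chain" where
  "simplex_boundary N \<sigma> =
     (if card \<sigma> \<le> 1 then (\<lambda>\<tau>. 0)
      else (\<lambda>\<tau>. \<Sum>i<card \<sigma>. if \<tau> = \<sigma> - {sorted_list_of_set \<sigma> ! i} then xi N ^ i else 0))"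

definition mayer_boundary :: "nat \<Rightarrow> 'v::linorder chain \<Rightarrow> 'v chain" where
  "mayer_boundary N x = (\<lambda>\<tau>. \<Sum>\<sigma> | x \<sigma> \<noteq> 0. x \<sigma> * simplex_boundary N \<sigma> \<tau>)"

definition mayer_cycles :: "nat \<Rightarrow> 'v::linorder set set \<Rightarrow> nat \<Rightarrow> nat \<Rightarrow> 'v chain set" where
  "mayer_cycles N L n q = {x \<in> chains L n. (mayer_boundary N ^^ q) x = (\<lambda>\<sigma>. 0)}"

definition mayer_boundaries :: "nat \<Rightarrow> 'v::linorder set set \<Rightarrow> nat \<Rightarrow> nat \<Rightarrow> 'v chain set" where
  "mayer_boundaries N L n q = (mayer_boundary N ^^ (N - q)) ` chains L (n + (N - q))"

definition mayer_homology ::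
  "nat \<Rightarrow> 'v::linorder set set \<Rightarrow> nat \<Rightarrow> nat \<Rightarrow> (complex, 'v chain set) module" where
  "mayer_homology N L n q =
     quotient_module ((chain_module L n)\<lparr>carrier := mayer_cycles N L n q\<rparr>) (mayer_boundaries N L n q)"

definition total_mayer_homology ::
  "nat \<Rightarrow> 'v::linorder set set \<Rightarrow> nat \<Rightarrow> (complex, nat \<Rightarrow> 'v chain set) module" where
  "total_mayer_homology N L q = module_sum UNIV (\<lambda>n. mayer_homology N L n q)"

text \<open>For an inclusion of \<open>L\<close> in \<open>L'\<close>, the class \<open>z + B(L)\<close> is sent to
  \<open>z + B(L') = B(L') + (z + B(L))\<close>.\<close>

definition inclusion_map ::
  "nat \<Rightarrow> 'v::linorder set set \<Rightarrow> nat \<Rightarrow> (nat \<Rightarrow> 'v chain set) \<Rightarrow> (nat \<Rightarrow> 'v chain set)" where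
  "inclusion_map N L' q X = (\<lambda>n. mayer_boundaries N L' n q <+>\<^bsub>chain_module L' n\<^esub> X n)"

definition mayer_persistence ::
  "nat \<Rightarrow> 'v::linorder set set \<Rightarrow> ('v set \<Rightarrow> real) \<Rightarrow> nat \<Rightarrow> (nat \<Rightarrow> 'v chain set) persistence_module" where
  "mayer_persistence N K f q =
     \<lparr>pm_space = (\<lambda>a. total_mayer_homology N (sublevel K f a) q),
      pm_map = (\<lambda>a b. inclusion_map N (sublevel K f b) q)\<rparr>"

definition mayer_diagram ::
  "nat \<Rightarrow> 'v::linorder set set \<Rightarrow> ('v set \<Rightarrow> real) \<Rightarrow> nat \<Rightarrow> diagram" where
  "mayer_diagram N K f q = persistence_diagram (mayer_persistence N K f q)"

end

theory Submission
  imports Defs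
begin

text \<open>
  Both filtrations live on the same complex \<open>K\<close>, so both persistence modules arise from one
  space \<open>Z\<close>, the cycles of \<open>K\<close> in a fixed degree.  A real function \<open>f\<close> puts two filtrations on
  \<open>Z\<close>: a cycle is born when its support has entered the sublevel complex, and it dies when it
  becomes a boundary there.  Homology at level \<open>a\<close> is the quotient of the cycles born by \<open>a\<close> by
  those dead by \<open>a\<close>, so a basis of \<open>Z\<close> that is adapted to both filtrations splits the
  persistence module into interval modules, one for each basis element that is born before it
  dies.  Such a basis exists: order the simplices by a rank that refines \<open>f\<close>, and for each simplex
  that is the leading simplex of some cycle choose such a cycle with the earliest death.
  Cancelling leading terms expands every cycle in these generators, and a cycle that is born or
  dead at level \<open>a\<close> uses only generators with the same property (\<open>ex_expansion\<close>).

  For two functions \<open>f\<close> and \<open>g\<close> at distance \<open>\<epsilon>\<close>, births and deaths of each cycle differ by at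
  most \<open>\<epsilon>\<close>.  A generator \<open>j\<close> for \<open>g\<close> that occurs in the expansion of a generator \<open>i\<close> for \<open>f\<close>
  is therefore born and dies at most \<open>\<epsilon>\<close> later than \<open>i\<close>, and conversely.  The two matrices of
  base change are inverse to each other.  If \<open>j\<close> contributes to the entry \<open>(i, k)\<close> of their
  product, and the interval of \<open>i\<close> has its midpoint no later than that of \<open>k\<close>, then \<open>j\<close> is
  \<open>\<epsilon>\<close>-close to \<open>i\<close> or to \<open>k\<close> in both endpoints (\<open>intermediate_close\<close>).  So for a finite set
  \<open>A\<close> of generators the product remains triangular when only the generators for \<open>g\<close> that are
  close to some member of \<open>A\<close> are kept, and there are at least as many of these as there are
  elements of \<open>A\<close>.  This is the condition in Hall's marriage theorem; together with the
  argument of Schroeder and Bernstein it yields a bijection between the two sets of generators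
  that moves births and deaths by at most \<open>\<epsilon>\<close> (\<open>ex_close_bijection\<close>).  A generator of positive
  length whose partner has length zero has length at most \<open>2 * \<epsilon>\<close>, so it is within \<open>\<epsilon>\<close> of
  the diagonal.  This argument uses a triangularity with respect to midpoints that is due to
  Bjerkevik in the setting of interleavings.

  Two further points connect this with the diagrams.  Boundaries are cycles because the
  \<open>N\<close>-th power of the Mayer boundary vanishes; its coefficients are multiples of the q-factorial
  of \<open>N\<close> at a primitive \<open>N\<close>-th root of unity (\<open>mayer_boundary_nilpotent\<close>).  And the barcode is
  well defined, because an isomorphism between sums of interval modules induces mutually
  inverse maps between the parts belonging to each single interval (\<open>barcode_unique\<close>).
\<close>

section \<open>Combinatorial tools\<close>

lemma homogeneous_system_nontrivial:
  fixes a :: "'t \<Rightarrow> 's \<Rightarrow> complex"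
  assumes "finite T" "finite S" "card T < card S"
  shows "\<exists>v. (\<exists>s\<in>S. v s \<noteq> 0) \<and> (\<forall>t\<in>T. (\<Sum>s\<in>S. a t s * v s) = 0)"
  using assms
proof (induction T arbitrary: S a rule: finite_induct)
  case empty
  then obtain s where "s \<in> S" by fastforce
  then show ?case by (intro exI[of _ "\<lambda>_. 1"]) auto
next
  case (insert t T)
  show ?case
  proof (cases "\<forall>s\<in>S. a t s = 0")
    case True
    have "card T < card S" using insert by simp
    from insert.IH[OF insert.prems(1) this, of a] True show ?thesis by auto
  next
    case False
    then obtain p where p: "p \<in> S" "a t p \<noteq> 0" by blast
    let ?S = "S - {p}"
    have "card T < card ?S" "finite ?S" using insert p by auto
    from insert.IH[OF this(2,1), of "\<lambda>t' s. a t' s - a t' p * a t s / a t p"]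
    obtain v where v: "\<exists>s\<in>?S. v s \<noteq> 0"
      "\<forall>t'\<in>T. (\<Sum>s\<in>?S. (a t' s - a t' p * a t s / a t p) * v s) = 0" by blast
    \<comment> \<open>solve the equation \<open>t\<close> for the unknown \<open>p\<close>\<close>
    define w where "w = (\<lambda>s. if s = p then - (\<Sum>s\<in>?S. a t s * v s) / a t p else v s)"
    have split: "(\<Sum>s\<in>S. a t' s * w s)
        = (\<Sum>s\<in>?S. a t' s * v s) - a t' p * (\<Sum>s\<in>?S. a t s * v s) / a t p" for t'
      using insert.prems(1) p by (simp add: sum.remove[of S p] w_def)
    have "(\<Sum>s\<in>S. a t' s * w s) = 0" if "t' \<in> T" for t'
    proof -
      have "(\<Sum>s\<in>?S. a t' s * v s) - a t' p * (\<Sum>s\<in>?S. a t s * v s) / a t p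
          = (\<Sum>s\<in>?S. (a t' s - a t' p * a t s / a t p) * v s)"
        unfolding left_diff_distrib sum_subtractf sum_distrib_left sum_divide_distrib
        by (intro arg_cong2[of _ _ _ _ minus] sum.cong) simp_all
      then show ?thesis using v(2) that split by simp
    qed
    moreover have "(\<Sum>s\<in>S. a t s * w s) = 0" using split[of t] p by simp
    moreover have "\<exists>s\<in>S. w s \<noteq> 0" using v(1) by (auto simp: w_def)
    ultimately show ?thesis by (intro exI[of _ w]) auto
  qed
qed

lemma ex_greatest_weight:
  fixes w :: "'s \<Rightarrow> 'w::linorder"
  assumes "finite V" "V \<noteq> {}"
  shows "\<exists>k\<in>V. \<forall>i\<in>V. w i \<le> w k"
proof -
  have "Max (w ` V) \<in> w ` V" using assms by simp
  then obtain k where "k \<in> V" "w k = Max (w ` V)" by auto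
  then show ?thesis using assms(1) by (metis Max_ge finite_imageI image_eqI)
qed

text \<open>The hypothesis on the product of the two matrices is a form of triangularity with nonzero
  diagonal, so the product is injective: look at column \<open>k\<close> for the support \<open>V\<close> of a
  kernel vector.  An injective map does not factor through a smaller space.\<close>

lemma card_le_if_triangular_product:
  fixes c :: "'s \<Rightarrow> 't \<Rightarrow> complex"
  assumes fin: "finite S" "finite T"
    and tri: "\<And>V. V \<subseteq> S \<Longrightarrow> V \<noteq> {} \<Longrightarrow> \<exists>k\<in>V. (\<Sum>j\<in>T. c k j * d j k) \<noteq> 0 \<and>
                (\<forall>i\<in>V. i \<noteq> k \<longrightarrow> (\<Sum>j\<in>T. c i j * d j k) = 0)"
  shows "card S \<le> card T"
proof (rule ccontr)
  assume "\<not> card S \<le> card T"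
  then obtain v where v: "\<exists>s\<in>S. v s \<noteq> 0" "\<forall>t\<in>T. (\<Sum>s\<in>S. c s t * v s) = 0"
    using homogeneous_system_nontrivial[OF fin(2,1), of "\<lambda>t s. c s t"] by (metis not_le)
  obtain k where k: "k \<in> S" "v k \<noteq> 0" "(\<Sum>j\<in>T. c k j * d j k) \<noteq> 0"
    and off: "\<And>i. i \<in> S \<Longrightarrow> v i \<noteq> 0 \<Longrightarrow> i \<noteq> k \<Longrightarrow> (\<Sum>j\<in>T. c i j * d j k) = 0"
    using tri[of "{s\<in>S. v s \<noteq> 0}"] v(1) by auto
  have "0 = (\<Sum>j\<in>T. (\<Sum>s\<in>S. c s j * v s) * d j k)" using v by simp
  also have "\<dots> = (\<Sum>s\<in>S. v s * (\<Sum>j\<in>T. c s j * d j k))"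
    unfolding sum_distrib_right sum_distrib_left by (subst sum.swap) (simp add: mult_ac)
  also have "\<dots> = (\<Sum>s\<in>S. if s = k then v k * (\<Sum>j\<in>T. c k j * d j k) else 0)"
  proof (rule sum.cong[OF refl])
    fix s assume "s \<in> S"
    then show "v s * (\<Sum>j\<in>T. c s j * d j k) = (if s = k then v k * (\<Sum>j\<in>T. c k j * d j k) else 0)"
      using off[of s] by (cases "v s = 0"; cases "s = k") simp_all
  qed
  also have "\<dots> = v k * (\<Sum>j\<in>T. c k j * d j k)" using fin k by simp
  finally show False using k by simp
qed

text \<open>Hall's marriage theorem for infinitely many finite sets.  Among the relations that still
  satisfy the marriage condition take a minimal one (the condition survives decreasing
  intersections, because each finite subfamily sees only finitely many pairs).  If it
  relates \<open>i\<close> to both \<open>x\<close> and \<open>y\<close>, then deleting either pair violates the condition, and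
  adding the two violations contradicts it for their union and their intersection.\<close>

theorem marriage:
  fixes N :: "'i \<Rightarrow> 'b set"
  assumes fin: "\<And>i. i \<in> I \<Longrightarrow> finite (N i)"
    and hall: "\<And>A. finite A \<Longrightarrow> A \<subseteq> I \<Longrightarrow> card A \<le> card (\<Union>i\<in>A. N i)"
  shows "\<exists>h. inj_on h I \<and> (\<forall>i\<in>I. h i \<in> N i)"
proof -
  define R where "R = Sigma I N"
  define good where "good E \<longleftrightarrow> (\<forall>A. finite A \<longrightarrow> A \<subseteq> I \<longrightarrow> card A \<le> card (E `` A))" for E :: "('i \<times> 'b) set"
  have goodD: "card A \<le> card (E `` A)" if "good E" "finite A" "A \<subseteq> I" for E A
    using that by (simp add: good_def)
  have finR: "finite (R `` A)" if "finite A" for A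
  proof -
    have "R `` A = (\<Union>i\<in>A \<inter> I. N i)" by (auto simp: R_def)
    then show ?thesis using that fin by auto
  qed
  have finE: "finite (E `` A)" if "finite A" "E \<subseteq> R" for A E
    using finR[OF that(1)] that(2) by (meson Image_mono finite_subset order_refl)
  have goodR: "good R"
  proof -
    have "R `` A = (\<Union>i\<in>A. N i)" if "A \<subseteq> I" for A using that by (auto simp: R_def)
    then show ?thesis using hall by (simp add: good_def)
  qed
  \<comment> \<open>\<open>F\<close> is the set of deleted pairs, so a minimal relation is a maximal \<open>F\<close>\<close>
  have "\<exists>M\<in>{F. F \<subseteq> R \<and> good (R - F)}. \<forall>X\<in>{F. F \<subseteq> R \<and> good (R - F)}. M \<subseteq> X \<longrightarrow> X = M"
  proof (rule subset_Zorn_nonempty)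
    show "{F. F \<subseteq> R \<and> good (R - F)} \<noteq> {}" using goodR by (auto intro!: exI[of _ "{}"])
  next
    fix C assume C: "C \<noteq> {}" "subset.chain {F. F \<subseteq> R \<and> good (R - F)} C"
    then have CR: "F \<subseteq> R" "good (R - F)" if "F \<in> C" for F
      using that by (auto simp: subset.chain_def)
    have "good (R - \<Union>C)"
      unfolding good_def
    proof (intro allI impI)
      fix A assume A: "finite A" "A \<subseteq> I"
      obtain F where F: "F \<in> C" "\<And>F'. F' \<in> C \<Longrightarrow> 
          card {p \<in> R - F. fst p \<in> A} \<le> card {p \<in> R - F'. fst p \<in> A}"
        using C(1) ex_has_least_nat[of "\<lambda>F. F \<in> C" _ "\<lambda>F. card {p \<in> R - F. fst p \<in> A}"] by auto
      have finA: "finite {p \<in> R. fst p \<in> A}"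
      proof (rule finite_subset)
        show "{p \<in> R. fst p \<in> A} \<subseteq> A \<times> R `` A" by auto
        show "finite (A \<times> R `` A)" using A finR by simp
      qed
      have "{p \<in> R - F. fst p \<in> A} \<subseteq> {p \<in> R - F'. fst p \<in> A}" if "F' \<in> C" for F'
      proof -
        from C(2) F(1) that have "F \<subseteq> F' \<or> F' \<subseteq> F" by (simp add: subset_chain_def)
        then show ?thesis
        proof
          assume "F \<subseteq> F'"
          then have "{p \<in> R - F'. fst p \<in> A} \<subseteq> {p \<in> R - F. fst p \<in> A}" by auto
          with F(2)[OF that] have "{p \<in> R - F'. fst p \<in> A} = {p \<in> R - F. fst p \<in> A}"
            using finA by (intro card_seteq) (auto elim: rev_finite_subset)
          then show ?thesis by simp
        qed auto
      qed
      then have "(R - F) `` A \<subseteq> (R - \<Union>C) `` A" by fastforce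
      then have "card ((R - F) `` A) \<le> card ((R - \<Union>C) `` A)"
        using finE[OF A(1), of "R - \<Union>C"] by (intro card_mono) auto
      then show "card A \<le> card ((R - \<Union>C) `` A)"
        using CR(2)[OF F(1)] A by (force simp: good_def)
    qed
    then show "\<Union>C \<in> {F. F \<subseteq> R \<and> good (R - F)}" using CR by auto
  qed
  then obtain F where FM: "F \<in> {F. F \<subseteq> R \<and> good (R - F)}"
    "\<forall>X\<in>{F. F \<subseteq> R \<and> good (R - F)}. F \<subseteq> X \<longrightarrow> X = F" by (rule bexE)
  then have F: "F \<subseteq> R" "good (R - F)" by simp_all
  have Fmax: "X = F" if "X \<subseteq> R" "good (R - X)" "F \<subseteq> X" for X using FM(2) that by simp
  define E where "E = R - F"
  have E: "E \<subseteq> R" "good E" using F by (auto simp: E_def)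
  have min: "\<not> good (E - {p})" if "p \<in> E" for p
  proof
    assume "good (E - {p})"
    moreover have "E - {p} = R - insert p F" by (auto simp: E_def)
    ultimately have "insert p F = F" using Fmax[of "insert p F"] F that by (auto simp: E_def)
    then show False using that by (auto simp: E_def)
  qed
  have viol: "\<exists>A. finite A \<and> A \<subseteq> I \<and> i \<notin> A \<and> card (E `` A \<union> (E `` {i} - {x})) \<le> card A"
    if "(i, x) \<in> E" for i x
  proof -
    from min[OF that] obtain A where A: "finite A" "A \<subseteq> I" "card ((E - {(i, x)}) `` A) < card A"
      by (auto simp: good_def not_le)
    have "i \<in> A"
    proof (rule ccontr)
      assume "i \<notin> A"
      then have "(E - {(i, x)}) `` A = E `` A" by auto
      then show False using A goodD[OF E(2) A(1,2)] by simp
    qed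
    moreover have "E `` (A - {i}) \<union> (E `` {i} - {x}) \<subseteq> (E - {(i, x)}) `` A" using \<open>i \<in> A\<close> by auto
    then have "card (E `` (A - {i}) \<union> (E `` {i} - {x})) \<le> card ((E - {(i, x)}) `` A)"
      using finE[OF A(1), of "E - {(i, x)}"] E by (intro card_mono) auto
    ultimately show ?thesis using A by (intro exI[of _ "A - {i}"]) auto
  qed
  have unique: "x = y" if ix: "(i, x) \<in> E" and iy: "(i, y) \<in> E" for i x y
  proof (rule ccontr)
    assume "x \<noteq> y"
    obtain A where A: "finite A" "A \<subseteq> I" "i \<notin> A" "card (E `` A \<union> (E `` {i} - {x})) \<le> card A"
      using viol[OF ix] by (elim exE conjE)
    obtain A' where A': "finite A'" "A' \<subseteq> I" "i \<notin> A'" "card (E `` A' \<union> (E `` {i} - {y})) \<le> card A'"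
      using viol[OF iy] by (elim exE conjE)
    let ?U = "E `` A \<union> (E `` {i} - {x})" and ?U' = "E `` A' \<union> (E `` {i} - {y})"
    have iI: "i \<in> I" using ix E by (auto simp: R_def)
    have fU: "finite ?U" "finite ?U'" using A A' finE[OF _ E(1)] by auto
    have "E `` insert i (A \<union> A') = ?U \<union> ?U'" using \<open>x \<noteq> y\<close> by auto
    moreover have "card (insert i (A \<union> A')) \<le> card (E `` insert i (A \<union> A'))"
      by (rule goodD[OF E(2)]) (use A A' iI in simp_all)
    ultimately have "card (insert i (A \<union> A')) \<le> card (?U \<union> ?U')" by (simp only:)
    moreover have "card (A \<inter> A') \<le> card (E `` (A \<inter> A'))"
      by (rule goodD[OF E(2)]) (use A A' in auto)
    moreover have "card (E `` (A \<inter> A')) \<le> card (?U \<inter> ?U')"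
      using fU by (intro card_mono) auto
    moreover have "card ?U + card ?U' = card (?U \<union> ?U') + card (?U \<inter> ?U')"
      using card_Un_Int[OF fU] .
    moreover have "card A + card A' = card (A \<union> A') + card (A \<inter> A')"
      using card_Un_Int[OF A(1) A'(1)] .
    moreover have "card (insert i (A \<union> A')) = Suc (card (A \<union> A'))" using A A' by simp
    ultimately show False using A(4) A'(4) by linarith
  qed
  have ex: "\<exists>x. (i, x) \<in> E" if "i \<in> I" for i
  proof -
    have "card {i} \<le> card (E `` {i})" by (rule goodD[OF E(2)]) (use that in simp_all)
    then have "card (E `` {i}) \<noteq> 0" by simp
    then have "E `` {i} \<noteq> {}" by (metis card.empty)
    then show ?thesis by auto
  qed
  then obtain h where h: "\<And>i. i \<in> I \<Longrightarrow> (i, h i) \<in> E" by metis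
  have "inj_on h I"
  proof (rule inj_onI)
    fix i k assume ik: "i \<in> I" "k \<in> I" "h i = h k"
    show "i = k"
    proof (rule ccontr)
      assume "i \<noteq> k"
      then have 2: "card {i, k} = 2" by simp
      have "E `` {i, k} \<subseteq> {h i}"
        using unique[OF _ h[OF ik(1)]] unique[OF _ h[OF ik(2)]] ik(3) by (intro subsetI) (elim ImageE insertE; simp)
      then have "card (E `` {i, k}) \<le> 1" using card_mono[of "{h i}"] by force
      moreover have "card {i, k} \<le> card (E `` {i, k})" by (rule goodD[OF E(2)]) (use ik in simp_all)
      ultimately show False using 2 by simp
    qed
  qed
  moreover have "h i \<in> N i" if "i \<in> I" for i using h[OF that] E by (auto simp: R_def)
  ultimately show ?thesis by blast
qed

text \<open>The bijection of the Schroeder-Bernstein theorem uses only the pairs of the two given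
  injections, so it stays inside any relation that contains them.\<close>

lemma Schroeder_Bernstein_relation:
  assumes u: "inj_on u A" "\<And>x. x \<in> A \<Longrightarrow> u x \<in> B \<and> R x (u x)"
    and v: "inj_on v B" "\<And>y. y \<in> B \<Longrightarrow> v y \<in> A \<and> R (v y) y"
  shows "\<exists>h. bij_betw h A B \<and> (\<forall>x\<in>A. R x (h x))"
proof -
  define X where "X = lfp (\<lambda>X. A - v ` (B - u ` X))"
  have "mono (\<lambda>X. A - v ` (B - u ` X))" by (rule monoI) blast
  then have X: "X = A - v ` (B - u ` X)" unfolding X_def by (rule lfp_unfold)
  define h where "h x = (if x \<in> X then u x else inv_into B v x)" for x
  have XA: "X \<subseteq> A" using X by blast
  have rest: "A - X = v ` (B - u ` X)" using X v(2) by blast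
  have hv: "h (v y) = y" if "y \<in> B - u ` X" for y
    using that rest v(1) by (auto simp: h_def)
  have "inj_on h A"
  proof (rule inj_onI)
    fix x y assume xy: "x \<in> A" "y \<in> A" "h x = h y"
    have hX: "h z = u z" if "z \<in> X" for z using that by (simp add: h_def)
    have hX': "\<exists>t\<in>B - u ` X. z = v t \<and> h z = t" if "z \<in> A" "z \<notin> X" for z
    proof -
      obtain t where "t \<in> B - u ` X" "z = v t" using \<open>z \<in> A\<close> \<open>z \<notin> X\<close> rest by blast
      then show ?thesis using hv by blast
    qed
    consider "x \<in> X" "y \<in> X" | "x \<in> X" "y \<notin> X" | "x \<notin> X" "y \<in> X" | "x \<notin> X" "y \<notin> X" by blast
    then show "x = y"
    proof cases
      case 1
      then show ?thesis using xy hX u(1) XA by (metis inj_onD subsetD)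
    next
      case 2
      then show ?thesis using hX hX'[of y] xy by (metis DiffD2 imageI)
    next
      case 3
      then show ?thesis using hX hX'[of x] xy by (metis DiffD2 imageI)
    next
      case 4
      then show ?thesis using hX'[of x] hX'[of y] xy by auto
    qed
  qed
  moreover have "h ` A = B"
  proof
    show "h ` A \<subseteq> B"
    proof (rule image_subsetI)
      fix x assume "x \<in> A"
      show "h x \<in> B"
      proof (cases "x \<in> X")
        case True
        then show ?thesis using u(2) \<open>x \<in> A\<close> by (simp add: h_def)
      next
        case False
        then have "x \<in> v ` (B - u ` X)" using \<open>x \<in> A\<close> by (simp flip: rest)
        then obtain y where "y \<in> B - u ` X" "x = v y" by blast
        then show ?thesis using hv[of y] by simp
      qed
    qed
    show "B \<subseteq> h ` A"
    proof
      fix y assume "y \<in> B"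
      show "y \<in> h ` A"
      proof (cases "y \<in> u ` X")
        case True
        then obtain x where "x \<in> X" "y = u x" by blast
        then show ?thesis using XA by (intro image_eqI[of _ _ x]) (auto simp: h_def)
      next
        case False
        then show ?thesis using hv[of y] v(2) \<open>y \<in> B\<close> by (metis DiffI imageI)
      qed
    qed
  qed
  moreover have "R x (h x)" if "x \<in> A" for x
  proof (cases "x \<in> X")
    case True
    then show ?thesis using u(2) that by (simp add: h_def)
  next
    case False
    then have "x \<in> v ` (B - u ` X)" using that by (simp flip: rest)
    then obtain y where "y \<in> B - u ` X" "x = v y" by blast
    then show ?thesis using hv[of y] v(2)[of y] by simp
  qed
  ultimately show ?thesis unfolding bij_betw_def by blast
qed

text \<open>A set with a labelling is, up to a bijection that respects labels, the multiset of its
  labels given by multiplicities.\<close>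

lemma labelled_enumeration:
  assumes "\<And>l. finite {x\<in>S. f x = l}"
  shows "\<exists>k. bij_betw k {(l, i). i < card {x\<in>S. f x = l}} S \<and>
    (\<forall>l i. i < card {x\<in>S. f x = l} \<longrightarrow> f (k (l, i)) = l)"
proof -
  have "\<forall>l. \<exists>h. bij_betw h {0..<card {x\<in>S. f x = l}} {x\<in>S. f x = l}"
    using ex_bij_betw_nat_finite[OF assms] by blast
  then obtain h where h: "\<And>l. bij_betw (h l) {0..<card {x\<in>S. f x = l}} {x\<in>S. f x = l}"
    by metis
  have hin: "h l i \<in> S" "f (h l i) = l" if "i < card {x\<in>S. f x = l}" for l i
    using bij_betwE[OF h[of l]] that by auto
  define k where "k = (\<lambda>(l, i). h l i)"
  have "inj_on k {(l, i). i < card {x\<in>S. f x = l}}"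
  proof (rule inj_onI, clarsimp simp: k_def)
    fix l i l' i'
    assume a: "i < card {x\<in>S. f x = l}" "i' < card {x\<in>S. f x = l'}" "h l i = h l' i'"
    then have "l = l'" using hin by metis
    with a show "l = l' \<and> i = i'" using bij_betw_imp_inj_on[OF h[of l]] by (auto dest: inj_onD)
  qed
  moreover have "k ` {(l, i). i < card {x\<in>S. f x = l}} = S"
  proof
    show "k ` {(l, i). i < card {x\<in>S. f x = l}} \<subseteq> S" using hin by (auto simp: k_def)
    show "S \<subseteq> k ` {(l, i). i < card {x\<in>S. f x = l}}"
    proof
      fix x assume "x \<in> S"
      then have "x \<in> h (f x) ` {0..<card {y\<in>S. f y = f x}}"
        using bij_betw_imp_surj_on[OF h[of "f x"]] by auto
      then show "x \<in> k ` {(l, i). i < card {x\<in>S. f x = l}}" by (force simp: k_def)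
    qed
  qed
  ultimately show ?thesis using hin by (intro exI[of _ k]) (auto simp: bij_betw_def k_def)
qed

section \<open>Bases of cycles adapted to births and deaths\<close>

definition linear_subspace :: "('a \<Rightarrow> complex) set \<Rightarrow> bool" where
  "linear_subspace V \<longleftrightarrow>
     (\<lambda>_. 0) \<in> V \<and> (\<forall>x\<in>V. \<forall>y\<in>V. \<forall>c. (\<lambda>s. x s + c * y s) \<in> V)"

lemma linear_subspaceD:
  assumes "linear_subspace V"
  shows "(\<lambda>_. 0) \<in> V" "\<And>x y c. x \<in> V \<Longrightarrow> y \<in> V \<Longrightarrow> (\<lambda>s. x s + c * y s) \<in> V"
  using assms by (auto simp: linear_subspace_def)

lemma linear_subspace_sum:
  assumes "linear_subspace V" "finite S" "\<And>j. j \<in> S \<Longrightarrow> c j \<noteq> 0 \<Longrightarrow> e j \<in> V"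
  shows "(\<lambda>s. \<Sum>j\<in>S. c j * e j s) \<in> V"
  using assms(2,3)
proof (induction S rule: finite_induct)
  case empty
  then show ?case using linear_subspaceD(1)[OF assms(1)] by simp
next
  case (insert j S)
  show ?case
  proof (cases "c j = 0")
    case True
    then show ?thesis using insert by simp
  next
    case False
    then have "(\<lambda>s. (\<Sum>j\<in>S. c j * e j s) + c j * e j s) \<in> V"
      using insert by (intro linear_subspaceD(2)[OF assms(1)]) auto
    then show ?thesis using insert(1,2) by (simp add: add.commute)
  qed
qed

text \<open>Levels, with ties broken by an enumeration, give every simplex only finitely many
  predecessors; counting them turns the filtration into one by single simplices.\<close>

lemma ex_rank_refining:
  fixes f :: "'a \<Rightarrow> real"
  assumes fin: "\<And>a. finite {\<sigma>\<in>K. f \<sigma> \<le> a}"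
  shows "\<exists>rk :: 'a \<Rightarrow> nat. inj_on rk K \<and> (\<forall>\<sigma>\<in>K. \<forall>\<tau>\<in>K. f \<sigma> < f \<tau> \<longrightarrow> rk \<sigma> < rk \<tau>)"
proof -
  have "K = (\<Union>n. {\<sigma>\<in>K. f \<sigma> \<le> real n})" using real_arch_simple by auto
  moreover have "countable (\<Union>n. {\<sigma>\<in>K. f \<sigma> \<le> real n})"
    using fin by (intro countable_UN) (auto intro: countable_finite)
  ultimately have "countable K" by simp
  define r where "r = to_nat_on K"
  have r: "inj_on r K" unfolding r_def by (rule inj_on_to_nat_on) fact
  define L where "L \<sigma> \<tau> \<longleftrightarrow> f \<sigma> < f \<tau> \<or> f \<sigma> = f \<tau> \<and> r \<sigma> < r \<tau>" for \<sigma> \<tau>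
  define rk where "rk \<tau> = card {\<sigma>\<in>K. L \<sigma> \<tau>}" for \<tau>
  have finL: "finite {\<sigma>\<in>K. L \<sigma> \<tau>}" for \<tau>
    by (rule finite_subset[OF _ fin[of "f \<tau>"]]) (auto simp: L_def)
  have less: "rk \<sigma> < rk \<tau>" if "\<sigma> \<in> K" "L \<sigma> \<tau>" for \<sigma> \<tau>
    unfolding rk_def
  proof (rule psubset_card_mono[OF finL])
    have "{\<rho>\<in>K. L \<rho> \<sigma>} \<subseteq> {\<rho>\<in>K. L \<rho> \<tau>}" using that by (auto simp: L_def)
    moreover have "\<sigma> \<in> {\<rho>\<in>K. L \<rho> \<tau>}" "\<sigma> \<notin> {\<rho>\<in>K. L \<rho> \<sigma>}" using that by (auto simp: L_def)
    ultimately show "{\<rho>\<in>K. L \<rho> \<sigma>} \<subset> {\<rho>\<in>K. L \<rho> \<tau>}" by blast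
  qed
  have "inj_on rk K"
  proof (rule inj_onI, rule ccontr)
    fix \<sigma> \<tau> assume *: "\<sigma> \<in> K" "\<tau> \<in> K" "rk \<sigma> = rk \<tau>" "\<sigma> \<noteq> \<tau>"
    then have "r \<sigma> \<noteq> r \<tau>" using r by (auto dest: inj_onD)
    then have "L \<sigma> \<tau> \<or> L \<tau> \<sigma>" by (auto simp: L_def)
    then show False using less * by fastforce
  qed
  moreover have "\<forall>\<sigma>\<in>K. \<forall>\<tau>\<in>K. f \<sigma> < f \<tau> \<longrightarrow> rk \<sigma> < rk \<tau>" using less by (simp add: L_def)
  ultimately show ?thesis by blast
qed

text \<open>A space of cycles with a filtration by boundaries.  The last assumption says that the
  boundaries at level \<open>a\<close> depend only on the sublevel set and not on the number \<open>a\<close>; since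
  sublevel sets are finite, it is what makes minimal deaths exist.\<close>

locale cycle_filtration =
  fixes K :: "'a set" and f :: "'a \<Rightarrow> real"
    and Z :: "('a \<Rightarrow> complex) set" and B :: "real \<Rightarrow> ('a \<Rightarrow> complex) set"
  assumes finite_sublevel: "\<And>a. finite {\<sigma>\<in>K. f \<sigma> \<le> a}"
    and subspace_Z: "linear_subspace Z"
    and finite_support: "\<And>z. z \<in> Z \<Longrightarrow> finite {\<sigma>. z \<sigma> \<noteq> 0}"
    and support_in: "\<And>z \<sigma>. z \<in> Z \<Longrightarrow> z \<sigma> \<noteq> 0 \<Longrightarrow> \<sigma> \<in> K"
    and subspace_B: "\<And>a. linear_subspace (B a)"
    and B_cycle: "\<And>x a. x \<in> B a \<Longrightarrow> x \<in> Z"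
    and B_level: "\<And>x a \<sigma>. x \<in> B a \<Longrightarrow> x \<sigma> \<noteq> 0 \<Longrightarrow> f \<sigma> \<le> a"
    and B_mono: "\<And>a b. {\<sigma>\<in>K. f \<sigma> \<le> a} \<subseteq> {\<sigma>\<in>K. f \<sigma> \<le> b} \<Longrightarrow> B a \<subseteq> B b"
begin

definition rk :: "'a \<Rightarrow> nat" where
  "rk = (SOME r. inj_on r K \<and> (\<forall>\<sigma>\<in>K. \<forall>\<tau>\<in>K. f \<sigma> < f \<tau> \<longrightarrow> r \<sigma> < r \<tau>))"

lemma rk: "inj_on rk K" "\<sigma> \<in> K \<Longrightarrow> \<tau> \<in> K \<Longrightarrow> f \<sigma> < f \<tau> \<Longrightarrow> rk \<sigma> < rk \<tau>"
  using someI_ex[OF ex_rank_refining[OF finite_sublevel]] unfolding rk_def[symmetric] by blast+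

lemma f_mono_rk: "\<sigma> \<in> K \<Longrightarrow> \<tau> \<in> K \<Longrightarrow> rk \<sigma> \<le> rk \<tau> \<Longrightarrow> f \<sigma> \<le> f \<tau>"
  using rk(2)[of \<tau> \<sigma>] by linarith

definition leads :: "('a \<Rightarrow> complex) \<Rightarrow> 'a \<Rightarrow> bool" where
  "leads z \<sigma> \<longleftrightarrow> z \<sigma> \<noteq> 0 \<and> (\<forall>\<tau>. z \<tau> \<noteq> 0 \<longrightarrow> rk \<tau> \<le> rk \<sigma>)"

definition pivots :: "'a set" where
  "pivots = {\<sigma>. \<exists>z\<in>Z. leads z \<sigma>}"

lemma pivots_subset: "pivots \<subseteq> K"
  using support_in by (auto simp: pivots_def leads_def)

lemma leads_level: "z \<in> Z \<Longrightarrow> leads z \<sigma> \<Longrightarrow> z \<tau> \<noteq> 0 \<Longrightarrow> f \<tau> \<le> f \<sigma>"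
  using support_in by (auto simp: leads_def intro!: f_mono_rk)

text \<open>The boundary spaces form a chain that is well-ordered from below, because \<open>B a\<close> depends
  only on the finite set of simplices at level at most \<open>a\<close>.  So among all cycles with the
  same leading simplex there is one that becomes a boundary no later than any other.\<close>

lemma ex_earliest_dying:
  assumes "\<sigma> \<in> pivots"
  shows "\<exists>z. z \<in> Z \<and> leads z \<sigma> \<and> (\<forall>x\<in>Z. leads x \<sigma> \<longrightarrow> (\<forall>a. x \<in> B a \<longrightarrow> z \<in> B a))"
proof (cases "\<exists>x\<in>Z. leads x \<sigma> \<and> (\<exists>a. x \<in> B a)")
  case True
  define n where "n = (\<lambda>a. card {\<sigma>\<in>K. f \<sigma> \<le> a})"
  from True have "\<exists>a. \<exists>x\<in>Z. leads x \<sigma> \<and> x \<in> B a" by blast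
  then obtain a where a: "\<exists>x\<in>Z. leads x \<sigma> \<and> x \<in> B a"
    and least: "\<And>b. (\<exists>x\<in>Z. leads x \<sigma> \<and> x \<in> B b) \<Longrightarrow> n a \<le> n b"
    using ex_has_least_nat[of "\<lambda>a. \<exists>x\<in>Z. leads x \<sigma> \<and> x \<in> B a" _ n] by blast
  from a obtain z where z: "z \<in> Z" "leads z \<sigma>" "z \<in> B a" by blast
  have "z \<in> B b" if "x \<in> Z" "leads x \<sigma>" "x \<in> B b" for x b
  proof -
    have "n a \<le> n b" using least that by blast
    have "{\<sigma>\<in>K. f \<sigma> \<le> a} \<subseteq> {\<sigma>\<in>K. f \<sigma> \<le> b}"
    proof (cases "a \<le> b")
      case False
      then have "{\<sigma>\<in>K. f \<sigma> \<le> b} \<subseteq> {\<sigma>\<in>K. f \<sigma> \<le> a}" by auto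
      then show ?thesis using \<open>n a \<le> n b\<close> finite_sublevel unfolding n_def
        by (metis card_seteq order_refl)
    qed auto
    then show ?thesis using B_mono z(3) by blast
  qed
  then show ?thesis using z by blast
next
  case False
  then show ?thesis using assms by (auto simp: pivots_def)
qed

definition gen :: "'a \<Rightarrow> 'a \<Rightarrow> complex" where
  "gen \<sigma> = (SOME z. z \<in> Z \<and> leads z \<sigma> \<and>
     (\<forall>x\<in>Z. leads x \<sigma> \<longrightarrow> (\<forall>a. x \<in> B a \<longrightarrow> z \<in> B a)))"

lemma
  assumes "\<sigma> \<in> pivots"
  shows gen_cycle: "gen \<sigma> \<in> Z" and gen_leads: "leads (gen \<sigma>) \<sigma>"
    and gen_earliest: "x \<in> Z \<Longrightarrow> leads x \<sigma> \<Longrightarrow> x \<in> B a \<Longrightarrow> gen \<sigma> \<in> B a"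
  using someI_ex[OF ex_earliest_dying[OF assms]] unfolding gen_def[symmetric] by blast+

lemma gen_level: "\<sigma> \<in> pivots \<Longrightarrow> gen \<sigma> \<tau> \<noteq> 0 \<Longrightarrow> f \<tau> \<le> f \<sigma>"
  using leads_level gen_cycle gen_leads by blast

lemma gen_nonzero: "\<sigma> \<in> pivots \<Longrightarrow> gen \<sigma> \<sigma> \<noteq> 0"
  using gen_leads by (auto simp: leads_def)

text \<open>Successive cancellation of leading terms.  A cycle at level \<open>a\<close>, or in \<open>B a\<close>, only
  meets generators with the same property: this is clear for the level, and for the
  boundaries it is the reason for choosing generators that die as early as possible.\<close>

lemma ex_expansion:
  assumes "z \<in> Z"
  shows "\<exists>c. finite {j. c j \<noteq> 0} \<and> {j. c j \<noteq> 0} \<subseteq> pivots \<and>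
    z = (\<lambda>\<tau>. \<Sum>j | c j \<noteq> 0. c j * gen j \<tau>) \<and>
    (\<forall>a. (\<forall>\<tau>. z \<tau> \<noteq> 0 \<longrightarrow> f \<tau> \<le> a) \<longrightarrow> (\<forall>j. c j \<noteq> 0 \<longrightarrow> f j \<le> a)) \<and>
    (\<forall>a. z \<in> B a \<longrightarrow> (\<forall>j. c j \<noteq> 0 \<longrightarrow> gen j \<in> B a))"
proof -
  have "\<exists>c. finite {j. c j \<noteq> 0} \<and> {j. c j \<noteq> 0} \<subseteq> pivots \<and> (\<forall>j. c j \<noteq> 0 \<longrightarrow> rk j < k) \<and>
    z = (\<lambda>\<tau>. \<Sum>j | c j \<noteq> 0. c j * gen j \<tau>) \<and>
    (\<forall>a. (\<forall>\<tau>. z \<tau> \<noteq> 0 \<longrightarrow> f \<tau> \<le> a) \<longrightarrow> (\<forall>j. c j \<noteq> 0 \<longrightarrow> f j \<le> a)) \<and>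
    (\<forall>a. z \<in> B a \<longrightarrow> (\<forall>j. c j \<noteq> 0 \<longrightarrow> gen j \<in> B a))"
    if "z \<in> Z" "\<forall>\<tau>. z \<tau> \<noteq> 0 \<longrightarrow> rk \<tau> < k" for k z
    using that
  proof (induction k arbitrary: z)
    case 0
    then have "z = (\<lambda>\<tau>. 0)" by auto
    then show ?case by (intro exI[of _ "\<lambda>_. 0"]) auto
  next
    case (Suc k)
    show ?case
    proof (cases "\<exists>\<sigma>. z \<sigma> \<noteq> 0 \<and> rk \<sigma> = k")
      case False
      then have "\<forall>\<tau>. z \<tau> \<noteq> 0 \<longrightarrow> rk \<tau> < k" using Suc.prems(2) by (metis less_SucE)
      from Suc.IH[OF Suc.prems(1) this] obtain c where "finite {j. c j \<noteq> 0}"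
        "{j. c j \<noteq> 0} \<subseteq> pivots" "\<forall>j. c j \<noteq> 0 \<longrightarrow> rk j < k" and
        c: "z = (\<lambda>\<tau>. \<Sum>j | c j \<noteq> 0. c j * gen j \<tau>)"
        "(\<forall>a. (\<forall>\<tau>. z \<tau> \<noteq> 0 \<longrightarrow> f \<tau> \<le> a) \<longrightarrow> (\<forall>j. c j \<noteq> 0 \<longrightarrow> f j \<le> a))"
        "(\<forall>a. z \<in> B a \<longrightarrow> (\<forall>j. c j \<noteq> 0 \<longrightarrow> gen j \<in> B a))" by (elim exE conjE)
      then show ?thesis by (intro exI[of _ c] conjI; (rule c)?) (auto simp: less_Suc_eq)
    next
      case True
      then obtain \<sigma> where \<sigma>: "z \<sigma> \<noteq> 0" "rk \<sigma> = k" by blast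
      then have lead: "leads z \<sigma>" using Suc.prems(2) by (auto simp: leads_def less_Suc_eq_le)
      then have piv: "\<sigma> \<in> pivots" using Suc.prems(1) by (auto simp: pivots_def)
      define t where "t = z \<sigma> / gen \<sigma> \<sigma>"
      have t0: "t \<noteq> 0" using \<sigma> gen_nonzero[OF piv] by (simp add: t_def)
      define y where "y = (\<lambda>\<tau>. z \<tau> + (- t) * gen \<sigma> \<tau>)"
      have yZ: "y \<in> Z" unfolding y_def
        by (rule linear_subspaceD(2)[OF subspace_Z Suc.prems(1) gen_cycle[OF piv]])
      have y\<sigma>: "y \<sigma> = 0" using gen_nonzero[OF piv] by (simp add: y_def t_def)
      have "rk \<tau> < k" if "y \<tau> \<noteq> 0" for \<tau>
      proof -
        have "z \<tau> \<noteq> 0 \<or> gen \<sigma> \<tau> \<noteq> 0" using that by (auto simp: y_def)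
        then have "rk \<tau> \<le> rk \<sigma>" using lead gen_leads[OF piv] by (auto simp: leads_def)
        moreover have "\<tau> \<noteq> \<sigma>" using that y\<sigma> by auto
        then have "rk \<tau> \<noteq> rk \<sigma>"
          using rk(1) support_in[OF yZ that] pivots_subset piv by (auto dest: inj_onD)
        ultimately show ?thesis using \<sigma> by simp
      qed
      with Suc.IH[OF yZ] obtain c where
        c: "finite {j. c j \<noteq> 0}" "{j. c j \<noteq> 0} \<subseteq> pivots" "\<forall>j. c j \<noteq> 0 \<longrightarrow> rk j < k"
        "y = (\<lambda>\<tau>. \<Sum>j | c j \<noteq> 0. c j * gen j \<tau>)"
        "\<forall>a. (\<forall>\<tau>. y \<tau> \<noteq> 0 \<longrightarrow> f \<tau> \<le> a) \<longrightarrow> (\<forall>j. c j \<noteq> 0 \<longrightarrow> f j \<le> a)"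
        "\<forall>a. y \<in> B a \<longrightarrow> (\<forall>j. c j \<noteq> 0 \<longrightarrow> gen j \<in> B a)" by auto
      define c' where "c' = c(\<sigma> := t)"
      have c\<sigma>: "c \<sigma> = 0" using c(3) \<sigma>(2) by auto
      have set: "{j. c' j \<noteq> 0} = insert \<sigma> {j. c j \<noteq> 0}" using t0 by (auto simp: c'_def)
      have z: "z = (\<lambda>\<tau>. \<Sum>j | c' j \<noteq> 0. c' j * gen j \<tau>)"
      proof
        fix \<tau>
        have "(\<Sum>j | c' j \<noteq> 0. c' j * gen j \<tau>)
            = c' \<sigma> * gen \<sigma> \<tau> + (\<Sum>j | c j \<noteq> 0. c' j * gen j \<tau>)"
          unfolding set using c(1) c\<sigma> by simp
        also have "(\<Sum>j | c j \<noteq> 0. c' j * gen j \<tau>) = y \<tau>"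
          unfolding c(4) by (rule sum.cong) (use c\<sigma> in \<open>auto simp: c'_def\<close>)
        finally show "z \<tau> = (\<Sum>j | c' j \<noteq> 0. c' j * gen j \<tau>)" by (simp add: y_def c'_def)
      qed
      have lev: "f j \<le> a" if a: "\<forall>\<tau>. z \<tau> \<noteq> 0 \<longrightarrow> f \<tau> \<le> a" and j: "c' j \<noteq> 0" for a j
      proof (cases "j = \<sigma>")
        case True
        then show ?thesis using a \<sigma> by simp
      next
        case False
        have "f \<tau> \<le> a" if "y \<tau> \<noteq> 0" for \<tau>
        proof -
          have "z \<tau> \<noteq> 0 \<or> gen \<sigma> \<tau> \<noteq> 0" using that by (auto simp: y_def)
          then show ?thesis using a \<sigma>(1) gen_level[OF piv, of \<tau>] by force
        qed
        then show ?thesis using c(5) j False by (auto simp: c'_def)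
      qed
      have bd: "gen j \<in> B a" if a: "z \<in> B a" and j: "c' j \<noteq> 0" for a j
      proof -
        have g: "gen \<sigma> \<in> B a" by (rule gen_earliest[OF piv Suc.prems(1) lead a])
        have "y \<in> B a" unfolding y_def by (rule linear_subspaceD(2)[OF subspace_B a g])
        then show ?thesis using c(6) g j by (auto simp: c'_def split: if_splits)
      qed
      have "{j. c' j \<noteq> 0} \<subseteq> pivots" "finite {j. c' j \<noteq> 0}" unfolding set using c piv by auto
      moreover have "\<forall>j. c' j \<noteq> 0 \<longrightarrow> rk j < Suc k" using c(3) \<sigma> by (auto simp: c'_def less_Suc_eq)
      ultimately show ?thesis by (intro exI[of _ c']) (use z lev bd in blast)
    qed
  qed
  note expand = this
  obtain k where k: "\<forall>\<tau>. z \<tau> \<noteq> 0 \<longrightarrow> rk \<tau> < k"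
  proof -
    have "finite (rk ` {\<tau>. z \<tau> \<noteq> 0})" using finite_support[OF assms] by simp
    then obtain k where "\<forall>i \<in> rk ` {\<tau>. z \<tau> \<noteq> 0}. i < k" by (auto simp: finite_nat_set_iff_bounded)
    then show thesis using that by auto
  qed
  from expand[OF assms k] show ?thesis by (elim exE conjE) (intro exI conjI; assumption)
qed

text \<open>Distinct generators have distinct leading simplices, so no nontrivial combination of
  them vanishes.\<close>

lemma gen_independent:
  assumes "finite S" "S \<subseteq> pivots" "\<And>\<tau>. (\<Sum>j\<in>S. c j * gen j \<tau>) = 0" "j \<in> S"
  shows "c j = 0"
proof (rule ccontr)
  assume "c j \<noteq> 0"
  let ?M = "rk ` {j\<in>S. c j \<noteq> 0}"
  have fin: "finite ?M" "?M \<noteq> {}" using assms \<open>c j \<noteq> 0\<close> by auto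
  from Max_in[OF this] obtain m where m: "m \<in> S" "c m \<noteq> 0" "rk m = Max ?M" by auto
  have max: "rk i \<le> rk m" if "i \<in> S" "c i \<noteq> 0" for i
    using Max_ge[OF fin(1)] that m(3) by auto
  have "c i * gen i m = 0" if i: "i \<in> S" "i \<noteq> m" for i
  proof (cases "c i = 0")
    case False
    have "rk i \<noteq> rk m" using i m(1) assms(2) pivots_subset rk(1) by (metis inj_onD subsetD)
    then have "rk i < rk m" using max[OF i(1) False] by simp
    then have "gen i m = 0" using gen_leads[of i] i(1) assms(2) unfolding leads_def
      by (metis not_le subsetD)
    then show ?thesis by simp
  qed simp
  then have "(\<Sum>i\<in>S. c i * gen i m) = c m * gen m m"
    using assms(1) m(1) by (simp add: sum.remove[of S m] sum.neutral)
  then show False using assms(2,3) m gen_nonzero by auto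
qed

definition coord :: "('a \<Rightarrow> complex) \<Rightarrow> 'a \<Rightarrow> complex" where
  "coord z = (SOME c. finite {j. c j \<noteq> 0} \<and> {j. c j \<noteq> 0} \<subseteq> pivots \<and>
    z = (\<lambda>\<tau>. \<Sum>j | c j \<noteq> 0. c j * gen j \<tau>) \<and>
    (\<forall>a. (\<forall>\<tau>. z \<tau> \<noteq> 0 \<longrightarrow> f \<tau> \<le> a) \<longrightarrow> (\<forall>j. c j \<noteq> 0 \<longrightarrow> f j \<le> a)) \<and>
    (\<forall>a. z \<in> B a \<longrightarrow> (\<forall>j. c j \<noteq> 0 \<longrightarrow> gen j \<in> B a)))"

lemma
  assumes "z \<in> Z"
  shows finite_coord: "finite {j. coord z j \<noteq> 0}"
    and coord_pivot: "coord z j \<noteq> 0 \<Longrightarrow> j \<in> pivots"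
    and coord_sum: "(\<Sum>j | coord z j \<noteq> 0. coord z j * gen j \<tau>) = z \<tau>"
    and coord_level: "(\<And>\<tau>. z \<tau> \<noteq> 0 \<Longrightarrow> f \<tau> \<le> a) \<Longrightarrow> coord z j \<noteq> 0 \<Longrightarrow> f j \<le> a"
    and coord_boundary: "z \<in> B a \<Longrightarrow> coord z j \<noteq> 0 \<Longrightarrow> gen j \<in> B a"
proof -
  note * = someI_ex[OF ex_expansion[OF assms], folded coord_def]
  from * show "finite {j. coord z j \<noteq> 0}" by blast
  from * show "j \<in> pivots" if "coord z j \<noteq> 0" using that by blast
  from * have "z = (\<lambda>\<tau>. \<Sum>j | coord z j \<noteq> 0. coord z j * gen j \<tau>)" by blast
  from fun_cong[OF this, of \<tau>] show "(\<Sum>j | coord z j \<noteq> 0. coord z j * gen j \<tau>) = z \<tau>" by simp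
  from * show "f j \<le> a" if "\<And>\<tau>. z \<tau> \<noteq> 0 \<Longrightarrow> f \<tau> \<le> a" "coord z j \<noteq> 0" using that by blast
  from * show "gen j \<in> B a" if "z \<in> B a" "coord z j \<noteq> 0" using that by blast
qed

lemma coord_sum_superset:
  assumes "z \<in> Z" "finite S" "\<And>j. coord z j \<noteq> 0 \<Longrightarrow> j \<in> S"
  shows "(\<Sum>j\<in>S. coord z j * gen j \<tau>) = z \<tau>"
proof -
  have "(\<Sum>j\<in>S. coord z j * gen j \<tau>) = (\<Sum>j | coord z j \<noteq> 0. coord z j * gen j \<tau>)"
    by (rule sum.mono_neutral_right) (use assms(2,3) in auto)
  then show ?thesis using coord_sum[OF assms(1)] by simp
qed

lemma coord_eqI:
  assumes "z \<in> Z" "finite S" "S \<subseteq> pivots" "\<And>j. j \<notin> S \<Longrightarrow> c j = 0"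
    and "\<And>\<tau>. z \<tau> = (\<Sum>j\<in>S. c j * gen j \<tau>)"
  shows "coord z = c"
proof
  fix i
  let ?S = "S \<union> {j. coord z j \<noteq> 0}"
  have fin: "finite ?S" using finite_coord[OF assms(1)] assms(2) by simp
  have "(\<Sum>j\<in>?S. (coord z j - c j) * gen j \<tau>) = 0" for \<tau>
  proof -
    have "(\<Sum>j\<in>?S. c j * gen j \<tau>) = (\<Sum>j\<in>S. c j * gen j \<tau>)"
      by (rule sum.mono_neutral_right) (use assms(4) fin in auto)
    then have "(\<Sum>j\<in>?S. c j * gen j \<tau>) = z \<tau>" using assms(5)[of \<tau>] by simp
    then show ?thesis using coord_sum_superset[OF assms(1) fin] by (simp add: left_diff_distrib sum_subtractf)
  qed
  moreover have "?S \<subseteq> pivots" using assms(3) coord_pivot[OF assms(1)] by auto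
  ultimately have "coord z j - c j = 0" if "j \<in> ?S" for j
    using gen_independent[OF fin, of "\<lambda>j. coord z j - c j"] that by blast
  then show "coord z i = c i" using assms(4)[of i] by (cases "i \<in> ?S") auto
qed

lemma coord_combination:
  assumes "finite S" "S \<subseteq> pivots" "\<And>j. j \<notin> S \<Longrightarrow> c j = 0"
  shows "coord (\<lambda>\<tau>. \<Sum>j\<in>S. c j * gen j \<tau>) = c"
proof (rule coord_eqI[OF _ assms])
  show "(\<lambda>\<tau>. \<Sum>j\<in>S. c j * gen j \<tau>) \<in> Z"
    by (rule linear_subspace_sum[OF subspace_Z assms(1)]) (use assms(2) gen_cycle in blast)
qed simp_all

lemma coord_add_scaled:
  assumes "x \<in> Z" "y \<in> Z"
  shows "coord (\<lambda>\<tau>. x \<tau> + t * y \<tau>) = (\<lambda>j. coord x j + t * coord y j)"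
proof (rule coord_eqI)
  let ?S = "{j. coord x j \<noteq> 0} \<union> {j. coord y j \<noteq> 0}"
  show "(\<lambda>\<tau>. x \<tau> + t * y \<tau>) \<in> Z" by (rule linear_subspaceD(2)[OF subspace_Z assms])
  show fin: "finite ?S" using finite_coord assms by simp
  show "?S \<subseteq> pivots" using coord_pivot assms by auto
  show "x \<tau> + t * y \<tau> = (\<Sum>j\<in>?S. (coord x j + t * coord y j) * gen j \<tau>)" for \<tau>
    using coord_sum_superset[OF assms(1) fin, of \<tau>] coord_sum_superset[OF assms(2) fin, of \<tau>]
    by (simp add: distrib_right sum.distrib mult.assoc flip: sum_distrib_left)
qed auto

lemma coord_gen: "j \<in> pivots \<Longrightarrow> coord (gen j) = (\<lambda>i. if i = j then 1 else 0)"
  by (rule coord_eqI[of _ "{j}"]) (auto intro: gen_cycle)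

lemma coord_lincomb:
  assumes "finite S" "\<And>j. j \<in> S \<Longrightarrow> x j \<in> Z"
  shows "coord (\<lambda>\<tau>. \<Sum>j\<in>S. c j * x j \<tau>) k = (\<Sum>j\<in>S. c j * coord (x j) k)"
  using assms
proof (induction S rule: finite_induct)
  case empty
  have "coord (\<lambda>\<tau>. 0) = (\<lambda>j. 0)"
    by (rule coord_eqI[of _ "{}"]) (simp_all add: linear_subspaceD(1)[OF subspace_Z])
  then show ?case by simp
next
  case (insert j S)
  have "(\<lambda>\<tau>. \<Sum>j\<in>S. c j * x j \<tau>) \<in> Z"
    using insert by (intro linear_subspace_sum[OF subspace_Z]) auto
  from coord_add_scaled[OF this, of "x j" "c j"] show ?case
    using insert by (simp add: add.commute)
qed

text \<open>The infimum is attained whenever it is finite, because the sublevel sets only change at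
  the finitely many values of \<open>f\<close> below a given level, and then at the value itself.\<close>

definition death :: "'a \<Rightarrow> ereal" where
  "death \<sigma> = Inf (ereal ` {a. gen \<sigma> \<in> B a})"

lemma death_le_iff:
  assumes "\<sigma> \<in> pivots"
  shows "death \<sigma> \<le> ereal a \<longleftrightarrow> gen \<sigma> \<in> B a"
proof (cases "\<exists>a. gen \<sigma> \<in> B a")
  case False
  then show ?thesis by (simp add: death_def top_ereal_def)
next
  case True
  define n where "n = (\<lambda>a. card {\<sigma>\<in>K. f \<sigma> \<le> a})"
  obtain a0 where a0: "gen \<sigma> \<in> B a0" and least: "\<And>b. gen \<sigma> \<in> B b \<Longrightarrow> n a0 \<le> n b"
    using True ex_has_least_nat[of "\<lambda>a. gen \<sigma> \<in> B a" _ n] by blast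
  let ?F = "f ` {\<sigma>\<in>K. f \<sigma> \<le> a0}"
  have "\<sigma> \<in> {\<sigma>\<in>K. f \<sigma> \<le> a0}"
    using B_level[OF a0 gen_nonzero[OF assms]] assms pivots_subset by auto
  then have F: "finite ?F" "?F \<noteq> {}" using finite_sublevel[of a0] by auto
  define a1 where "a1 = Max ?F"
  have a1: "a1 \<in> ?F" using Max_in[OF F] by (simp add: a1_def)
  have same: "{\<sigma>\<in>K. f \<sigma> \<le> a1} = {\<sigma>\<in>K. f \<sigma> \<le> a0}"
    using a1 Max_ge[OF F(1)] by (auto simp: a1_def[symmetric])
  have ga1: "gen \<sigma> \<in> B a1" using B_mono[of a0 a1] same a0 by blast
  have iff: "gen \<sigma> \<in> B b \<longleftrightarrow> a1 \<le> b" for b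
  proof
    assume "a1 \<le> b"
    then have "{\<sigma>\<in>K. f \<sigma> \<le> a1} \<subseteq> {\<sigma>\<in>K. f \<sigma> \<le> b}" by auto
    then show "gen \<sigma> \<in> B b" using B_mono ga1 by blast
  next
    assume b: "gen \<sigma> \<in> B b"
    show "a1 \<le> b"
    proof (rule ccontr)
      assume "\<not> a1 \<le> b"
      obtain \<tau> where \<tau>: "\<tau> \<in> K" "f \<tau> = a1" using a1 by blast
      have "{\<sigma>\<in>K. f \<sigma> \<le> b} \<subset> {\<sigma>\<in>K. f \<sigma> \<le> a1}"
        using \<open>\<not> a1 \<le> b\<close> \<tau> by (intro psubsetI) auto
      then have "n b < n a0" unfolding n_def same by (rule psubset_card_mono[OF finite_sublevel])
      then show False using least[OF b] by simp
    qed
  qed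
  have "death \<sigma> = ereal a1" unfolding death_def iff
    by (rule antisym) (auto intro!: INF_lower2[of a1] INF_greatest)
  then show ?thesis using iff by simp
qed

lemma birth_le_death:
  assumes "\<sigma> \<in> pivots"
  shows "ereal (f \<sigma>) \<le> death \<sigma>"
  unfolding death_def
proof (rule INF_greatest)
  fix a assume "a \<in> {a. gen \<sigma> \<in> B a}"
  then show "ereal (f \<sigma>) \<le> ereal a" using B_level gen_nonzero[OF assms] by auto
qed

end

section \<open>Matching two filtrations of the same space of cycles\<close>

locale cycle_filtration_pair =
  F: cycle_filtration K f Z B + G: cycle_filtration K g Z B'
  for K :: "'a set" and f g :: "'a \<Rightarrow> real"
    and Z :: "('a \<Rightarrow> complex) set" and B B' :: "real \<Rightarrow> ('a \<Rightarrow> complex) set" +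
  fixes \<epsilon> :: real
  assumes level_close: "\<And>\<sigma>. \<sigma> \<in> K \<Longrightarrow> \<bar>f \<sigma> - g \<sigma>\<bar> \<le> \<epsilon>"
    and B_shift: "\<And>a. B a \<subseteq> B' (a + \<epsilon>)" and B'_shift: "\<And>a. B' a \<subseteq> B (a + \<epsilon>)"
begin

definition close :: "'a \<Rightarrow> 'a \<Rightarrow> bool" where
  "close i j \<longleftrightarrow> \<bar>f i - g j\<bar> \<le> \<epsilon> \<and> F.death i \<le> G.death j + ereal \<epsilon> \<and> G.death j \<le> F.death i + ereal \<epsilon>"

text \<open>The cycle \<open>F.gen i\<close> is born and dies for \<open>g\<close> at most \<open>\<epsilon>\<close> later than for \<open>f\<close>, and the
  generators for \<open>g\<close> in its expansion are born and die no later than the cycle itself.\<close>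

lemma coord_transfer:
  assumes i: "i \<in> F.pivots" and j: "G.coord (F.gen i) j \<noteq> 0"
  shows "j \<in> G.pivots" "g j \<le> f i + \<epsilon>" "G.death j \<le> F.death i + ereal \<epsilon>"
proof -
  note iZ = F.gen_cycle[OF i]
  show jG: "j \<in> G.pivots" by (rule G.coord_pivot[OF iZ j])
  show "g j \<le> f i + \<epsilon>"
  proof (rule G.coord_level[OF iZ _ j])
    fix \<tau> assume \<tau>: "F.gen i \<tau> \<noteq> 0"
    then have "f \<tau> \<le> f i" "\<tau> \<in> K" using F.gen_level[OF i] F.support_in[OF iZ] by auto
    then show "g \<tau> \<le> f i + \<epsilon>" using level_close[of \<tau>] by linarith
  qed
  show "G.death j \<le> F.death i + ereal \<epsilon>"
  proof (cases "F.death i")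
    case (real a)
    then have "F.gen i \<in> B a" using F.death_le_iff[OF i, of a] by simp
    then have "F.gen i \<in> B' (a + \<epsilon>)" using B_shift by blast
    then have "G.gen j \<in> B' (a + \<epsilon>)" by (rule G.coord_boundary[OF iZ _ j])
    then show ?thesis using G.death_le_iff[OF jG] real by simp
  next
    case MInf
    then show ?thesis using F.birth_le_death[OF i] by simp
  qed simp
qed

text \<open>The total preorder by the midpoints of the intervals; among the intervals of infinite
  length, which come last, by the left endpoints.\<close>

definition precedes :: "'a \<Rightarrow> 'a \<Rightarrow> bool" where
  "precedes i k \<longleftrightarrow>
    (if F.death k = \<infinity> then F.death i = \<infinity> \<longrightarrow> f i \<le> f k
     else F.death i \<noteq> \<infinity> \<and> f i + real_of_ereal (F.death i) \<le> f k + real_of_ereal (F.death k))"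

lemma ex_greatest_precedes:
  assumes "finite V" "V \<noteq> {}"
  shows "\<exists>k\<in>V. \<forall>i\<in>V. precedes i k"
proof (cases "\<exists>k\<in>V. F.death k = \<infinity>")
  case True
  then have "finite {k\<in>V. F.death k = \<infinity>}" "{k\<in>V. F.death k = \<infinity>} \<noteq> {}" using assms by auto
  from ex_greatest_weight[OF this, of f] show ?thesis by (auto simp: precedes_def)
next
  case False
  from ex_greatest_weight[OF assms, of "\<lambda>i. f i + real_of_ereal (F.death i)"] False
  show ?thesis by (auto simp: precedes_def)
qed

text \<open>If the generator \<open>j\<close> for \<open>g\<close> is not close to \<open>i\<close>, then its midpoint lies
  before that of \<open>i\<close>, since neither endpoint of \<open>j\<close> lies more than \<open>\<epsilon>\<close> after the
  corresponding one of \<open>i\<close> and one of them lies more than \<open>\<epsilon>\<close> before.  If it is not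
  close to \<open>k\<close> either, then likewise the midpoint of \<open>k\<close> lies before that of \<open>j\<close>, so \<open>i\<close>
  cannot precede \<open>k\<close>.  The hypotheses make the three deaths all finite or all infinite;
  if they are infinite, births take the place of midpoints.\<close>

lemma intermediate_close:
  assumes i: "i \<in> F.pivots" and k: "k \<in> F.pivots" and prec: "precedes i k"
    and ij: "g j \<le> f i + \<epsilon>" "G.death j \<le> F.death i + ereal \<epsilon>"
    and jk: "f k \<le> g j + \<epsilon>" "F.death k \<le> G.death j + ereal \<epsilon>"
    and j: "j \<in> G.pivots"
  shows "close i j \<or> close k j"
proof -
  have ninf: "F.death i \<noteq> -\<infinity>" "F.death k \<noteq> -\<infinity>" "G.death j \<noteq> -\<infinity>"
    using F.birth_le_death[OF i] F.birth_le_death[OF k] G.birth_le_death[OF j] by auto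
  show ?thesis
    using prec ij jk ninf unfolding close_def precedes_def
    by (cases "F.death i"; cases "F.death k"; cases "G.death j") (simp_all split: if_splits; linarith)+
qed

lemma coord_product:
  assumes i: "i \<in> F.pivots" and T: "finite T" "\<And>j. G.coord (F.gen i) j \<noteq> 0 \<Longrightarrow> j \<in> T" "T \<subseteq> G.pivots"
  shows "(\<Sum>j\<in>T. G.coord (F.gen i) j * F.coord (G.gen j) k) = (if k = i then 1 else 0)"
proof -
  have "F.gen i = (\<lambda>\<tau>. \<Sum>j\<in>T. G.coord (F.gen i) j * G.gen j \<tau>)"
    using G.coord_sum_superset[OF F.gen_cycle[OF i] T(1,2)] by (intro ext) simp
  then have "F.coord (F.gen i) k = F.coord (\<lambda>\<tau>. \<Sum>j\<in>T. G.coord (F.gen i) j * G.gen j \<tau>) k"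
    by (rule arg_cong)
  also have "\<dots> = (\<Sum>j\<in>T. G.coord (F.gen i) j * F.coord (G.gen j) k)"
    by (rule F.coord_lincomb[OF T(1)]) (use T(3) G.gen_cycle in blast)
  finally show ?thesis by (simp add: F.coord_gen[OF i])
qed

end

lemma (in cycle_filtration_pair) swapped: "cycle_filtration_pair K g f Z B' B \<epsilon>"
  by unfold_locales (use level_close B_shift B'_shift in \<open>auto simp: abs_minus_commute\<close>)

context cycle_filtration_pair
begin

interpretation S: cycle_filtration_pair K g f Z B' B \<epsilon> by (rule swapped)

lemma finite_close: "finite {j \<in> G.pivots. close i j}"
  by (rule finite_subset[OF _ G.finite_sublevel[of "f i + \<epsilon>"]])
    (use G.pivots_subset in \<open>auto simp: close_def\<close>)

text \<open>The matrices of base change between the generators for \<open>f\<close> and those for \<open>g\<close> are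
  inverse to each other.  For a finite set \<open>A\<close> of generators for \<open>f\<close>, dropping the
  generators for \<open>g\<close> that are close to no member of \<open>A\<close> leaves the product triangular with
  respect to midpoints, so enough of them remain.\<close>

lemma marriage_condition:
  assumes A: "finite A" "A \<subseteq> F.pivots"
  shows "card A \<le> card (\<Union>i\<in>A. {j \<in> G.pivots. close i j})"
proof -
  note fin = finite_close
  let ?T = "\<Union>i\<in>A. {j \<in> G.pivots. close i j}"
  have prod: "(\<Sum>j\<in>?T. G.coord (F.gen i) j * F.coord (G.gen j) k) = (if k = i then 1 else 0)"
    if ik: "i \<in> A" "k \<in> A" "precedes i k" for i k
  proof -
    have i: "i \<in> F.pivots" and k: "k \<in> F.pivots" using ik A by auto
    let ?T' = "?T \<union> {j. G.coord (F.gen i) j \<noteq> 0}"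
    have T': "finite ?T'" using fin A(1) G.finite_coord[OF F.gen_cycle[OF i]] by simp
    have "(\<Sum>j\<in>?T. G.coord (F.gen i) j * F.coord (G.gen j) k)
        = (\<Sum>j\<in>?T'. G.coord (F.gen i) j * F.coord (G.gen j) k)"
    proof (rule sum.mono_neutral_left[OF T'])
      show "\<forall>j\<in>?T' - ?T. G.coord (F.gen i) j * F.coord (G.gen j) k = 0"
      proof (rule ballI, rule ccontr)
        fix j assume j: "j \<in> ?T' - ?T" "G.coord (F.gen i) j * F.coord (G.gen j) k \<noteq> 0"
        then have ij: "G.coord (F.gen i) j \<noteq> 0" and jk: "F.coord (G.gen j) k \<noteq> 0" by auto
        note 1 = coord_transfer[OF i ij]
        note 2 = S.coord_transfer[OF 1(1) jk]
        from intermediate_close[OF i k ik(3) 1(2,3) 2(2,3) 1(1)]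
        show False using j(1) 1(1) ik by auto
      qed
    qed simp
    also have "\<dots> = (if k = i then 1 else 0)"
      by (rule coord_product[OF i T']) (use coord_transfer(1)[OF i] in auto)
    finally show ?thesis .
  qed
  show "card A \<le> card ?T"
  proof (rule card_le_if_triangular_product[OF A(1)])
    show "finite ?T" using fin A(1) by simp
    fix V assume V: "V \<subseteq> A" "V \<noteq> {}"
    then have "finite V" using A(1) finite_subset by blast
    from ex_greatest_precedes[OF this V(2)] obtain k where k: "k \<in> V" "\<forall>i\<in>V. precedes i k" by blast
    show "\<exists>k\<in>V. (\<Sum>j\<in>?T. G.coord (F.gen k) j * F.coord (G.gen j) k) \<noteq> 0 \<and>
        (\<forall>i\<in>V. i \<noteq> k \<longrightarrow> (\<Sum>j\<in>?T. G.coord (F.gen i) j * F.coord (G.gen j) k) = 0)"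
    proof (intro bexI[OF _ k(1)] conjI ballI impI)
      show "(\<Sum>j\<in>?T. G.coord (F.gen k) j * F.coord (G.gen j) k) \<noteq> 0"
        using prod[of k k] k V by auto
      fix i assume "i \<in> V" "i \<noteq> k"
      then show "(\<Sum>j\<in>?T. G.coord (F.gen i) j * F.coord (G.gen j) k) = 0"
        using prod[of i k] k V by auto
    qed
  qed
qed

lemma ex_close_injection: "\<exists>h. inj_on h F.pivots \<and> (\<forall>i\<in>F.pivots. h i \<in> G.pivots \<and> close i (h i))"
  using marriage[of F.pivots "\<lambda>i. {j \<in> G.pivots. close i j}"] marriage_condition finite_close by auto

end

text \<open>Generators of length zero are matched as well: both sets of generators are bases of the
  whole space \<open>Z\<close>.\<close>

theorem (in cycle_filtration_pair) ex_close_bijection: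
  "\<exists>h. bij_betw h F.pivots G.pivots \<and> (\<forall>i\<in>F.pivots. close i (h i))"
proof -
  interpret S: cycle_filtration_pair K g f Z B' B \<epsilon> by (rule swapped)
  have sym: "S.close j i = close i j" for i j
    by (auto simp: close_def S.close_def abs_minus_commute)
  obtain u where "inj_on u F.pivots" "\<forall>i\<in>F.pivots. u i \<in> G.pivots \<and> close i (u i)"
    using ex_close_injection by blast
  moreover obtain v where "inj_on v G.pivots" "\<forall>j\<in>G.pivots. v j \<in> F.pivots \<and> S.close j (v j)"
    using S.ex_close_injection by blast
  ultimately show ?thesis
    by (intro Schroeder_Bernstein_relation[of u _ _ close v]) (auto simp: sym)
qed

section \<open>Powers of the Mayer boundary\<close>

definition simplicial_chains :: "'v chain set" where
  "simplicial_chains = {x. finite {\<sigma>. x \<sigma> \<noteq> 0} \<and> (\<forall>\<sigma>. x \<sigma> \<noteq> 0 \<longrightarrow> finite \<sigma> \<and> \<sigma> \<noteq> {})}"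

lemma card_less_nth_sorted_list_of_set:
  assumes "finite \<rho>" "i < card \<rho>"
  shows "card {u\<in>\<rho>. u < sorted_list_of_set \<rho> ! i} = i"
proof -
  let ?xs = "sorted_list_of_set \<rho>"
  have len: "length ?xs = card \<rho>" by simp
  have mono: "?xs ! a < ?xs ! b" if "a < b" "b < card \<rho>" for a b
    using sorted_wrt_nth_less[OF strict_sorted_list_of_set, of a b \<rho>] that by simp
  have "{u\<in>\<rho>. u < ?xs ! i} = (\<lambda>j. ?xs ! j) ` {..<i}"
  proof
    show "{u\<in>\<rho>. u < ?xs ! i} \<subseteq> (\<lambda>j. ?xs ! j) ` {..<i}"
    proof
      fix u assume u: "u \<in> {u\<in>\<rho>. u < ?xs ! i}"
      then have "u \<in> set ?xs" using assms by simp
      then obtain j where j: "j < card \<rho>" "u = ?xs ! j" by (auto simp: in_set_conv_nth)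
      have "j < i"
      proof (rule ccontr)
        assume "\<not> j < i"
        then have "?xs ! i \<le> u" using mono[of i j] j by (cases "i = j") auto
        then show False using u by auto
      qed
      then show "u \<in> (\<lambda>j. ?xs ! j) ` {..<i}" using j by auto
    qed
    show "(\<lambda>j. ?xs ! j) ` {..<i} \<subseteq> {u\<in>\<rho>. u < ?xs ! i}"
    proof (rule image_subsetI)
      fix j assume j: "j \<in> {..<i}"
      then have "?xs ! j \<in> set ?xs" using assms len by (intro nth_mem) auto
      then show "?xs ! j \<in> {u\<in>\<rho>. u < ?xs ! i}" using mono[of j i] j assms by auto
    qed
  qed
  moreover have "inj_on (\<lambda>j. ?xs ! j) {..<i}"
    using assms(2) len distinct_sorted_list_of_set[of \<rho>]
    by (intro inj_onI) (simp add: nth_eq_iff_index_eq)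
  ultimately show ?thesis by (simp add: card_image)
qed

lemma simplex_boundary_facet:
  fixes \<tau> :: "'v::linorder set"
  assumes "finite \<tau>" "\<tau> \<noteq> {}" "s \<notin> \<tau>"
  shows "simplex_boundary N (insert s \<tau>) \<tau> = xi N ^ card {u\<in>\<tau>. u < s}"
proof -
  let ?\<rho> = "insert s \<tau>" and ?xs = "sorted_list_of_set (insert s \<tau>)"
  have len: "length ?xs = card ?\<rho>" by simp
  have set: "set ?xs = ?\<rho>" by (rule set_sorted_list_of_set) (use assms in simp)
  obtain p where p: "p < card ?\<rho>" "?xs ! p = s" using set len by (metis in_set_conv_nth insertI1)
  have cond: "\<tau> = ?\<rho> - {?xs ! i} \<longleftrightarrow> i = p" if "i < card ?\<rho>" for i
  proof -
    have "\<tau> = ?\<rho> - {?xs ! i} \<longleftrightarrow> ?xs ! i = s"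
      using assms(3) nth_mem[of i ?xs] that set by auto
    also have "\<dots> \<longleftrightarrow> i = p" using p that len distinct_sorted_list_of_set[of ?\<rho>]
      by (metis nth_eq_iff_index_eq)
    finally show ?thesis .
  qed
  have "card ?\<rho> > 1" using assms by (simp add: card_gt_0_iff)
  then have "simplex_boundary N ?\<rho> \<tau> = (\<Sum>i<card ?\<rho>. if i = p then xi N ^ p else 0)"
    unfolding simplex_boundary_def using cond by (auto intro!: sum.cong)
  also have "\<dots> = xi N ^ p" using p(1) by simp
  also have "p = card {u\<in>?\<rho>. u < s}"
    using card_less_nth_sorted_list_of_set[of ?\<rho> p] assms(1) p by simp
  also have "{u\<in>?\<rho>. u < s} = {u\<in>\<tau>. u < s}" by auto
  finally show ?thesis .
qed

lemma simplex_boundary_support: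
  fixes \<tau> :: "'v::linorder set"
  assumes "simplex_boundary N \<rho> \<tau> \<noteq> 0" "finite \<rho>"
  shows "\<exists>s. s \<notin> \<tau> \<and> \<rho> = insert s \<tau>" "\<tau> \<noteq> {}"
proof -
  have big: "card \<rho> > 1" using assms(1) by (auto simp: simplex_boundary_def split: if_splits)
  then have "(\<Sum>i<card \<rho>. if \<tau> = \<rho> - {sorted_list_of_set \<rho> ! i} then xi N ^ i else 0) \<noteq> 0"
    using assms(1) by (simp add: simplex_boundary_def)
  then obtain i where i: "i < card \<rho>" "\<tau> = \<rho> - {sorted_list_of_set \<rho> ! i}"
    by (rule sum.not_neutral_contains_not_neutral) (simp split: if_splits)
  then have in_\<rho>: "sorted_list_of_set \<rho> ! i \<in> \<rho>"
    using nth_mem[of i "sorted_list_of_set \<rho>"] assms(2) by simp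
  then show "\<exists>s. s \<notin> \<tau> \<and> \<rho> = insert s \<tau>" using i(2) by blast
  have "card \<tau> = card \<rho> - 1" using i(2) in_\<rho> assms(2) by simp
  then show "\<tau> \<noteq> {}" using big by auto
qed

lemma mayer_boundary_superset:
  assumes "finite S" "\<And>\<sigma>. x \<sigma> \<noteq> 0 \<Longrightarrow> \<sigma> \<in> S"
  shows "mayer_boundary N x \<tau> = (\<Sum>\<sigma>\<in>S. x \<sigma> * simplex_boundary N \<sigma> \<tau>)"
  unfolding mayer_boundary_def by (rule sum.mono_neutral_left) (use assms in auto)

lemma mayer_boundary_support:
  assumes "x \<in> simplicial_chains" "mayer_boundary N x \<tau> \<noteq> 0"
  shows "\<exists>s. s \<notin> \<tau> \<and> x (insert s \<tau>) \<noteq> 0" "\<tau> \<noteq> {}"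
proof -
  obtain \<sigma> where \<sigma>: "x \<sigma> \<noteq> 0" "x \<sigma> * simplex_boundary N \<sigma> \<tau> \<noteq> 0"
    using assms(2) unfolding mayer_boundary_def
    by (rule sum.not_neutral_contains_not_neutral) simp
  then have "finite \<sigma>" "simplex_boundary N \<sigma> \<tau> \<noteq> 0"
    using assms(1) by (auto simp: simplicial_chains_def)
  note 1 = simplex_boundary_support[OF this(2,1)]
  show "\<exists>s. s \<notin> \<tau> \<and> x (insert s \<tau>) \<noteq> 0" using 1(1) \<sigma>(1) by blast
  show "\<tau> \<noteq> {}" by (rule 1(2))
qed

lemma mayer_boundary_simplicial:
  assumes "x \<in> simplicial_chains"
  shows "mayer_boundary N x \<in> simplicial_chains"
proof -
  have fin: "finite {\<sigma>. x \<sigma> \<noteq> 0}" "\<And>\<sigma>. x \<sigma> \<noteq> 0 \<Longrightarrow> finite \<sigma>"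
    using assms by (auto simp: simplicial_chains_def)
  have "{\<tau>. mayer_boundary N x \<tau> \<noteq> 0} \<subseteq> (\<Union>\<sigma>\<in>{\<sigma>. x \<sigma> \<noteq> 0}. Pow \<sigma>)"
    using mayer_boundary_support(1)[OF assms] by fastforce
  moreover have "finite (\<Union>\<sigma>\<in>{\<sigma>. x \<sigma> \<noteq> 0}. Pow \<sigma>)" using fin by auto
  ultimately have "finite {\<tau>. mayer_boundary N x \<tau> \<noteq> 0}" by (rule finite_subset)
  moreover have "finite \<tau>" "\<tau> \<noteq> {}" if "mayer_boundary N x \<tau> \<noteq> 0" for \<tau>
    using mayer_boundary_support[OF assms that] fin(2) by (auto dest: finite_subset[OF subset_insertI])
  ultimately show ?thesis by (simp add: simplicial_chains_def)
qed

lemma mayer_boundary_power_simplicial: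
  "x \<in> simplicial_chains \<Longrightarrow> (mayer_boundary N ^^ k) x \<in> simplicial_chains"
  by (induction k) (auto intro: mayer_boundary_simplicial)

lemma mayer_boundary_add_scaled:
  assumes "x \<in> simplicial_chains" "y \<in> simplicial_chains"
  shows "mayer_boundary N (\<lambda>\<sigma>. x \<sigma> + c * y \<sigma>)
    = (\<lambda>\<sigma>. mayer_boundary N x \<sigma> + c * mayer_boundary N y \<sigma>)"
proof
  fix \<tau>
  let ?S = "{\<sigma>. x \<sigma> \<noteq> 0} \<union> {\<sigma>. y \<sigma> \<noteq> 0}"
  have fin: "finite ?S" using assms by (auto simp: simplicial_chains_def)
  have "mayer_boundary N (\<lambda>\<sigma>. x \<sigma> + c * y \<sigma>) \<tau> = (\<Sum>\<sigma>\<in>?S. (x \<sigma> + c * y \<sigma>) * simplex_boundary N \<sigma> \<tau>)"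
    by (rule mayer_boundary_superset[OF fin]) auto
  also have "\<dots> = (\<Sum>\<sigma>\<in>?S. x \<sigma> * simplex_boundary N \<sigma> \<tau>) + c * (\<Sum>\<sigma>\<in>?S. y \<sigma> * simplex_boundary N \<sigma> \<tau>)"
    by (simp add: distrib_right sum.distrib sum_distrib_left mult.assoc)
  also have "(\<Sum>\<sigma>\<in>?S. x \<sigma> * simplex_boundary N \<sigma> \<tau>) = mayer_boundary N x \<tau>"
    by (rule mayer_boundary_superset[OF fin, symmetric]) auto
  also have "(\<Sum>\<sigma>\<in>?S. y \<sigma> * simplex_boundary N \<sigma> \<tau>) = mayer_boundary N y \<tau>"
    by (rule mayer_boundary_superset[OF fin, symmetric]) auto
  finally show "mayer_boundary N (\<lambda>\<sigma>. x \<sigma> + c * y \<sigma>) \<tau> = mayer_boundary N x \<tau> + c * mayer_boundary N y \<tau>" .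
qed

lemma mayer_boundary_power_add_scaled:
  assumes "x \<in> simplicial_chains" "y \<in> simplicial_chains"
  shows "(mayer_boundary N ^^ k) (\<lambda>\<sigma>. x \<sigma> + c * y \<sigma>)
    = (\<lambda>\<sigma>. (mayer_boundary N ^^ k) x \<sigma> + c * (mayer_boundary N ^^ k) y \<sigma>)"
  using assms
  by (induction k) (simp_all add: mayer_boundary_add_scaled mayer_boundary_power_simplicial)

lemma mayer_boundary_power_zero: "(mayer_boundary N ^^ k) (\<lambda>\<sigma>. 0) = (\<lambda>\<sigma>. 0)"
  by (induction k) (simp_all add: mayer_boundary_def)

definition inversions :: "'v::linorder set \<Rightarrow> 'v set \<Rightarrow> nat" where
  "inversions \<sigma> \<tau> = card {(u, v). u \<in> \<tau> \<and> v \<in> \<sigma> - \<tau> \<and> u < v}"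

definition q_factorial :: "complex \<Rightarrow> nat \<Rightarrow> complex" where
  "q_factorial z k = (\<Prod>i\<in>{1..k}. \<Sum>j<i. z ^ j)"

text \<open>Both sides count the pairs \<open>u < v\<close> with \<open>u \<in> insert s \<tau>\<close> and \<open>v \<in> \<sigma> - \<tau>\<close>.\<close>

lemma inversions_insert:
  assumes "finite \<sigma>" "\<tau> \<subseteq> \<sigma>" "s \<in> \<sigma> - \<tau>"
  shows "inversions \<sigma> (insert s \<tau>) + card {u\<in>\<tau>. u < s} = inversions \<sigma> \<tau> + card {v\<in>\<sigma> - \<tau>. s < v}"
proof -
  define W where "W = {(u, v). u \<in> \<tau> \<and> v \<in> \<sigma> - \<tau> - {s} \<and> u < v}"
  have \<tau>: "finite \<tau>" using assms finite_subset by blast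
  have "finite (\<tau> \<times> \<sigma>)" using \<tau> assms by simp
  then have W: "finite W" by (rule rev_finite_subset) (auto simp: W_def)
  have "{(u, v). u \<in> insert s \<tau> \<and> v \<in> \<sigma> - insert s \<tau> \<and> u < v} = W \<union> Pair s ` {v\<in>\<sigma> - \<tau>. s < v}"
    by (auto simp: W_def)
  moreover have "card (W \<union> Pair s ` {v\<in>\<sigma> - \<tau>. s < v}) = card W + card (Pair s ` {v\<in>\<sigma> - \<tau>. s < v})"
    by (rule card_Un_disjoint) (use W assms in \<open>auto simp: W_def\<close>)
  ultimately have 1: "inversions \<sigma> (insert s \<tau>) = card W + card {v\<in>\<sigma> - \<tau>. s < v}"
    by (simp add: inversions_def card_image inj_on_def)
  have "{(u, v). u \<in> \<tau> \<and> v \<in> \<sigma> - \<tau> \<and> u < v} = W \<union> (\<lambda>u. (u, s)) ` {u\<in>\<tau>. u < s}"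
    using assms by (auto simp: W_def)
  moreover have "card (W \<union> (\<lambda>u. (u, s)) ` {u\<in>\<tau>. u < s}) = card W + card ((\<lambda>u. (u, s)) ` {u\<in>\<tau>. u < s})"
    by (rule card_Un_disjoint) (use W \<tau> in \<open>auto simp: W_def\<close>)
  ultimately have 2: "inversions \<sigma> \<tau> = card W + card {u\<in>\<tau>. u < s}"
    by (simp add: inversions_def card_image inj_on_def)
  show ?thesis using 1 2 by simp
qed

text \<open>The elements of \<open>S\<close> have \<open>0, 1, \<dots>, card S - 1\<close> larger elements, respectively.\<close>

lemma sum_power_card_greater:
  fixes S :: "'v::linorder set" and z :: complex
  assumes "finite S"
  shows "(\<Sum>s\<in>S. z ^ card {v\<in>S. s < v}) = (\<Sum>j<card S. z ^ j)"
  using assms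
proof (induction S rule: finite_linorder_min_induct)
  case empty
  then show ?case by simp
next
  case (insert b A)
  have b: "b \<notin> A" using insert by auto
  have "{v \<in> insert b A. b < v} = A" using insert by auto
  moreover have "{v \<in> insert b A. s < v} = {v \<in> A. s < v}" if "s \<in> A" for s
    using insert that by (auto dest: less_asym)
  ultimately have "(\<Sum>s\<in>insert b A. z ^ card {v \<in> insert b A. s < v})
      = z ^ card A + (\<Sum>s\<in>A. z ^ card {v \<in> A. s < v})"
    using b insert(1) by simp
  then show ?case using insert b by simp
qed

text \<open>Deleting the vertices of \<open>\<sigma> - \<tau>\<close> one after the other in all possible orders gives the
  coefficient of \<open>\<tau>\<close> in the \<open>k\<close>-th power of the boundary of \<open>\<sigma>\<close>.  Relative to a fixed
  order, each deletion order contributes the power of \<open>\<xi>\<close> that counts its inversions, and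
  the generating function of inversions over all permutations is the q-factorial.\<close>

definition power_coefficient :: "nat \<Rightarrow> nat \<Rightarrow> 'v::linorder set \<Rightarrow> 'v set \<Rightarrow> complex" where
  "power_coefficient N k \<sigma> \<tau> =
    (if \<tau> \<noteq> {} \<and> \<tau> \<subseteq> \<sigma> \<and> card \<sigma> = card \<tau> + k then q_factorial (xi N) k * xi N ^ inversions \<sigma> \<tau> else 0)"

lemma power_coefficient_Suc:
  assumes \<sigma>: "finite \<sigma>" and R: "finite R" "Pow \<sigma> \<subseteq> R" "\<And>\<rho>. \<rho> \<in> R \<Longrightarrow> finite \<rho>"
  shows "(\<Sum>\<rho>\<in>R. power_coefficient N k \<sigma> \<rho> * simplex_boundary N \<rho> \<tau>) = power_coefficient N (Suc k) \<sigma> \<tau>"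
proof (cases "\<tau> \<noteq> {} \<and> \<tau> \<subseteq> \<sigma> \<and> card \<sigma> = card \<tau> + Suc k")
  case False
  have "power_coefficient N k \<sigma> \<rho> * simplex_boundary N \<rho> \<tau> = 0" if "\<rho> \<in> R" for \<rho>
  proof (rule ccontr)
    assume a: "power_coefficient N k \<sigma> \<rho> * simplex_boundary N \<rho> \<tau> \<noteq> 0"
    then have "simplex_boundary N \<rho> \<tau> \<noteq> 0" by simp
    note supp = simplex_boundary_support[OF this R(3)[OF that]]
    then obtain s where s: "s \<notin> \<tau>" "\<rho> = insert s \<tau>" "\<tau> \<noteq> {}" by blast
    have "\<rho> \<subseteq> \<sigma>" "card \<sigma> = card \<rho> + k"
      using a by (auto simp: power_coefficient_def split: if_splits)
    moreover have "finite \<tau>" using s R(3)[OF that] by simp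
    ultimately show False using False s by auto
  qed
  then have "(\<Sum>\<rho>\<in>R. power_coefficient N k \<sigma> \<rho> * simplex_boundary N \<rho> \<tau>) = 0"
    by (rule sum.neutral[OF ballI])
  also have "0 = power_coefficient N (Suc k) \<sigma> \<tau>"
    using False by (auto simp: power_coefficient_def)
  finally show ?thesis .
next
  case True
  then have fin: "finite \<tau>" using \<sigma> finite_subset by blast
  let ?S = "\<sigma> - \<tau>"
  have S: "finite ?S" "card ?S = Suc k" using True \<sigma> fin by (simp_all add: card_Diff_subset)
  have inj: "inj_on (\<lambda>s. insert s \<tau>) ?S" by (rule inj_onI) blast
  have "(\<Sum>\<rho>\<in>R. power_coefficient N k \<sigma> \<rho> * simplex_boundary N \<rho> \<tau>)
      = (\<Sum>\<rho>\<in>(\<lambda>s. insert s \<tau>) ` ?S. power_coefficient N k \<sigma> \<rho> * simplex_boundary N \<rho> \<tau>)"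
  proof (rule sum.mono_neutral_right[OF R(1)])
    have "insert s \<tau> \<in> Pow \<sigma>" if "s \<in> ?S" for s using True that by blast
    then show "(\<lambda>s. insert s \<tau>) ` ?S \<subseteq> R" using R(2) by blast
    show "\<forall>\<rho>\<in>R - (\<lambda>s. insert s \<tau>) ` ?S. power_coefficient N k \<sigma> \<rho> * simplex_boundary N \<rho> \<tau> = 0"
    proof (rule ballI, rule ccontr)
      fix \<rho> assume \<rho>: "\<rho> \<in> R - (\<lambda>s. insert s \<tau>) ` ?S"
        and a: "power_coefficient N k \<sigma> \<rho> * simplex_boundary N \<rho> \<tau> \<noteq> 0"
      then have "simplex_boundary N \<rho> \<tau> \<noteq> 0" "finite \<rho>" using R(3)[of \<rho>] by simp_all
      then obtain s where s: "s \<notin> \<tau>" "\<rho> = insert s \<tau>"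
        using simplex_boundary_support(1)[of N \<rho> \<tau>] by blast
      have "\<rho> \<subseteq> \<sigma>" using a by (auto simp: power_coefficient_def split: if_splits)
      then show False using \<rho> s by auto
    qed
  qed
  also have "\<dots> = (\<Sum>s\<in>?S. power_coefficient N k \<sigma> (insert s \<tau>) * simplex_boundary N (insert s \<tau>) \<tau>)"
    using inj by (simp add: sum.reindex)
  also have "\<dots> = (\<Sum>s\<in>?S. q_factorial (xi N) k * xi N ^ inversions \<sigma> \<tau> * xi N ^ card {v\<in>?S. s < v})"
  proof (rule sum.cong[OF refl])
    fix s assume s: "s \<in> ?S"
    have "power_coefficient N k \<sigma> (insert s \<tau>) = q_factorial (xi N) k * xi N ^ inversions \<sigma> (insert s \<tau>)"
      using s True fin by (simp add: power_coefficient_def)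
    moreover have "simplex_boundary N (insert s \<tau>) \<tau> = xi N ^ card {u\<in>\<tau>. u < s}"
      using simplex_boundary_facet[OF fin] True s by simp
    ultimately have "power_coefficient N k \<sigma> (insert s \<tau>) * simplex_boundary N (insert s \<tau>) \<tau>
      = q_factorial (xi N) k * xi N ^ (inversions \<sigma> (insert s \<tau>) + card {u\<in>\<tau>. u < s})"
      by (simp add: power_add)
    also have "inversions \<sigma> (insert s \<tau>) + card {u\<in>\<tau>. u < s} = inversions \<sigma> \<tau> + card {v\<in>?S. s < v}"
      by (rule inversions_insert[OF \<sigma>]) (use True s in auto)
    finally show "power_coefficient N k \<sigma> (insert s \<tau>) * simplex_boundary N (insert s \<tau>) \<tau>
      = q_factorial (xi N) k * xi N ^ inversions \<sigma> \<tau> * xi N ^ card {v\<in>?S. s < v}"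
      by (simp add: power_add)
  qed
  also have "\<dots> = q_factorial (xi N) k * xi N ^ inversions \<sigma> \<tau> * (\<Sum>j<Suc k. xi N ^ j)"
    unfolding sum_distrib_left[symmetric] sum_power_card_greater[OF S(1)] S(2) ..
  also have "\<dots> = q_factorial (xi N) (Suc k) * xi N ^ inversions \<sigma> \<tau>"
    by (simp add: q_factorial_def mult_ac)
  finally show ?thesis using True by (simp add: power_coefficient_def)
qed

lemma mayer_boundary_power:
  assumes x: "x \<in> simplicial_chains"
  shows "(mayer_boundary N ^^ k) x \<tau> = (\<Sum>\<sigma> | x \<sigma> \<noteq> 0. x \<sigma> * power_coefficient N k \<sigma> \<tau>)"
proof (induction k arbitrary: \<tau>)
  case 0
  have fin: "finite {\<sigma>. x \<sigma> \<noteq> 0}" "\<And>\<sigma>. x \<sigma> \<noteq> 0 \<Longrightarrow> finite \<sigma> \<and> \<sigma> \<noteq> {}"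
    using x by (auto simp: simplicial_chains_def)
  have "x \<sigma> * power_coefficient N 0 \<sigma> \<tau> = (if \<sigma> = \<tau> then x \<tau> else 0)" if "x \<sigma> \<noteq> 0" for \<sigma>
  proof -
    have "\<tau> = \<sigma>" if "\<tau> \<subseteq> \<sigma>" "card \<sigma> = card \<tau>"
      using that fin(2)[OF \<open>x \<sigma> \<noteq> 0\<close>] by (metis card_subset_eq)
    then show ?thesis using fin(2)[OF that]
      by (auto simp: power_coefficient_def q_factorial_def inversions_def)
  qed
  then have "(\<Sum>\<sigma> | x \<sigma> \<noteq> 0. x \<sigma> * power_coefficient N 0 \<sigma> \<tau>) = (\<Sum>\<sigma> | x \<sigma> \<noteq> 0. if \<sigma> = \<tau> then x \<tau> else 0)"
    by (intro sum.cong) auto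
  then show ?case using fin(1) by simp
next
  case (Suc k)
  let ?X = "{\<sigma>. x \<sigma> \<noteq> 0}"
  have fin: "finite ?X" "\<And>\<sigma>. x \<sigma> \<noteq> 0 \<Longrightarrow> finite \<sigma>"
    using x by (auto simp: simplicial_chains_def)
  define R where "R = (\<Union>\<sigma>\<in>?X. Pow \<sigma>)"
  have R: "finite R" "\<And>\<rho>. \<rho> \<in> R \<Longrightarrow> finite \<rho>"
    using fin by (auto simp: R_def dest: finite_subset)
  have "(mayer_boundary N ^^ Suc k) x \<tau> = (\<Sum>\<rho>\<in>R. (mayer_boundary N ^^ k) x \<rho> * simplex_boundary N \<rho> \<tau>)"
    unfolding funpow.simps o_apply
  proof (rule mayer_boundary_superset[OF R(1)])
    fix \<rho> assume "(mayer_boundary N ^^ k) x \<rho> \<noteq> 0"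
    then obtain \<sigma> where "x \<sigma> \<noteq> 0" "x \<sigma> * power_coefficient N k \<sigma> \<rho> \<noteq> 0"
      unfolding Suc.IH by (rule sum.not_neutral_contains_not_neutral) simp
    then show "\<rho> \<in> R" by (auto simp: R_def power_coefficient_def split: if_splits)
  qed
  also have "\<dots> = (\<Sum>\<sigma>\<in>?X. x \<sigma> * (\<Sum>\<rho>\<in>R. power_coefficient N k \<sigma> \<rho> * simplex_boundary N \<rho> \<tau>))"
    unfolding Suc.IH sum_distrib_right sum_distrib_left by (subst sum.swap) (simp add: mult.assoc)
  also have "\<dots> = (\<Sum>\<sigma>\<in>?X. x \<sigma> * power_coefficient N (Suc k) \<sigma> \<tau>)"
  proof (rule sum.cong[OF refl])
    fix \<sigma> assume "\<sigma> \<in> ?X"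
    then have "(\<Sum>\<rho>\<in>R. power_coefficient N k \<sigma> \<rho> * simplex_boundary N \<rho> \<tau>) = power_coefficient N (Suc k) \<sigma> \<tau>"
      by (intro power_coefficient_Suc R fin) (auto simp: R_def)
    then show "x \<sigma> * (\<Sum>\<rho>\<in>R. power_coefficient N k \<sigma> \<rho> * simplex_boundary N \<rho> \<tau>)
      = x \<sigma> * power_coefficient N (Suc k) \<sigma> \<tau>" by simp
  qed
  finally show ?case .
qed

lemma sum_xi_powers:
  assumes "N \<ge> 2"
  shows "(\<Sum>j<N. xi N ^ j) = 0"
proof -
  have "xi N ^ N = exp (of_nat N * (2 * of_real pi * \<i> / of_nat N))"
    unfolding xi_def by (rule exp_of_nat_mult[symmetric])
  also have "of_nat N * (2 * of_real pi * \<i> / of_nat N) = (2 * of_real pi * \<i> :: complex)"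
    using assms by simp
  finally have 1: "xi N ^ N = 1" by simp
  have "xi N \<noteq> 1"
  proof
    assume "xi N = 1"
    then obtain n :: int where "2 * pi / real N = of_int (2 * n) * pi"
      by (auto simp: xi_def exp_eq_1)
    then have "1 = of_int n * real N" using assms by (simp add: field_simps)
    then have "1 = n * int N" by (metis of_int_1 of_int_eq_iff of_int_mult of_int_of_nat_eq)
    then have "int N dvd 1" by (metis dvd_triv_right)
    then show False using assms by simp
  qed
  then show ?thesis using 1 by (simp add: geometric_sum)
qed

text \<open>The last factor of the q-factorial is the sum of all \<open>N\<close>-th roots of unity, which vanishes.\<close>

theorem mayer_boundary_nilpotent:
  assumes "N \<ge> 2" "x \<in> simplicial_chains"
  shows "(mayer_boundary N ^^ N) x = (\<lambda>\<sigma>. 0)"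
proof
  have "q_factorial (xi N) N = 0"
    using assms(1) sum_xi_powers[OF assms(1)] by (auto simp: q_factorial_def intro!: bexI[of _ N])
  then have "power_coefficient N N \<sigma> \<tau> = 0" for \<sigma> \<tau> :: "'a set"
    by (simp add: power_coefficient_def)
  then show "(mayer_boundary N ^^ N) x \<tau> = 0" for \<tau>
    by (simp add: mayer_boundary_power[OF assms(2)])
qed

section \<open>Mayer cycles and boundaries of a filtered complex\<close>

lemma simplicial_complexD:
  assumes "abstract_simplicial_complex L" "\<sigma> \<in> L"
  shows "finite \<sigma>" "\<sigma> \<noteq> {}" "\<tau> \<subseteq> \<sigma> \<Longrightarrow> \<tau> \<noteq> {} \<Longrightarrow> \<tau> \<in> L"
  using bspec[OF assms(1)[unfolded abstract_simplicial_complex_def] assms(2)] by blast+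

lemma chains_simplicial:
  assumes "abstract_simplicial_complex L"
  shows "chains L n \<subseteq> simplicial_chains"
  using simplicial_complexD(1,2)[OF assms] by (auto simp: chains_def simplicial_chains_def)

lemma subspace_chains: "linear_subspace (chains L n)"
  unfolding linear_subspace_def
proof (intro conjI ballI allI)
  show "(\<lambda>_. 0) \<in> chains L n" by (simp add: chains_def)
  fix x y c assume xy: "x \<in> chains L n" "y \<in> chains L n"
  have sub: "{s. x s + c * y s \<noteq> 0} \<subseteq> {s. x s \<noteq> 0} \<union> {s. y s \<noteq> 0}" by auto
  have *: "finite ({s. x s \<noteq> 0} \<union> {s. y s \<noteq> 0})"
    and **: "{s. x s \<noteq> 0} \<union> {s. y s \<noteq> 0} \<subseteq> {\<sigma>\<in>L. card \<sigma> = n + 1}"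
    using xy unfolding chains_def by simp_all
  show "(\<lambda>s. x s + c * y s) \<in> chains L n"
    unfolding chains_def
    by (rule CollectI, rule conjI, rule finite_subset[OF sub *], rule order_trans[OF sub **])
qed

lemma chains_mono: "L \<subseteq> L' \<Longrightarrow> chains L n \<subseteq> chains L' n"
  by (auto simp: chains_def)

lemma mayer_boundary_chains:
  assumes L: "abstract_simplicial_complex L" and x: "x \<in> chains L (Suc n)"
  shows "mayer_boundary N x \<in> chains L n"
proof -
  have xs: "x \<in> simplicial_chains" using chains_simplicial[OF L] x by blast
  have "\<tau> \<in> L \<and> card \<tau> = n + 1" if "mayer_boundary N x \<tau> \<noteq> 0" for \<tau>
  proof -
    note supp = mayer_boundary_support[OF xs that]
    then obtain s where s: "s \<notin> \<tau>" "x (insert s \<tau>) \<noteq> 0" "\<tau> \<noteq> {}" by blast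
    then have "insert s \<tau> \<in> L" "card (insert s \<tau>) = n + 2" using x by (auto simp: chains_def)
    moreover have "finite (insert s \<tau>)" "\<tau> \<in> L"
      using simplicial_complexD[OF L \<open>insert s \<tau> \<in> L\<close>] s(3) by (simp_all add: subset_insertI)
    ultimately show ?thesis using s by simp
  qed
  then show ?thesis using mayer_boundary_simplicial[OF xs, of N]
    by (auto simp: chains_def simplicial_chains_def)
qed

lemma mayer_boundary_power_chains:
  assumes "abstract_simplicial_complex L" "x \<in> chains L (n + k)"
  shows "(mayer_boundary N ^^ k) x \<in> chains L n"
  using assms(2)
proof (induction k arbitrary: x)
  case (Suc k)
  then show ?case using mayer_boundary_chains[OF assms(1), of x "n + k"]
    by (simp add: funpow_swap1)
qed simp

lemma sublevel_complex:
  assumes "abstract_simplicial_complex K" "mono_on K f"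
  shows "abstract_simplicial_complex (sublevel K f a)"
  unfolding abstract_simplicial_complex_def sublevel_def
proof (intro ballI conjI allI impI)
  fix \<sigma> \<tau> assume \<sigma>: "\<sigma> \<in> {\<sigma> \<in> K. f \<sigma> \<le> a}" and \<tau>: "\<tau> \<subseteq> \<sigma> \<and> \<tau> \<noteq> {}"
  then have "\<tau> \<in> K" using simplicial_complexD(3)[OF assms(1), of \<sigma> \<tau>] by simp
  moreover have "f \<tau> \<le> f \<sigma>" using mono_onD[OF assms(2) \<open>\<tau> \<in> K\<close>, of \<sigma>] \<sigma> \<tau> by simp
  ultimately show "\<tau> \<in> {\<sigma> \<in> K. f \<sigma> \<le> a}" using \<sigma> by simp
qed (use simplicial_complexD(1,2)[OF assms(1)] in auto)

lemma mayer_cycles_sublevel: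
  "mayer_cycles N (sublevel K f a) n q = {z \<in> mayer_cycles N K n q. \<forall>\<sigma>. z \<sigma> \<noteq> 0 \<longrightarrow> f \<sigma> \<le> a}"
  by (auto simp: mayer_cycles_def chains_def sublevel_def)

lemma subspace_mayer_cycles:
  assumes "abstract_simplicial_complex L"
  shows "linear_subspace (mayer_cycles N L n q)"
  unfolding linear_subspace_def
proof (intro conjI ballI allI)
  show "(\<lambda>_. 0) \<in> mayer_cycles N L n q"
    by (simp add: mayer_cycles_def mayer_boundary_power_zero linear_subspaceD(1)[OF subspace_chains])
  fix x y c assume "x \<in> mayer_cycles N L n q" "y \<in> mayer_cycles N L n q"
  then have x: "x \<in> chains L n" "(mayer_boundary N ^^ q) x = (\<lambda>_. 0)"
    and y: "y \<in> chains L n" "(mayer_boundary N ^^ q) y = (\<lambda>_. 0)" by (auto simp: mayer_cycles_def)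
  have "x \<in> simplicial_chains" "y \<in> simplicial_chains" using x y chains_simplicial[OF assms] by auto
  from mayer_boundary_power_add_scaled[OF this, where k = q]
  show "(\<lambda>s. x s + c * y s) \<in> mayer_cycles N L n q"
    using x y linear_subspaceD(2)[OF subspace_chains x(1) y(1)] by (simp add: mayer_cycles_def)
qed

lemma subspace_mayer_boundaries:
  assumes "abstract_simplicial_complex L"
  shows "linear_subspace (mayer_boundaries N L n q)"
  unfolding linear_subspace_def mayer_boundaries_def
proof (intro conjI ballI allI)
  let ?d = "mayer_boundary N ^^ (N - q)" and ?C = "chains L (n + (N - q))"
  show "(\<lambda>_. 0) \<in> ?d ` ?C"
    by (rule image_eqI[OF _ linear_subspaceD(1)[OF subspace_chains]]) (simp add: mayer_boundary_power_zero)
  fix x y c assume "x \<in> ?d ` ?C" "y \<in> ?d ` ?C"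
  then obtain u v where uv: "u \<in> ?C" "v \<in> ?C" "x = ?d u" "y = ?d v" by blast
  have "u \<in> simplicial_chains" "v \<in> simplicial_chains" using uv chains_simplicial[OF assms] by auto
  from mayer_boundary_power_add_scaled[OF this, where k = "N - q"]
  show "(\<lambda>s. x s + c * y s) \<in> ?d ` ?C"
    using uv by (intro image_eqI[OF _ linear_subspaceD(2)[OF subspace_chains uv(1,2), of c]]) simp
qed

lemma mayer_boundaries_cycles:
  assumes "abstract_simplicial_complex L" "N \<ge> 2" "q \<le> N"
  shows "mayer_boundaries N L n q \<subseteq> mayer_cycles N L n q"
proof
  fix x assume "x \<in> mayer_boundaries N L n q"
  then obtain u where u: "u \<in> chains L (n + (N - q))" "x = (mayer_boundary N ^^ (N - q)) u"
    unfolding mayer_boundaries_def by (rule imageE)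
  have "(mayer_boundary N ^^ q) x = (mayer_boundary N ^^ N) u"
    using assms(3) u(2) fun_cong[OF funpow_add[of q "N - q" "mayer_boundary N"], of u] by simp
  also have "\<dots> = (\<lambda>\<sigma>. 0)"
    using mayer_boundary_nilpotent[OF assms(2)] chains_simplicial[OF assms(1)] u(1) by blast
  finally show "x \<in> mayer_cycles N L n q"
    using mayer_boundary_power_chains[OF assms(1) u(1)] u(2) by (simp add: mayer_cycles_def)
qed

lemma mayer_boundaries_mono: "L \<subseteq> L' \<Longrightarrow> mayer_boundaries N L n q \<subseteq> mayer_boundaries N L' n q"
  unfolding mayer_boundaries_def by (intro image_mono chains_mono)

lemma cycle_filtration_mayer:
  assumes K: "abstract_simplicial_complex K" "mono_on K f" "\<And>a. finite (sublevel K f a)"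
    and N: "N \<ge> 2" "q \<le> N"
  shows "cycle_filtration K f (mayer_cycles N K n q) (\<lambda>a. mayer_boundaries N (sublevel K f a) n q)"
proof
  show "finite {\<sigma> \<in> K. f \<sigma> \<le> a}" for a using K(3)[of a] by (simp add: sublevel_def)
  show "linear_subspace (mayer_cycles N K n q)" by (rule subspace_mayer_cycles[OF K(1)])
  show "finite {\<sigma>. z \<sigma> \<noteq> 0}" if "z \<in> mayer_cycles N K n q" for z
    using that by (simp add: mayer_cycles_def chains_def)
  show "\<sigma> \<in> K" if "z \<in> mayer_cycles N K n q" "z \<sigma> \<noteq> 0" for z \<sigma>
    using that by (auto simp: mayer_cycles_def chains_def)
  show "linear_subspace (mayer_boundaries N (sublevel K f a) n q)" for a
    by (rule subspace_mayer_boundaries[OF sublevel_complex[OF K(1,2)]])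
  show "x \<in> mayer_cycles N K n q" "x \<sigma> \<noteq> 0 \<Longrightarrow> f \<sigma> \<le> a"
    if "x \<in> mayer_boundaries N (sublevel K f a) n q" for x a \<sigma>
    using mayer_boundaries_cycles[OF sublevel_complex[OF K(1,2)] N] that
    unfolding mayer_cycles_sublevel by blast+
  show "mayer_boundaries N (sublevel K f a) n q \<subseteq> mayer_boundaries N (sublevel K f b) n q"
    if "{\<sigma> \<in> K. f \<sigma> \<le> a} \<subseteq> {\<sigma> \<in> K. f \<sigma> \<le> b}" for a b
    using that by (intro mayer_boundaries_mono) (simp add: sublevel_def)
qed

section \<open>Uniqueness of barcodes\<close>

definition bar_sum :: "(real set \<times> nat) set \<Rightarrow> (real set \<times> nat \<Rightarrow> complex) persistence_module" where
  "bar_sum J = pm_sum J (\<lambda>(I, i). interval_module I)"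

lemma bar_sum_carrier:
  "x \<in> carrier (pm_space (bar_sum J) t) \<longleftrightarrow>
     x \<in> extensional J \<and> (\<forall>j\<in>J. t \<notin> fst j \<longrightarrow> x j = 0) \<and> finite {j\<in>J. x j \<noteq> 0}"
  by (fastforce simp: bar_sum_def pm_sum_def module_sum_def interval_module_def PiE_iff split_beta
      split: if_splits)

lemma bar_sum_simps:
  "x \<oplus>\<^bsub>pm_space (bar_sum J) t\<^esub> y = (\<lambda>j\<in>J. x j + y j)"
  "c \<odot>\<^bsub>pm_space (bar_sum J) t\<^esub> x = (\<lambda>j\<in>J. c * x j)"
  "pm_map (bar_sum J) s t x = (\<lambda>j\<in>J. if s \<in> fst j \<and> t \<in> fst j then x j else 0)"
  by (simp_all add: bar_sum_def pm_sum_def module_sum_def interval_module_def split_beta)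

definition bar_unit :: "(real set \<times> nat) set \<Rightarrow> real set \<times> nat \<Rightarrow> real set \<times> nat \<Rightarrow> complex" where
  "bar_unit J j = (\<lambda>i\<in>J. if i = j then 1 else 0)"

lemma bar_unit_carrier: "t \<in> fst j \<Longrightarrow> bar_unit J j \<in> carrier (pm_space (bar_sum J) t)"
  unfolding bar_sum_carrier
  by (auto simp: bar_unit_def intro!: finite_subset[of "{i\<in>J. bar_unit J j i \<noteq> 0}" "{j}"])

locale barcode_morphism =
  fixes J J' :: "(real set \<times> nat) set"
    and F :: "real \<Rightarrow> (real set \<times> nat \<Rightarrow> complex) \<Rightarrow> real set \<times> nat \<Rightarrow> complex"
  assumes carrier: "\<And>t x. x \<in> carrier (pm_space (bar_sum J) t) \<Longrightarrow> F t x \<in> carrier (pm_space (bar_sum J') t)"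
    and add: "\<And>t x y. x \<in> carrier (pm_space (bar_sum J) t) \<Longrightarrow> y \<in> carrier (pm_space (bar_sum J) t) \<Longrightarrow>
        F t (x \<oplus>\<^bsub>pm_space (bar_sum J) t\<^esub> y) = F t x \<oplus>\<^bsub>pm_space (bar_sum J') t\<^esub> F t y"
    and smult: "\<And>t x c. x \<in> carrier (pm_space (bar_sum J) t) \<Longrightarrow>
        F t (c \<odot>\<^bsub>pm_space (bar_sum J) t\<^esub> x) = c \<odot>\<^bsub>pm_space (bar_sum J') t\<^esub> F t x"
    and natural: "\<And>s t x. s \<le> t \<Longrightarrow> x \<in> carrier (pm_space (bar_sum J) s) \<Longrightarrow>
        F t (pm_map (bar_sum J) s t x) = pm_map (bar_sum J') s t (F s x)"
begin

lemma zero: "k \<in> J' \<Longrightarrow> F t (\<lambda>j\<in>J. 0) k = 0"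
  using smult[of "\<lambda>j\<in>J. 0" t 0] by (simp add: bar_sum_carrier bar_sum_simps cong: restrict_cong)

lemma expand:
  assumes x: "x \<in> carrier (pm_space (bar_sum J) t)" and k: "k \<in> J'"
  shows "F t x k = (\<Sum>j\<in>{j\<in>J. x j \<noteq> 0}. x j * F t (bar_unit J j) k)"
proof -
  have "F t x k = (\<Sum>j\<in>S. x j * F t (bar_unit J j) k)"
    if "finite S" "S \<subseteq> J" "x \<in> carrier (pm_space (bar_sum J) t)" "\<And>j. j \<in> J \<Longrightarrow> x j \<noteq> 0 \<Longrightarrow> j \<in> S" for S x
    using that
  proof (induction S arbitrary: x rule: finite_induct)
    case empty
    then have "x = (\<lambda>j\<in>J. 0)" by (intro extensionalityI[of x J]) (auto simp: bar_sum_carrier)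
    then have "F t x k = 0" by (simp only: zero[OF k])
    then show ?case by simp
  next
    case (insert j S)
    show ?case
    proof (cases "x j = 0")
      case True
      have "F t x k = (\<Sum>j\<in>S. x j * F t (bar_unit J j) k)"
        by (rule insert.IH) (use insert.prems True in auto)
      then show ?thesis using insert.hyps True by simp
    next
      case False
      have j: "j \<in> J" using insert.prems(1) by simp
      have t: "t \<in> fst j" using insert.prems(2) j False unfolding bar_sum_carrier by blast
      define y where "y = x(j := 0)"
      have fin: "finite {i\<in>J. y i \<noteq> 0}"
        by (rule finite_subset[of _ "{i\<in>J. x i \<noteq> 0}"])
          (use insert.prems(2) in \<open>auto simp: y_def bar_sum_carrier\<close>)
      have yc: "y \<in> carrier (pm_space (bar_sum J) t)"
        using insert.prems(2) fin j unfolding bar_sum_carrier by (auto simp: y_def extensional_def)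
      have uc: "bar_unit J j \<in> carrier (pm_space (bar_sum J) t)" by (rule bar_unit_carrier[OF t])
      have suc: "x j \<odot>\<^bsub>pm_space (bar_sum J) t\<^esub> bar_unit J j \<in> carrier (pm_space (bar_sum J) t)"
        using uc unfolding bar_sum_carrier bar_sum_simps by (auto elim: rev_finite_subset)
      have "x = y \<oplus>\<^bsub>pm_space (bar_sum J) t\<^esub> (x j \<odot>\<^bsub>pm_space (bar_sum J) t\<^esub> bar_unit J j)"
        unfolding bar_sum_simps using insert.prems(2)
        by (intro extensionalityI[of x J]) (auto simp: y_def bar_unit_def bar_sum_carrier)
      then have "F t x = F t y \<oplus>\<^bsub>pm_space (bar_sum J') t\<^esub>
          (x j \<odot>\<^bsub>pm_space (bar_sum J') t\<^esub> F t (bar_unit J j))"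
        using add[OF yc suc] smult[OF uc, of "x j"] by simp
      then have "F t x k = F t y k + x j * F t (bar_unit J j) k" using k by (simp add: bar_sum_simps)
      also have "F t y k = (\<Sum>i\<in>S. y i * F t (bar_unit J i) k)"
        by (rule insert.IH[OF _ yc]) (use insert.prems in \<open>auto simp: y_def split: if_splits\<close>)
      also have "\<dots> = (\<Sum>i\<in>S. x i * F t (bar_unit J i) k)"
        by (rule sum.cong) (use insert.hyps in \<open>auto simp: y_def\<close>)
      finally show ?thesis using insert.hyps by simp
    qed
  qed
  from this[of "{j\<in>J. x j \<noteq> 0}" x] x show ?thesis unfolding bar_sum_carrier by auto
qed

text \<open>A nonzero map from one interval module to another goes to an interval that starts and
  ends no later, because it commutes with the structure maps.\<close>

lemma component_nonzero:
  assumes j: "j \<in> J" and k: "k \<in> J'" and t: "t \<in> fst j" and nz: "F t (bar_unit J j) k \<noteq> 0"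
  shows "t \<in> fst k"
    and "s \<le> t \<Longrightarrow> s \<in> fst j \<Longrightarrow> s \<in> fst k"
    and "t \<le> u \<Longrightarrow> u \<in> fst k \<Longrightarrow> u \<in> fst j"
proof -
  show tk: "t \<in> fst k"
    using carrier[OF bar_unit_carrier[OF t, of J]] k nz unfolding bar_sum_carrier by blast
  show "s \<in> fst k" if "s \<le> t" "s \<in> fst j"
  proof -
    have "pm_map (bar_sum J) s t (bar_unit J j) = bar_unit J j"
      using that t by (auto simp: bar_sum_simps bar_unit_def intro!: restrict_ext)
    with natural[OF that(1) bar_unit_carrier[OF that(2), of J]]
    have "F t (bar_unit J j) = pm_map (bar_sum J') s t (F s (bar_unit J j))" by simp
    from fun_cong[OF this, of k] show ?thesis using k nz by (simp add: bar_sum_simps split: if_splits)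
  qed
  show "u \<in> fst j" if "t \<le> u" "u \<in> fst k"
  proof (rule ccontr)
    assume "u \<notin> fst j"
    then have "pm_map (bar_sum J) t u (bar_unit J j) = (\<lambda>j\<in>J. 0)"
      by (auto simp: bar_sum_simps bar_unit_def intro!: restrict_ext)
    with natural[OF that(1) bar_unit_carrier[OF t, of J]]
    have "F u (\<lambda>j\<in>J. 0) k = pm_map (bar_sum J') t u (F t (bar_unit J j)) k" by simp
    then show False using zero[OF k, of u] k nz tk that by (simp add: bar_sum_simps)
  qed
qed

end

text \<open>Consider the matrices of the two maps between the summands isomorphic to the interval
  \<open>I\<close>.  A nonzero composition that starts and ends in \<open>I\<close> passes only through copies of
  \<open>I\<close>, so the product of the matrices is the identity.\<close>

lemma multiplicity_le:
  assumes F: "barcode_morphism {(I, i). i < m I} {(I, i). i < m' I} F"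
    and G: "barcode_morphism {(I, i). i < m' I} {(I, i). i < m I} G"
    and inv: "\<And>t x. x \<in> carrier (pm_space (bar_sum {(I, i). i < m I}) t) \<Longrightarrow> G t (F t x) = x"
    and "I \<noteq> {}"
  shows "m I \<le> m' I"
proof -
  let ?J = "{(I, i). i < m I}" and ?J' = "{(I, i). i < m' I}"
  interpret F: barcode_morphism ?J ?J' F by fact
  interpret G: barcode_morphism ?J' ?J G by fact
  obtain t where t: "t \<in> I" using assms by blast
  define c where "c i j = F t (bar_unit ?J (I, i)) (I, j)" for i j
  define d where "d j k = G t (bar_unit ?J' (I, j)) (I, k)" for j k
  have prod: "(\<Sum>j<m' I. c i j * d j k) = (if k = i then 1 else 0)" if ik: "i < m I" "k < m I" for i k
  proof -
    define u where "u = F t (bar_unit ?J (I, i))"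
    have uJ: "bar_unit ?J (I, i) \<in> carrier (pm_space (bar_sum ?J) t)"
      using bar_unit_carrier[of t "(I, i)"] t by simp
    have uc: "u \<in> carrier (pm_space (bar_sum ?J') t)" unfolding u_def by (rule F.carrier[OF uJ])
    have fin: "finite {j\<in>?J'. u j \<noteq> 0}" using uc unfolding bar_sum_carrier by blast
    have "(if k = i then 1 else 0) = G t u (I, k)"
      using inv[OF uJ] ik by (simp add: u_def bar_unit_def)
    also have "\<dots> = (\<Sum>j\<in>{j\<in>?J'. u j \<noteq> 0}. u j * G t (bar_unit ?J' j) (I, k))"
      by (rule G.expand[OF uc]) (use ik in simp)
    also have "\<dots> = (\<Sum>j\<in>Pair I ` {..<m' I}. u j * G t (bar_unit ?J' j) (I, k))"
    proof (rule sum.mono_neutral_cong[OF _ fin])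
      fix p assume p: "p \<in> {j\<in>?J'. u j \<noteq> 0} - Pair I ` {..<m' I}"
      show "u p * G t (bar_unit ?J' p) (I, k) = 0"
      proof (rule ccontr)
        assume nz: "u p * G t (bar_unit ?J' p) (I, k) \<noteq> 0"
        have pJ: "p \<in> ?J'" using p by blast
        note 1 = F.component_nonzero[of "(I, i)" p t, OF _ pJ, folded u_def]
        have "t \<in> fst p" using 1(1) ik t nz by simp
        note 2 = G.component_nonzero[of p "(I, k)" t, OF pJ _ this]
        have "s \<in> fst p \<longleftrightarrow> s \<in> I" for s
        proof (cases "s \<le> t")
          case True
          then show ?thesis using 1(2)[of s] 2(2)[of s] ik t nz by auto
        next
          case False
          then show ?thesis using 1(3)[of s] 2(3)[of s] ik t nz by auto
        qed
        then have "fst p = I" by blast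
        then show False using p by auto
      qed
    qed auto
    also have "\<dots> = (\<Sum>j<m' I. c i j * d j k)"
      by (subst sum.reindex) (auto simp: inj_on_def c_def d_def u_def)
    finally show ?thesis by simp
  qed
  have "card {..<m I} \<le> card {..<m' I}"
  proof (rule card_le_if_triangular_product)
    fix V :: "nat set" assume V: "V \<subseteq> {..<m I}" "V \<noteq> {}"
    then obtain k where k: "k \<in> V" by blast
    show "\<exists>k\<in>V. (\<Sum>j<m' I. c k j * d j k) \<noteq> 0 \<and> (\<forall>i\<in>V. i \<noteq> k \<longrightarrow> (\<Sum>j<m' I. c i j * d j k) = 0)"
      using V prod by (intro bexI[OF _ k]) (auto simp: subset_iff k)
  qed simp_all
  then show ?thesis by simp
qed

text \<open>The definition of an isomorphism only speaks about the values of the operations, and these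
  might lead out of the carrier.  Closedness ensures that the inverse of an isomorphism is
  again linear and natural.\<close>

definition closed_persistence_module :: "'x persistence_module \<Rightarrow> bool" where
  "closed_persistence_module M \<longleftrightarrow>
    (\<forall>a. \<forall>x\<in>carrier (pm_space M a). \<forall>y\<in>carrier (pm_space M a). x \<oplus>\<^bsub>pm_space M a\<^esub> y \<in> carrier (pm_space M a)) \<and>
    (\<forall>a c. \<forall>x\<in>carrier (pm_space M a). c \<odot>\<^bsub>pm_space M a\<^esub> x \<in> carrier (pm_space M a)) \<and>
    (\<forall>a b. a \<le> b \<longrightarrow> (\<forall>x\<in>carrier (pm_space M a). pm_map M a b x \<in> carrier (pm_space M b)))"

definition iso_family :: "'x persistence_module \<Rightarrow> 'y persistence_module \<Rightarrow> (real \<Rightarrow> 'x \<Rightarrow> 'y) \<Rightarrow> bool" where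
  "iso_family M M' \<phi> \<longleftrightarrow>
     (\<forall>a. \<phi> a \<in> linear_isos (pm_space M a) (pm_space M' a)) \<and>
     (\<forall>a b. a \<le> b \<longrightarrow> (\<forall>x\<in>carrier (pm_space M a). \<phi> b (pm_map M a b x) = pm_map M' a b (\<phi> a x)))"

lemma is_barcode_iff:
  "is_barcode M m \<longleftrightarrow> (\<forall>I. m I > 0 \<longrightarrow> I \<noteq> {} \<and> is_interval I) \<and>
     (\<exists>\<phi>. iso_family M (bar_sum {(I, i). i < m I}) \<phi>)"
  by (simp add: is_barcode_def pm_isomorphic_def iso_family_def bar_sum_def)

lemma iso_familyD:
  assumes "iso_family M M' \<phi>"
  shows "bij_betw (\<phi> a) (carrier (pm_space M a)) (carrier (pm_space M' a))"
    and "x \<in> carrier (pm_space M a) \<Longrightarrow> \<phi> a x \<in> carrier (pm_space M' a)"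
    and "x \<in> carrier (pm_space M a) \<Longrightarrow> y \<in> carrier (pm_space M a) \<Longrightarrow>
      \<phi> a (x \<oplus>\<^bsub>pm_space M a\<^esub> y) = \<phi> a x \<oplus>\<^bsub>pm_space M' a\<^esub> \<phi> a y"
    and "x \<in> carrier (pm_space M a) \<Longrightarrow> \<phi> a (c \<odot>\<^bsub>pm_space M a\<^esub> x) = c \<odot>\<^bsub>pm_space M' a\<^esub> \<phi> a x"
    and "a \<le> b \<Longrightarrow> x \<in> carrier (pm_space M a) \<Longrightarrow> \<phi> b (pm_map M a b x) = pm_map M' a b (\<phi> a x)"
  using assms by (auto simp: iso_family_def linear_isos_def hom_def bij_betw_apply)

lemma barcode_morphism_iso:
  assumes M: "closed_persistence_module M"
    and \<phi>: "iso_family M (bar_sum J) \<phi>" and \<phi>': "iso_family M (bar_sum J') \<phi>'"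
  shows "barcode_morphism J J' (\<lambda>t x. \<phi>' t (inv_into (carrier (pm_space M t)) (\<phi> t) x))"
proof -
  define \<psi> where "\<psi> t = inv_into (carrier (pm_space M t)) (\<phi> t)" for t
  have \<psi>: "\<psi> t x \<in> carrier (pm_space M t)" "\<phi> t (\<psi> t x) = x"
    if "x \<in> carrier (pm_space (bar_sum J) t)" for t x
    using bij_betw_imp_surj_on[OF iso_familyD(1)[OF \<phi>, of t]] that
    by (auto simp: \<psi>_def inv_into_into f_inv_into_f)
  have \<psi>\<phi>: "\<psi> t (\<phi> t y) = y" if "y \<in> carrier (pm_space M t)" for t y
    using bij_betw_imp_inj_on[OF iso_familyD(1)[OF \<phi>, of t]] that by (simp add: \<psi>_def)
  have "barcode_morphism J J' (\<lambda>t x. \<phi>' t (\<psi> t x))"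
  proof
    show "\<phi>' t (\<psi> t x) \<in> carrier (pm_space (bar_sum J') t)" if "x \<in> carrier (pm_space (bar_sum J) t)" for t x
      by (rule iso_familyD(2)[OF \<phi>' \<psi>(1)[OF that]])
    fix t x assume x: "x \<in> carrier (pm_space (bar_sum J) t)"
    note x' = \<psi>(1)[OF x]
    show "\<phi>' t (\<psi> t (x \<oplus>\<^bsub>pm_space (bar_sum J) t\<^esub> y)) = \<phi>' t (\<psi> t x) \<oplus>\<^bsub>pm_space (bar_sum J') t\<^esub> \<phi>' t (\<psi> t y)"
      if y: "y \<in> carrier (pm_space (bar_sum J) t)" for y
    proof -
      note y' = \<psi>(1)[OF y]
      have "\<psi> t x \<oplus>\<^bsub>pm_space M t\<^esub> \<psi> t y \<in> carrier (pm_space M t)"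
        using M x' y' unfolding closed_persistence_module_def by blast
      from \<psi>\<phi>[OF this] iso_familyD(3)[OF \<phi> x' y'] iso_familyD(3)[OF \<phi>' x' y']
      show ?thesis using \<psi>(2)[OF x] \<psi>(2)[OF y] by simp
    qed
    show "\<phi>' t (\<psi> t (c \<odot>\<^bsub>pm_space (bar_sum J) t\<^esub> x)) = c \<odot>\<^bsub>pm_space (bar_sum J') t\<^esub> \<phi>' t (\<psi> t x)" for c
    proof -
      have "c \<odot>\<^bsub>pm_space M t\<^esub> \<psi> t x \<in> carrier (pm_space M t)"
        using M x' unfolding closed_persistence_module_def by blast
      from \<psi>\<phi>[OF this] iso_familyD(4)[OF \<phi> x', of c] iso_familyD(4)[OF \<phi>' x', of c]
      show ?thesis using \<psi>(2)[OF x] by simp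
    qed
    show "\<phi>' u (\<psi> u (pm_map (bar_sum J) t u x)) = pm_map (bar_sum J') t u (\<phi>' t (\<psi> t x))" if "t \<le> u" for u
    proof -
      have "pm_map M t u (\<psi> t x) \<in> carrier (pm_space M u)"
        using M x' that unfolding closed_persistence_module_def by blast
      from \<psi>\<phi>[OF this] iso_familyD(5)[OF \<phi> that x'] iso_familyD(5)[OF \<phi>' that x']
      show ?thesis using \<psi>(2)[OF x] by simp
    qed
  qed
  then show ?thesis by (simp add: \<psi>_def)
qed

theorem barcode_unique:
  assumes M: "closed_persistence_module M" and m: "is_barcode M m" and m': "is_barcode M m'"
  shows "m = m'"
proof -
  have le: "m I \<le> m' I" if m: "is_barcode M m" and m': "is_barcode M m'" for m m' I
  proof (cases "I = {}")
    case True
    then have "m I = 0" using m unfolding is_barcode_def by blast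
    then show ?thesis by simp
  next
    case False
    let ?J = "{(I, i). i < m I}" and ?J' = "{(I, i). i < m' I}"
    obtain \<phi> where \<phi>: "iso_family M (bar_sum ?J) \<phi>"
      using m unfolding is_barcode_iff by blast
    obtain \<phi>' where \<phi>': "iso_family M (bar_sum ?J') \<phi>'"
      using m' unfolding is_barcode_iff by blast
    show ?thesis
    proof (rule multiplicity_le[OF barcode_morphism_iso[OF M \<phi> \<phi>'] barcode_morphism_iso[OF M \<phi>' \<phi>] _ False])
      fix t x assume x: "x \<in> carrier (pm_space (bar_sum ?J) t)"
      let ?y = "inv_into (carrier (pm_space M t)) (\<phi> t) x"
      have "x \<in> \<phi> t ` carrier (pm_space M t)"
        using bij_betw_imp_surj_on[OF iso_familyD(1)[OF \<phi>, of t]] x by simp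
      then have y: "?y \<in> carrier (pm_space M t)" "\<phi> t ?y = x"
        by (rule inv_into_into, rule f_inv_into_f)
      have "inv_into (carrier (pm_space M t)) (\<phi>' t) (\<phi>' t ?y) = ?y"
        by (rule inv_into_f_f[OF bij_betw_imp_inj_on[OF iso_familyD(1)[OF \<phi>']] y(1)])
      then show "\<phi> t (inv_into (carrier (pm_space M t)) (\<phi>' t) (\<phi>' t ?y)) = x" using y(2) by simp
    qed
  qed
  show ?thesis by (intro ext antisym le[OF m m'] le[OF m' m])
qed

section \<open>The barcode of Mayer homology\<close>

definition coset :: "'v chain set \<Rightarrow> 'v chain \<Rightarrow> 'v chain set" where
  "coset V z = (\<lambda>b \<sigma>. b \<sigma> + z \<sigma>) ` V"

lemma coset_self: "linear_subspace V \<Longrightarrow> z \<in> coset V z"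
  using linear_subspaceD(1)[of V] by (auto simp: coset_def intro!: image_eqI[of _ _ "\<lambda>_. 0"])

lemma set_add_chain_module:
  "X <+>\<^bsub>chain_module L n\<^esub> Y = (\<Union>x\<in>X. \<Union>y\<in>Y. {\<lambda>\<sigma>. x \<sigma> + y \<sigma>})"
  by (simp add: set_add_def set_mult_def chain_module_def)

lemma coset_add:
  assumes V: "linear_subspace V"
  shows "(\<Union>u\<in>coset V x. \<Union>v\<in>coset V y. {\<lambda>\<sigma>. u \<sigma> + v \<sigma>}) = coset V (\<lambda>\<sigma>. x \<sigma> + y \<sigma>)"
proof (intro equalityI subsetI)
  fix w assume "w \<in> (\<Union>u\<in>coset V x. \<Union>v\<in>coset V y. {\<lambda>\<sigma>. u \<sigma> + v \<sigma>})"
  then obtain b b' where b: "b \<in> V" "b' \<in> V" "w = (\<lambda>\<sigma>. (b \<sigma> + x \<sigma>) + (b' \<sigma> + y \<sigma>))"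
    unfolding coset_def by blast
  have "(\<lambda>\<sigma>. b \<sigma> + 1 * b' \<sigma>) \<in> V" by (rule linear_subspaceD(2)[OF V b(1,2)])
  then show "w \<in> coset V (\<lambda>\<sigma>. x \<sigma> + y \<sigma>)" unfolding coset_def b(3)
    by (rule rev_image_eqI) (simp add: algebra_simps)
next
  fix w assume "w \<in> coset V (\<lambda>\<sigma>. x \<sigma> + y \<sigma>)"
  then obtain b where b: "b \<in> V" "w = (\<lambda>\<sigma>. b \<sigma> + (x \<sigma> + y \<sigma>))" unfolding coset_def by blast
  have "(\<lambda>\<sigma>. b \<sigma> + x \<sigma>) \<in> coset V x" using b(1) by (simp add: coset_def)
  moreover have "w = (\<lambda>\<sigma>. (b \<sigma> + x \<sigma>) + y \<sigma>)" using b(2) by (simp add: add.assoc)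
  ultimately show "w \<in> (\<Union>u\<in>coset V x. \<Union>v\<in>coset V y. {\<lambda>\<sigma>. u \<sigma> + v \<sigma>})"
    using coset_self[OF V, of y] by blast
qed

lemma coset_absorb:
  assumes V': "linear_subspace V'" and "linear_subspace V" "V \<subseteq> V'"
  shows "(\<Union>b\<in>V'. \<Union>v\<in>coset V x. {\<lambda>\<sigma>. b \<sigma> + v \<sigma>}) = coset V' x"
proof (intro equalityI subsetI)
  fix w assume "w \<in> (\<Union>b\<in>V'. \<Union>v\<in>coset V x. {\<lambda>\<sigma>. b \<sigma> + v \<sigma>})"
  then obtain b b' where b: "b \<in> V'" "b' \<in> V" "w = (\<lambda>\<sigma>. b \<sigma> + (b' \<sigma> + x \<sigma>))"
    unfolding coset_def by blast
  have "b' \<in> V'" using b(2) assms(3) by blast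
  have "(\<lambda>\<sigma>. b \<sigma> + 1 * b' \<sigma>) \<in> V'" by (rule linear_subspaceD(2)[OF V' b(1) \<open>b' \<in> V'\<close>])
  then show "w \<in> coset V' x" unfolding coset_def b(3)
    by (rule rev_image_eqI) (simp add: algebra_simps)
next
  fix w assume "w \<in> coset V' x"
  then obtain b where "b \<in> V'" "w = (\<lambda>\<sigma>. b \<sigma> + x \<sigma>)" unfolding coset_def by blast
  then show "w \<in> (\<Union>b\<in>V'. \<Union>v\<in>coset V x. {\<lambda>\<sigma>. b \<sigma> + v \<sigma>})"
    using coset_self[OF assms(2), of x] by blast
qed

lemma coset_scale:
  assumes V: "linear_subspace V"
  shows "(\<Union>b\<in>V. \<Union>v\<in>(\<lambda>u \<sigma>. c * u \<sigma>) ` coset V x. {\<lambda>\<sigma>. b \<sigma> + v \<sigma>}) = coset V (\<lambda>\<sigma>. c * x \<sigma>)"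
proof (intro equalityI subsetI)
  fix w assume "w \<in> (\<Union>b\<in>V. \<Union>v\<in>(\<lambda>u \<sigma>. c * u \<sigma>) ` coset V x. {\<lambda>\<sigma>. b \<sigma> + v \<sigma>})"
  then obtain b b' where b: "b \<in> V" "b' \<in> V" "w = (\<lambda>\<sigma>. b \<sigma> + c * (b' \<sigma> + x \<sigma>))"
    unfolding coset_def by blast
  have "(\<lambda>\<sigma>. b \<sigma> + c * b' \<sigma>) \<in> V" by (rule linear_subspaceD(2)[OF V b(1,2)])
  then show "w \<in> coset V (\<lambda>\<sigma>. c * x \<sigma>)" unfolding coset_def b(3)
    by (rule rev_image_eqI) (simp add: algebra_simps)
next
  fix w assume "w \<in> coset V (\<lambda>\<sigma>. c * x \<sigma>)"
  then obtain b where "b \<in> V" "w = (\<lambda>\<sigma>. b \<sigma> + c * x \<sigma>)" unfolding coset_def by blast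
  then show "w \<in> (\<Union>b\<in>V. \<Union>v\<in>(\<lambda>u \<sigma>. c * u \<sigma>) ` coset V x. {\<lambda>\<sigma>. b \<sigma> + v \<sigma>})"
    using coset_self[OF V, of x] by blast
qed

lemma coset_eqI:
  assumes V: "linear_subspace V" and d: "(\<lambda>\<sigma>. x \<sigma> + (-1) * y \<sigma>) \<in> V"
  shows "coset V x = coset V y"
proof (intro equalityI subsetI)
  fix w assume "w \<in> coset V x"
  then obtain b where b: "b \<in> V" "w = (\<lambda>\<sigma>. b \<sigma> + x \<sigma>)" unfolding coset_def by blast
  have "(\<lambda>\<sigma>. b \<sigma> + 1 * (x \<sigma> + (-1) * y \<sigma>)) \<in> V" by (rule linear_subspaceD(2)[OF V b(1) d])
  then show "w \<in> coset V y" unfolding coset_def b(2) by (rule rev_image_eqI) simp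
next
  fix w assume "w \<in> coset V y"
  then obtain b where b: "b \<in> V" "w = (\<lambda>\<sigma>. b \<sigma> + y \<sigma>)" unfolding coset_def by blast
  have "(\<lambda>\<sigma>. b \<sigma> + (-1) * (x \<sigma> + (-1) * y \<sigma>)) \<in> V" by (rule linear_subspaceD(2)[OF V b(1) d])
  then show "w \<in> coset V x" unfolding coset_def b(2) by (rule rev_image_eqI) simp
qed

lemma coset_zero: "coset V (\<lambda>_. 0) = V"
  by (simp add: coset_def)

lemma mayer_homology_simps:
  "carrier (mayer_homology N L n q) = coset (mayer_boundaries N L n q) ` mayer_cycles N L n q"
  "\<zero>\<^bsub>mayer_homology N L n q\<^esub> = mayer_boundaries N L n q"
  "X \<oplus>\<^bsub>mayer_homology N L n q\<^esub> Y = (\<Union>x\<in>X. \<Union>y\<in>Y. {\<lambda>\<sigma>. x \<sigma> + y \<sigma>})"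
  "c \<odot>\<^bsub>mayer_homology N L n q\<^esub> X
     = (\<Union>b\<in>mayer_boundaries N L n q. \<Union>v\<in>(\<lambda>u \<sigma>. c * u \<sigma>) ` X. {\<lambda>\<sigma>. b \<sigma> + v \<sigma>})"
  by (auto simp: mayer_homology_def quotient_module_def chain_module_def A_RCOSETS_def RCOSETS_def
      r_coset_def set_add_def set_mult_def coset_def)

lemma mayer_homology_smult:
  assumes "linear_subspace (mayer_boundaries N L n q)"
  shows "c \<odot>\<^bsub>mayer_homology N L n q\<^esub> coset (mayer_boundaries N L n q) x
    = coset (mayer_boundaries N L n q) (\<lambda>\<sigma>. c * x \<sigma>)"
  by (simp only: mayer_homology_simps coset_scale[OF assms])

locale mayer_filtration =
  fixes N :: nat and K :: "'v::linorder set set" and f :: "'v set \<Rightarrow> real" and q :: nat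
  assumes N: "N \<ge> 2" "q \<le> N"
    and complex: "abstract_simplicial_complex K"
    and monotone: "mono_on K f" and finite_levels: "\<And>a. finite (sublevel K f a)"
begin

abbreviation cycles :: "nat \<Rightarrow> real \<Rightarrow> 'v chain set" where
  "cycles n a \<equiv> mayer_cycles N (sublevel K f a) n q"

abbreviation bounds :: "nat \<Rightarrow> real \<Rightarrow> 'v chain set" where
  "bounds n a \<equiv> mayer_boundaries N (sublevel K f a) n q"

sublocale C: cycle_filtration K f "mayer_cycles N K n q" "bounds n" for n
  by (rule cycle_filtration_mayer[OF complex monotone finite_levels N])

abbreviation M :: "(nat \<Rightarrow> 'v chain set) persistence_module" where
  "M \<equiv> mayer_persistence N K f q"

lemma cycles_iff: "z \<in> cycles n a \<longleftrightarrow> z \<in> mayer_cycles N K n q \<and> (\<forall>\<sigma>. z \<sigma> \<noteq> 0 \<longrightarrow> f \<sigma> \<le> a)"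
  unfolding mayer_cycles_sublevel by simp

lemma cyclesD: "z \<in> cycles n a \<Longrightarrow> z \<in> mayer_cycles N K n q"
  by (simp add: cycles_iff)

lemma subspace_cycles: "linear_subspace (cycles n a)"
  by (rule subspace_mayer_cycles[OF sublevel_complex[OF complex monotone]])

lemma bounds_mono: "a \<le> b \<Longrightarrow> bounds n a \<subseteq> bounds n b"
  by (rule mayer_boundaries_mono) (auto simp: sublevel_def)

lemma cycle_degree:
  assumes "z \<in> mayer_cycles N K n q" "z \<sigma> \<noteq> 0"
  shows "n = card \<sigma> - 1"
  using assms by (auto simp: mayer_cycles_def chains_def)

lemma pivot_degree: "\<sigma> \<in> C.pivots n \<Longrightarrow> n = card \<sigma> - 1"
  using cycle_degree[OF C.gen_cycle C.gen_nonzero] by blast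

text \<open>Only finitely many degrees matter at each level, so direct sum and product agree.\<close>

lemma M_carrier:
  "X \<in> carrier (pm_space M a) \<longleftrightarrow> (\<exists>z. (\<forall>n. z n \<in> cycles n a) \<and> X = (\<lambda>n. coset (bounds n a) (z n)))"
proof
  assume "X \<in> carrier (pm_space M a)"
  then have "\<forall>n. X n \<in> coset (bounds n a) ` cycles n a"
    by (simp add: mayer_persistence_def total_mayer_homology_def module_sum_def mayer_homology_simps PiE_iff)
  then have "\<forall>n. \<exists>z. z \<in> cycles n a \<and> X n = coset (bounds n a) z" by blast
  from choice[OF this] show "\<exists>z. (\<forall>n. z n \<in> cycles n a) \<and> X = (\<lambda>n. coset (bounds n a) (z n))"
    by (auto simp: fun_eq_iff)
next
  assume "\<exists>z. (\<forall>n. z n \<in> cycles n a) \<and> X = (\<lambda>n. coset (bounds n a) (z n))"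
  then obtain z where z: "\<And>n. z n \<in> cycles n a" "X = (\<lambda>n. coset (bounds n a) (z n))" by blast
  have "n \<in> (\<lambda>\<sigma>. card \<sigma> - 1) ` sublevel K f a" if "X n \<noteq> bounds n a" for n
  proof -
    have "z n \<noteq> (\<lambda>_. 0)"
    proof
      assume "z n = (\<lambda>_. 0)"
      then have "X n = coset (bounds n a) (\<lambda>_. 0)" using z(2) by simp
      then show False using that by (simp only: coset_zero)
    qed
    then obtain \<sigma> where \<sigma>: "z n \<sigma> \<noteq> 0" by blast
    have "\<sigma> \<in> sublevel K f a" using z(1)[of n] \<sigma> by (auto simp: mayer_cycles_def chains_def)
    moreover have "n = card \<sigma> - 1" by (rule cycle_degree[OF cyclesD[OF z(1)] \<sigma>])
    ultimately show ?thesis by blast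
  qed
  then have "finite {n. X n \<noteq> bounds n a}"
    by (intro finite_subset[OF _ finite_imageI[OF finite_levels[of a]]] subsetI) simp
  then show "X \<in> carrier (pm_space M a)" using z
    by (simp add: mayer_persistence_def total_mayer_homology_def module_sum_def mayer_homology_simps PiE_iff)
qed

lemma M_add:
  "(\<lambda>n. coset (bounds n a) (x n)) \<oplus>\<^bsub>pm_space M a\<^esub> (\<lambda>n. coset (bounds n a) (y n))
     = (\<lambda>n. coset (bounds n a) (\<lambda>\<sigma>. x n \<sigma> + y n \<sigma>))"
  by (simp add: mayer_persistence_def total_mayer_homology_def module_sum_def mayer_homology_simps
      coset_add[OF C.subspace_B] restrict_def)

lemma M_smult:
  "c \<odot>\<^bsub>pm_space M a\<^esub> (\<lambda>n. coset (bounds n a) (x n)) = (\<lambda>n. coset (bounds n a) (\<lambda>\<sigma>. c * x n \<sigma>))"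
  by (simp add: mayer_persistence_def total_mayer_homology_def module_sum_def
      mayer_homology_smult[OF C.subspace_B] restrict_def)

lemma M_map:
  assumes "a \<le> b"
  shows "pm_map M a b (\<lambda>n. coset (bounds n a) (x n)) = (\<lambda>n. coset (bounds n b) (x n))"
  by (simp add: mayer_persistence_def inclusion_map_def set_add_chain_module
      coset_absorb[OF C.subspace_B C.subspace_B bounds_mono[OF assms]])

lemma closed_M: "closed_persistence_module M"
  unfolding closed_persistence_module_def
proof (intro conjI allI ballI impI)
  fix a X Y assume "X \<in> carrier (pm_space M a)" "Y \<in> carrier (pm_space M a)"
  then obtain x y where x: "\<And>n. x n \<in> cycles n a" "X = (\<lambda>n. coset (bounds n a) (x n))"
    and y: "\<And>n. y n \<in> cycles n a" "Y = (\<lambda>n. coset (bounds n a) (y n))"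
    unfolding M_carrier by blast
  have "(\<lambda>\<sigma>. x n \<sigma> + 1 * y n \<sigma>) \<in> cycles n a" for n
    by (rule linear_subspaceD(2)[OF subspace_cycles x(1) y(1)])
  then show "X \<oplus>\<^bsub>pm_space M a\<^esub> Y \<in> carrier (pm_space M a)"
    unfolding x(2) y(2) M_add M_carrier by (intro exI[of _ "\<lambda>n \<sigma>. x n \<sigma> + y n \<sigma>"]) simp
next
  fix a c X assume "X \<in> carrier (pm_space M a)"
  then obtain x where x: "\<And>n. x n \<in> cycles n a" "X = (\<lambda>n. coset (bounds n a) (x n))"
    unfolding M_carrier by blast
  have "(\<lambda>\<sigma>. 0 + c * x n \<sigma>) \<in> cycles n a" for n
    by (rule linear_subspaceD(2)[OF subspace_cycles linear_subspaceD(1)[OF subspace_cycles] x(1)])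
  then show "c \<odot>\<^bsub>pm_space M a\<^esub> X \<in> carrier (pm_space M a)"
    unfolding x(2) M_smult M_carrier by (intro exI[of _ "\<lambda>n \<sigma>. c * x n \<sigma>"]) simp
next
  fix a b X assume ab: "a \<le> b" and "X \<in> carrier (pm_space M a)"
  then obtain x where x: "\<And>n. x n \<in> cycles n a" "X = (\<lambda>n. coset (bounds n a) (x n))"
    unfolding M_carrier by blast
  have "x n \<in> cycles n b" for n using x(1)[of n] ab unfolding cycles_iff by (meson order_trans)
  then show "pm_map M a b X \<in> carrier (pm_space M b)"
    unfolding x(2) M_map[OF ab] M_carrier by (intro exI[of _ x]) simp
qed

text \<open>The generators of all degrees.  One that is born and dies at the same level contributes
  nothing to homology; the others are called visible.\<close>

definition generators :: "(nat \<times> 'v set) set" where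
  "generators = {(n, \<sigma>). \<sigma> \<in> C.pivots n}"

definition ends :: "nat \<times> 'v set \<Rightarrow> ereal \<times> ereal" where
  "ends = (\<lambda>(n, \<sigma>). (ereal (f \<sigma>), C.death n \<sigma>))"

definition bar :: "nat \<times> 'v set \<Rightarrow> real set" where
  "bar p = {a. fst (ends p) \<le> ereal a \<and> ereal a < snd (ends p)}"

definition visible :: "(nat \<times> 'v set) set" where
  "visible = {p \<in> generators. fst (ends p) < snd (ends p)}"

lemma visibleD:
  assumes "p \<in> visible"
  shows "snd p \<in> C.pivots (fst p)" "snd p \<in> K" "ereal (f (snd p)) < C.death (fst p) (snd p)"
proof -
  show "snd p \<in> C.pivots (fst p)" "ereal (f (snd p)) < C.death (fst p) (snd p)"
    using assms by (auto simp: visible_def generators_def ends_def split_beta)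
  then show "snd p \<in> K" using C.pivots_subset by blast
qed

lemma bar_iff: "a \<in> bar (n, \<sigma>) \<longleftrightarrow> f \<sigma> \<le> a \<and> ereal a < C.death n \<sigma>"
  by (simp add: bar_def ends_def)

lemma bar_pivot_iff: "\<sigma> \<in> C.pivots n \<Longrightarrow> a \<in> bar (n, \<sigma>) \<longleftrightarrow> f \<sigma> \<le> a \<and> C.gen n \<sigma> \<notin> bounds n a"
  using C.death_le_iff[of \<sigma> n a] by (simp add: bar_iff not_le flip: not_le)

lemma finite_generators_level: "finite {p \<in> generators. f (snd p) \<le> a}"
proof (rule finite_subset)
  show "{p \<in> generators. f (snd p) \<le> a} \<subseteq> (\<lambda>\<sigma>. (card \<sigma> - 1, \<sigma>)) ` sublevel K f a"
  proof
    fix p assume p: "p \<in> {p \<in> generators. f (snd p) \<le> a}"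
    obtain n \<sigma> where [simp]: "p = (n, \<sigma>)" by (cases p)
    have "\<sigma> \<in> C.pivots n" "f \<sigma> \<le> a" using p by (auto simp: generators_def)
    then show "p \<in> (\<lambda>\<sigma>. (card \<sigma> - 1, \<sigma>)) ` sublevel K f a"
      using pivot_degree[of \<sigma> n] C.pivots_subset[of n] by (auto simp: sublevel_def)
  qed
qed (use finite_levels in simp)

lemma bar_nonempty: "p \<in> visible \<Longrightarrow> f (snd p) \<in> bar p"
  using visibleD(3)[of p] by (cases p) (simp add: bar_iff)

lemma finite_visible_bar: "finite {p \<in> visible. bar p = I}"
proof (cases "I = {}")
  case True
  then have False if "p \<in> visible" "bar p = I" for p using bar_nonempty[OF that(1)] that(2) by simp
  then have "{p \<in> visible. bar p = I} = {}" by blast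
  then show ?thesis by (simp only: finite.emptyI)
next
  case False
  then obtain t where t: "t \<in> I" by blast
  have "f (snd p) \<le> t" if "bar p = I" for p
    using t unfolding that[symmetric] by (cases p) (simp add: bar_iff)
  then have "{p \<in> visible. bar p = I} \<subseteq> {p \<in> generators. f (snd p) \<le> t}"
    unfolding visible_def by blast
  then show ?thesis by (rule finite_subset[OF _ finite_generators_level])
qed

definition bar_multiplicity :: "real set \<Rightarrow> nat" where
  "bar_multiplicity I = card {p \<in> visible. bar p = I}"

text \<open>The coordinate of a homology class along a generator that is alive does not depend on
  the representing cycle, since boundaries have no such coordinate.\<close>

definition class_coord :: "nat \<Rightarrow> 'v chain set \<Rightarrow> 'v set \<Rightarrow> complex" where
  "class_coord n X \<sigma> = C.coord n (SOME z. z \<in> X) \<sigma>"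

lemma class_coord:
  assumes z: "z \<in> mayer_cycles N K n q" and alive: "a \<in> bar (n, \<sigma>)" and \<sigma>: "\<sigma> \<in> C.pivots n"
  shows "class_coord n (coset (bounds n a) z) \<sigma> = C.coord n z \<sigma>"
proof -
  define w where "w = (SOME w. w \<in> coset (bounds n a) z)"
  have "w \<in> coset (bounds n a) z" unfolding w_def
    by (rule someI[of "\<lambda>w. w \<in> coset (bounds n a) z", OF coset_self[OF C.subspace_B]])
  then obtain b where b: "b \<in> bounds n a" "w = (\<lambda>\<sigma>. b \<sigma> + 1 * z \<sigma>)" unfolding coset_def by auto
  have bZ: "b \<in> mayer_cycles N K n q" by (rule C.B_cycle[OF b(1)])
  have "C.coord n b \<sigma> = 0"
    using C.coord_boundary[OF bZ b(1), of \<sigma>] alive bar_pivot_iff[OF \<sigma>] by blast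
  then have "C.coord n w \<sigma> = C.coord n z \<sigma>"
    using fun_cong[OF C.coord_add_scaled[OF bZ z, of 1], of \<sigma>] b(2) by simp
  then show ?thesis by (simp add: class_coord_def w_def)
qed

text \<open>The isomorphism takes the coordinates of a homology class along the generators that are
  alive.  It is injective because a cycle all of whose generators are dead is a boundary, and
  it commutes with the structure maps because a cycle has no coordinates along generators that
  are not yet born.\<close>

theorem is_barcode_multiplicity: "is_barcode M bar_multiplicity"
proof -
  define J where "J = {(I, i). i < bar_multiplicity I}"
  obtain k where k: "bij_betw k J visible" and bar_k: "\<And>j. j \<in> J \<Longrightarrow> bar (k j) = fst j"
    using labelled_enumeration[OF finite_visible_bar] unfolding J_def bar_multiplicity_def by auto
  have k_visible: "k j \<in> visible" if "j \<in> J" for j using bij_betwE[OF k] that by blast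
  define \<phi> where "\<phi> a X = (\<lambda>j\<in>J. if a \<in> fst j then class_coord (fst (k j)) (X (fst (k j))) (snd (k j)) else 0)" for a X
  have \<phi>: "\<phi> a (\<lambda>n. coset (bounds n a) (z n))
      = (\<lambda>j\<in>J. if a \<in> fst j then C.coord (fst (k j)) (z (fst (k j))) (snd (k j)) else 0)"
    if "\<And>n. z n \<in> cycles n a" for a z
    unfolding \<phi>_def
  proof (rule restrict_ext)
    fix j assume j: "j \<in> J"
    show "(if a \<in> fst j then class_coord (fst (k j)) (coset (bounds (fst (k j)) a) (z (fst (k j)))) (snd (k j)) else 0)
        = (if a \<in> fst j then C.coord (fst (k j)) (z (fst (k j))) (snd (k j)) else 0)"
      using class_coord[OF cyclesD[OF that], of a "fst (k j)" "snd (k j)"]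
        visibleD(1)[OF k_visible[OF j]] bar_k[OF j] by simp
  qed
  have finite_alive: "finite {j\<in>J. a \<in> fst j}" for a
  proof (rule inj_on_finite[OF _ _ finite_generators_level[of a]])
    show "inj_on k {j\<in>J. a \<in> fst j}" using bij_betw_imp_inj_on[OF k] by (rule inj_on_subset) auto
    have "f (snd (k j)) \<le> a" if "j \<in> J" "a \<in> fst j" for j
      using bar_k[OF that(1)] that(2) by (cases "k j") (simp add: bar_iff flip: bar_k[OF that(1)])
    then show "k ` {j\<in>J. a \<in> fst j} \<subseteq> {p \<in> generators. f (snd p) \<le> a}"
      using k_visible by (auto simp: visible_def)
  qed
  have carrier_\<phi>: "\<phi> a X \<in> carrier (pm_space (bar_sum J) a)" for a X
    unfolding bar_sum_carrier by (auto simp: \<phi>_def intro!: finite_subset[OF _ finite_alive[of a]])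
  have inj: "inj_on (\<phi> a) (carrier (pm_space M a))" for a
  proof (rule inj_onI)
    fix X Y assume XY: "X \<in> carrier (pm_space M a)" "Y \<in> carrier (pm_space M a)" "\<phi> a X = \<phi> a Y"
    then obtain x y where x: "\<And>n. x n \<in> cycles n a" "X = (\<lambda>n. coset (bounds n a) (x n))"
      and y: "\<And>n. y n \<in> cycles n a" "Y = (\<lambda>n. coset (bounds n a) (y n))"
      unfolding M_carrier by blast
    have "coset (bounds n a) (x n) = coset (bounds n a) (y n)" for n
    proof (rule coset_eqI[OF C.subspace_B])
      define d where "d = (\<lambda>\<sigma>. x n \<sigma> + (-1) * y n \<sigma>)"
      have da: "d \<in> cycles n a" unfolding d_def by (rule linear_subspaceD(2)[OF subspace_cycles x(1) y(1)])
      note dZ = cyclesD[OF da]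
      have gen_bound: "C.gen n \<sigma> \<in> bounds n a" if nz: "C.coord n d \<sigma> \<noteq> 0" for \<sigma>
      proof (rule ccontr)
        assume nb: "C.gen n \<sigma> \<notin> bounds n a"
        have piv: "\<sigma> \<in> C.pivots n" by (rule C.coord_pivot[OF dZ nz])
        have "f \<sigma> \<le> a" by (rule C.coord_level[OF dZ _ nz]) (use da in \<open>simp add: cycles_iff\<close>)
        then have alive: "a \<in> bar (n, \<sigma>)" using nb bar_pivot_iff[OF piv] by simp
        then have "ereal (f \<sigma>) < C.death n \<sigma>" unfolding bar_iff by (meson ereal_less_eq(3) le_less_trans)
        then have "(n, \<sigma>) \<in> visible" using piv by (simp add: visible_def generators_def ends_def)
        then obtain j where j: "j \<in> J" "k j = (n, \<sigma>)" using bij_betw_imp_surj_on[OF k] by (metis imageE)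
        have aj: "a \<in> fst j" using bar_k[OF j(1)] j(2) alive by simp
        have "\<phi> a X j = \<phi> a Y j" using XY(3) by simp
        then have "C.coord n (x n) \<sigma> = C.coord n (y n) \<sigma>"
          using j aj unfolding x(2) y(2) \<phi>[OF x(1)] \<phi>[OF y(1)] by simp
        then show False
          using nz fun_cong[OF C.coord_add_scaled[OF cyclesD[OF x(1)] cyclesD[OF y(1)], of n "-1"], of \<sigma>]
          by (simp add: d_def)
      qed
      have "d = (\<lambda>\<tau>. \<Sum>\<sigma> | C.coord n d \<sigma> \<noteq> 0. C.coord n d \<sigma> * C.gen n \<sigma> \<tau>)"
        using C.coord_sum[OF dZ] by (intro ext) simp
      also have "\<dots> \<in> bounds n a"
        by (rule linear_subspace_sum[OF C.subspace_B C.finite_coord[OF dZ] gen_bound])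
      finally show "(\<lambda>\<sigma>. x n \<sigma> + (-1) * y n \<sigma>) \<in> bounds n a" by (simp add: d_def)
    qed
    then show "X = Y" using x(2) y(2) by simp
  qed
  have surj: "\<phi> a ` carrier (pm_space M a) = carrier (pm_space (bar_sum J) a)" for a
  proof
    show "\<phi> a ` carrier (pm_space M a) \<subseteq> carrier (pm_space (bar_sum J) a)" using carrier_\<phi> by blast
    show "carrier (pm_space (bar_sum J) a) \<subseteq> \<phi> a ` carrier (pm_space M a)"
    proof
      fix y assume y: "y \<in> carrier (pm_space (bar_sum J) a)"
      define S where "S n = {\<sigma>. (n, \<sigma>) \<in> visible \<and> a \<in> bar (n, \<sigma>)}" for n
      define c where "c n \<sigma> = (if \<sigma> \<in> S n then y (inv_into J k (n, \<sigma>)) else 0)" for n \<sigma>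
      define z where "z n = (\<lambda>\<tau>. \<Sum>\<sigma>\<in>S n. c n \<sigma> * C.gen n \<sigma> \<tau>)" for n
      have SK: "S n \<subseteq> {\<sigma>\<in>K. f \<sigma> \<le> a}" and Sp: "S n \<subseteq> C.pivots n" for n
        using visibleD(1,2) by (fastforce simp: S_def bar_iff)+
      have fin: "finite (S n)" for n by (rule finite_subset[OF SK C.finite_sublevel])
      have gen: "C.gen n \<sigma> \<in> cycles n a" if "\<sigma> \<in> S n" for n \<sigma>
        unfolding cycles_iff
      proof (intro conjI allI impI)
        show "C.gen n \<sigma> \<in> mayer_cycles N K n q" using C.gen_cycle Sp that by blast
        fix \<tau> assume "C.gen n \<sigma> \<tau> \<noteq> 0"
        then have "f \<tau> \<le> f \<sigma>" using C.gen_level Sp that by blast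
        then show "f \<tau> \<le> a" using SK that by force
      qed
      have zc: "z n \<in> cycles n a" for n unfolding z_def
        by (rule linear_subspace_sum[OF subspace_cycles fin gen])
      have coord_z: "C.coord n (z n) = c n" for n unfolding z_def
        by (rule C.coord_combination[OF fin Sp]) (simp add: c_def)
      have preimage: "\<phi> a (\<lambda>n. coset (bounds n a) (z n)) = y"
        unfolding \<phi>[OF zc] coord_z
      proof (rule extensionalityI[of _ J])
        show "y \<in> extensional J" using y unfolding bar_sum_carrier by blast
        fix j assume j: "j \<in> J"
        have "c (fst (k j)) (snd (k j)) = y j" if "a \<in> fst j"
        proof -
          have "snd (k j) \<in> S (fst (k j))" using k_visible[OF j] bar_k[OF j] that by (simp add: S_def)
          moreover have "inv_into J k (k j) = j" by (rule inv_into_f_f[OF bij_betw_imp_inj_on[OF k] j])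
          ultimately show ?thesis by (simp add: c_def)
        qed
        moreover have "y j = 0" if "a \<notin> fst j" using y j that unfolding bar_sum_carrier by blast
        ultimately show "(\<lambda>j\<in>J. if a \<in> fst j then c (fst (k j)) (snd (k j)) else 0) j = y j"
          using j by simp
      qed simp
      have "(\<lambda>n. coset (bounds n a) (z n)) \<in> carrier (pm_space M a)"
        unfolding M_carrier by (intro exI[of _ z] conjI allI zc refl)
      then have "\<phi> a (\<lambda>n. coset (bounds n a) (z n)) \<in> \<phi> a ` carrier (pm_space M a)"
        by (rule imageI)
      then show "y \<in> \<phi> a ` carrier (pm_space M a)" by (simp only: preimage)
    qed
  qed
  have add: "\<phi> a (X \<oplus>\<^bsub>pm_space M a\<^esub> Y) = \<phi> a X \<oplus>\<^bsub>pm_space (bar_sum J) a\<^esub> \<phi> a Y"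
    if XY: "X \<in> carrier (pm_space M a)" "Y \<in> carrier (pm_space M a)" for a X Y
  proof -
    obtain x y where x: "\<And>n. x n \<in> cycles n a" "X = (\<lambda>n. coset (bounds n a) (x n))"
      and y: "\<And>n. y n \<in> cycles n a" "Y = (\<lambda>n. coset (bounds n a) (y n))"
      using XY unfolding M_carrier by blast
    have s: "(\<lambda>\<sigma>. x n \<sigma> + 1 * y n \<sigma>) \<in> cycles n a" for n
      by (rule linear_subspaceD(2)[OF subspace_cycles x(1) y(1)])
    have "X \<oplus>\<^bsub>pm_space M a\<^esub> Y = (\<lambda>n. coset (bounds n a) (\<lambda>\<sigma>. x n \<sigma> + 1 * y n \<sigma>))"
      unfolding x(2) y(2) M_add by simp
    then have "\<phi> a (X \<oplus>\<^bsub>pm_space M a\<^esub> Y)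
      = \<phi> a (\<lambda>n. coset (bounds n a) (\<lambda>\<sigma>. x n \<sigma> + 1 * y n \<sigma>))" by simp
    also have "\<dots> = \<phi> a X \<oplus>\<^bsub>pm_space (bar_sum J) a\<^esub> \<phi> a Y"
      unfolding \<phi>[OF s] x(2) y(2) \<phi>[OF x(1)] \<phi>[OF y(1)] bar_sum_simps
        C.coord_add_scaled[OF cyclesD[OF x(1)] cyclesD[OF y(1)]]
      by (rule restrict_ext) simp
    finally show ?thesis .
  qed
  have smult: "\<phi> a (c \<odot>\<^bsub>pm_space M a\<^esub> X) = c \<odot>\<^bsub>pm_space (bar_sum J) a\<^esub> \<phi> a X"
    if X: "X \<in> carrier (pm_space M a)" for a c X
  proof -
    obtain x where x: "\<And>n. x n \<in> cycles n a" "X = (\<lambda>n. coset (bounds n a) (x n))"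
      using X unfolding M_carrier by blast
    \<comment> \<open>\<open>c * x\<close> in the form to which \<open>coord_add_scaled\<close> applies\<close>
    have s: "(\<lambda>\<sigma>. x n \<sigma> + (c - 1) * x n \<sigma>) \<in> cycles n a" for n
      by (rule linear_subspaceD(2)[OF subspace_cycles x(1) x(1)])
    have "c \<odot>\<^bsub>pm_space M a\<^esub> X = (\<lambda>n. coset (bounds n a) (\<lambda>\<sigma>. x n \<sigma> + (c - 1) * x n \<sigma>))"
      unfolding x(2) M_smult by (simp add: algebra_simps)
    then have "\<phi> a (c \<odot>\<^bsub>pm_space M a\<^esub> X)
      = \<phi> a (\<lambda>n. coset (bounds n a) (\<lambda>\<sigma>. x n \<sigma> + (c - 1) * x n \<sigma>))" by simp
    also have "\<dots> = c \<odot>\<^bsub>pm_space (bar_sum J) a\<^esub> \<phi> a X"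
      unfolding \<phi>[OF s] x(2) \<phi>[OF x(1)] bar_sum_simps
        C.coord_add_scaled[OF cyclesD[OF x(1)] cyclesD[OF x(1)]]
      by (rule restrict_ext) (simp add: algebra_simps)
    finally show ?thesis .
  qed
  have natural: "\<phi> b (pm_map M a b X) = pm_map (bar_sum J) a b (\<phi> a X)"
    if ab: "a \<le> b" and X: "X \<in> carrier (pm_space M a)" for a b X
  proof -
    obtain x where x: "\<And>n. x n \<in> cycles n a" "X = (\<lambda>n. coset (bounds n a) (x n))"
      using X unfolding M_carrier by blast
    have xb: "x n \<in> cycles n b" for n using x(1)[of n] ab unfolding cycles_iff by (meson order_trans)
    show ?thesis
      unfolding x(2) M_map[OF ab] \<phi>[OF xb] \<phi>[OF x(1)] bar_sum_simps
    proof (rule restrict_ext)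
      fix j assume j: "j \<in> J"
      obtain n \<sigma> where n\<sigma>: "k j = (n, \<sigma>)" by (cases "k j")
      have j_bar: "t \<in> fst j \<longleftrightarrow> f \<sigma> \<le> t \<and> ereal t < C.death n \<sigma>" for t
        using bar_k[OF j] unfolding n\<sigma> by (simp flip: bar_iff)
      have "C.coord n (x n) \<sigma> = 0" if "b \<in> fst j" "a \<notin> fst j"
      proof (rule ccontr)
        assume "C.coord n (x n) \<sigma> \<noteq> 0"
        then have "f \<sigma> \<le> a"
          using C.coord_level[OF cyclesD[OF x(1)], of n a \<sigma>] x(1)[of n] by (simp add: cycles_iff)
        moreover have "ereal b < C.death n \<sigma>" using that(1) by (simp add: j_bar)
        then have "ereal a < C.death n \<sigma>" using ab by (meson ereal_less_eq(3) le_less_trans)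
        ultimately show False using that(2) by (simp add: j_bar)
      qed
      then show "(if b \<in> fst j then C.coord (fst (k j)) (x (fst (k j))) (snd (k j)) else 0) =
         (if a \<in> fst j \<and> b \<in> fst j
          then (\<lambda>j\<in>J. if a \<in> fst j then C.coord (fst (k j)) (x (fst (k j))) (snd (k j)) else 0) j else 0)"
        using j n\<sigma> by simp
    qed
  qed
  have "iso_family M (bar_sum J) \<phi>"
    unfolding iso_family_def linear_isos_def hom_def bij_betw_def
    using inj surj add smult natural carrier_\<phi> by simp
  then have "\<exists>\<phi>. iso_family M (bar_sum {(I, i). i < bar_multiplicity I}) \<phi>"
    unfolding J_def by (rule exI[of _ \<phi>])
  moreover have "I \<noteq> {} \<and> is_interval I" if "bar_multiplicity I > 0" for I
  proof -
    have "{p \<in> visible. bar p = I} \<noteq> {}"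
    proof
      assume "{p \<in> visible. bar p = I} = {}"
      then have "bar_multiplicity I = 0" unfolding bar_multiplicity_def by (simp only: card.empty)
      then show False using that by simp
    qed
    then obtain p where p: "p \<in> visible" "bar p = I" by blast
    have "c \<in> bar p" if ab: "a \<in> bar p" "b \<in> bar p" "a \<le> c" "c \<le> b" for a b c
    proof -
      have "fst (ends p) \<le> ereal a" "ereal a \<le> ereal c" "ereal c \<le> ereal b" "ereal b < snd (ends p)"
        using ab by (simp_all add: bar_def)
      then have "fst (ends p) \<le> ereal c" "ereal c < snd (ends p)"
        by (blast intro: order_trans le_less_trans)+
      then show ?thesis by (simp add: bar_def)
    qed
    then have "is_interval (bar p)" unfolding is_interval_1 by blast
    then show ?thesis using p bar_nonempty by blast
  qed
  ultimately show ?thesis unfolding is_barcode_iff by blast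
qed

lemma barcode_M: "barcode M = bar_multiplicity"
  unfolding barcode_def
proof (rule the_equality)
  show "is_barcode M bar_multiplicity" by (rule is_barcode_multiplicity)
  show "m = bar_multiplicity" if "is_barcode M m" for m
    by (rule barcode_unique[OF closed_M that is_barcode_multiplicity])
qed

lemma bar_ends:
  assumes "p \<in> visible"
  shows "(Inf (ereal ` bar p), Sup (ereal ` bar p)) = ends p"
proof -
  obtain n \<sigma> where p: "p = (n, \<sigma>)" by (cases p)
  have lt: "ereal (f \<sigma>) < C.death n \<sigma>" using visibleD(3)[OF assms] p by simp
  have "Inf (ereal ` bar p) = ereal (f \<sigma>)"
  proof (rule antisym)
    show "Inf (ereal ` bar p) \<le> ereal (f \<sigma>)" using bar_nonempty[OF assms] p by (intro INF_lower) simp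
    show "ereal (f \<sigma>) \<le> Inf (ereal ` bar p)" by (rule INF_greatest) (simp add: p bar_iff)
  qed
  moreover have "Sup (ereal ` bar p) = C.death n \<sigma>"
  proof (rule antisym)
    show "Sup (ereal ` bar p) \<le> C.death n \<sigma>" by (rule SUP_least) (simp add: p bar_iff less_imp_le)
    show "C.death n \<sigma> \<le> Sup (ereal ` bar p)"
    proof (rule dense_le_bounded[OF lt])
      fix w assume w: "ereal (f \<sigma>) < w" "w < C.death n \<sigma>"
      then obtain r where "w = ereal r" by (cases w) auto
      then show "w \<le> Sup (ereal ` bar p)" using w by (intro SUP_upper2[of r]) (simp_all add: p bar_iff)
    qed
  qed
  ultimately show ?thesis by (simp add: p ends_def)
qed

lemma finite_visible_ends: "finite {p \<in> visible. ends p = e}"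
proof -
  have "f (snd p) \<le> real_of_ereal (fst e)" if "ends p = e" for p
    unfolding that[symmetric] by (cases p) (simp add: ends_def)
  then have "{p \<in> visible. ends p = e} \<subseteq> {p \<in> generators. f (snd p) \<le> real_of_ereal (fst e)}"
    unfolding visible_def by blast
  then show ?thesis by (rule finite_subset[OF _ finite_generators_level])
qed

theorem mayer_diagram_eq: "mayer_diagram N K f q e = card {p \<in> visible. ends p = e}"
proof -
  obtain b d where e: "e = (b, d)" by (cases e)
  have between: "bar p \<in> intervals_between b d \<longleftrightarrow> ends p = e" if "p \<in> visible" for p
  proof -
    have "is_interval (bar p)" "bar p \<noteq> {}"
    proof -
      have "{p' \<in> visible. bar p' = bar p} \<noteq> {}" using that by blast
      then have "bar_multiplicity (bar p) > 0" using finite_visible_bar[of "bar p"]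
        by (simp add: bar_multiplicity_def card_gt_0_iff)
      then show "is_interval (bar p)" "bar p \<noteq> {}"
        using is_barcode_multiplicity by (auto simp: is_barcode_def)
    qed
    then show ?thesis using bar_ends[OF that] e by (auto simp: intervals_between_def)
  qed
  have "mayer_diagram N K f q e = (\<Sum>I\<in>intervals_between b d. card {p \<in> visible. bar p = I})"
    by (simp add: mayer_diagram_def persistence_diagram_def e barcode_M bar_multiplicity_def)
  also have "\<dots> = card (\<Union>I\<in>intervals_between b d. {p \<in> visible. bar p = I})"
    by (rule card_UN_disjoint[symmetric])
      (use finite_intervals_between[of b d] finite_visible_bar in auto)
  also have "(\<Union>I\<in>intervals_between b d. {p \<in> visible. bar p = I}) = {p \<in> visible. ends p = e}"
    using between by auto
  finally show ?thesis .
qed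

end

section \<open>Stability\<close>

lemma ext_dist_le:
  assumes "u \<le> v + ereal \<epsilon>" "v \<le> u + ereal \<epsilon>" "0 \<le> \<epsilon>"
  shows "ext_dist u v \<le> ennreal \<epsilon>"
proof (cases "u = v")
  case False
  then obtain x y where xy: "u = ereal x" "v = ereal y"
    using assms by (cases u; cases v) auto
  then have "\<bar>u - v\<bar> \<le> ereal \<epsilon>" using assms by simp
  then have "e2ennreal \<bar>u - v\<bar> \<le> e2ennreal (ereal \<epsilon>)" by (rule e2ennreal_mono)
  then show ?thesis using False by (simp add: ext_dist_def ennreal.abs_eq)
qed (simp add: ext_dist_def)

lemma diagonal_dist_le:
  assumes "ereal b \<le> d" "d \<le> ereal (b + 2 * \<epsilon>)" "0 \<le> \<epsilon>"
  shows "diagonal_dist (ereal b, d) \<le> ennreal \<epsilon>"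
proof -
  obtain r where r: "d = ereal r" using assms by (cases d) auto
  have "linf_dist (ereal b, d) (ereal ((b + r) / 2), ereal ((b + r) / 2)) \<le> ennreal \<epsilon>"
    unfolding linf_dist_def using assms r by (auto intro!: max.boundedI ext_dist_le simp: field_simps)
  then show ?thesis unfolding diagonal_dist_def by (rule INF_lower2[OF UNIV_I])
qed

text \<open>The matching is the close bijection between the generators, restricted to those that are
  visible on both sides.  If the partner is not visible, its birth and death coincide, so the
  generator itself has length at most \<open>2 * \<epsilon>\<close>.\<close>

lemma bottleneck_le:
  fixes N :: nat and K :: "'v::linorder set set"
  assumes F: "mayer_filtration N K f q" and G: "mayer_filtration N K g q"
    and close: "\<And>\<sigma>. \<sigma> \<in> K \<Longrightarrow> \<bar>f \<sigma> - g \<sigma>\<bar> \<le> \<epsilon>" and "0 \<le> \<epsilon>"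
  shows "(INF \<gamma>\<in>matchings (mayer_diagram N K f q) (mayer_diagram N K g q).
            matching_cost (mayer_diagram N K f q) (mayer_diagram N K g q) \<gamma>) \<le> ennreal \<epsilon>"
proof -
  interpret F: mayer_filtration N K f q by fact
  interpret G: mayer_filtration N K g q by fact
  have pair: "cycle_filtration_pair K f g (mayer_cycles N K n q) (F.bounds n) (G.bounds n) \<epsilon>" for n
  proof
    show "F.bounds n a \<subseteq> G.bounds n (a + \<epsilon>)" "G.bounds n a \<subseteq> F.bounds n (a + \<epsilon>)" for a
      by (rule mayer_boundaries_mono; use close in \<open>fastforce simp: sublevel_def\<close>)+
  qed (fact close)
  define near where "near p r \<longleftrightarrow>
      fst (F.ends p) \<le> fst (G.ends r) + ereal \<epsilon> \<and> fst (G.ends r) \<le> fst (F.ends p) + ereal \<epsilon> \<and>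
      snd (F.ends p) \<le> snd (G.ends r) + ereal \<epsilon> \<and> snd (G.ends r) \<le> snd (F.ends p) + ereal \<epsilon>" for p r
  have "\<exists>h. bij_betw h (F.C.pivots n) (G.C.pivots n) \<and> (\<forall>\<sigma>\<in>F.C.pivots n. near (n, \<sigma>) (n, h \<sigma>))" for n
  proof -
    interpret P: cycle_filtration_pair K f g "mayer_cycles N K n q" "F.bounds n" "G.bounds n" \<epsilon> by (rule pair)
    obtain h where h: "bij_betw h (F.C.pivots n) (G.C.pivots n)" "\<forall>\<sigma>\<in>F.C.pivots n. P.close \<sigma> (h \<sigma>)"
      using P.ex_close_bijection by blast
    have "near (n, \<sigma>) (n, h \<sigma>)" if "P.close \<sigma> (h \<sigma>)" for \<sigma>
      using that by (auto simp: P.close_def near_def F.ends_def G.ends_def)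
    then show ?thesis using h by blast
  qed
  then obtain h where h: "\<And>n. bij_betw (h n) (F.C.pivots n) (G.C.pivots n)"
    and near_h: "\<And>n \<sigma>. \<sigma> \<in> F.C.pivots n \<Longrightarrow> near (n, \<sigma>) (n, h n \<sigma>)" by metis
  define H where "H = (\<lambda>(n, \<sigma>). (n, h n \<sigma>))"
  have inj_H: "inj_on H F.generators"
    using bij_betw_imp_inj_on[OF h] by (auto simp: inj_on_def H_def F.generators_def)
  have H_onto: "\<exists>p\<in>F.generators. H p = r" if "r \<in> G.generators" for r
  proof -
    obtain n \<tau> where r: "r = (n, \<tau>)" by (cases r)
    then have "\<tau> \<in> h n ` F.C.pivots n"
      using that bij_betw_imp_surj_on[OF h[of n]] by (simp add: G.generators_def)
    then show ?thesis by (force simp: r H_def F.generators_def)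
  qed
  have H_in: "H p \<in> G.generators" and H_near: "near p (H p)" if "p \<in> F.generators" for p
    using that bij_betwE[OF h] near_h by (auto simp: H_def F.generators_def G.generators_def)
  let ?D = "mayer_diagram N K f q" and ?D' = "mayer_diagram N K g q"
  obtain kf where kf: "bij_betw kf (diagram_points ?D) F.visible"
    and kf_ends: "\<And>x. x \<in> diagram_points ?D \<Longrightarrow> F.ends (kf x) = fst x"
    using labelled_enumeration[OF F.finite_visible_ends]
    unfolding diagram_points_def F.mayer_diagram_eq by auto
  obtain kg where kg: "bij_betw kg (diagram_points ?D') G.visible"
    and kg_ends: "\<And>y. y \<in> diagram_points ?D' \<Longrightarrow> G.ends (kg y) = fst y"
    using labelled_enumeration[OF G.finite_visible_ends]
    unfolding diagram_points_def G.mayer_diagram_eq by auto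
  have kf_in: "kf x \<in> F.generators" if "x \<in> diagram_points ?D" for x
    using bij_betwE[OF kf] that by (auto simp: F.visible_def)
  have kg_in: "kg y \<in> G.generators" if "y \<in> diagram_points ?D'" for y
    using bij_betwE[OF kg] that by (auto simp: G.visible_def)
  define \<gamma> where "\<gamma> = {(x, y). x \<in> diagram_points ?D \<and> y \<in> diagram_points ?D' \<and> H (kf x) = kg y}"
  have "single_valued \<gamma>"
    using bij_betw_imp_inj_on[OF kg] by (auto simp: single_valued_def \<gamma>_def dest: inj_onD)
  moreover have "single_valued (\<gamma>\<inverse>)"
  proof (rule single_valuedI)
    fix y x x' assume "(y, x) \<in> \<gamma>\<inverse>" "(y, x') \<in> \<gamma>\<inverse>"
    then have "x \<in> diagram_points ?D" "x' \<in> diagram_points ?D" "H (kf x) = H (kf x')" by (auto simp: \<gamma>_def)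
    then show "x = x'"
      using inj_onD[OF inj_H] kf_in inj_onD[OF bij_betw_imp_inj_on[OF kf]] by blast
  qed
  ultimately have "\<gamma> \<in> matchings ?D ?D'" by (auto simp: matchings_def \<gamma>_def)
  moreover have "matching_cost ?D ?D' \<gamma> \<le> ennreal \<epsilon>"
    unfolding matching_cost_def
  proof (rule Sup_least)
    fix c assume "c \<in> {linf_dist (fst x) (fst y) |x y. (x, y) \<in> \<gamma>} \<union>
      {diagonal_dist (fst x) |x. x \<in> diagram_points ?D - Domain \<gamma>} \<union>
      {diagonal_dist (fst y) |y. y \<in> diagram_points ?D' - Range \<gamma>}"
    then consider
        (matched) x y where "(x, y) \<in> \<gamma>" "c = linf_dist (fst x) (fst y)"
      | (left) x where "x \<in> diagram_points ?D" "x \<notin> Domain \<gamma>" "c = diagonal_dist (fst x)"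
      | (right) y where "y \<in> diagram_points ?D'" "y \<notin> Range \<gamma>" "c = diagonal_dist (fst y)"
      by blast
    then show "c \<le> ennreal \<epsilon>"
    proof cases
      case matched
      then have xy: "x \<in> diagram_points ?D" "y \<in> diagram_points ?D'" "H (kf x) = kg y" by (auto simp: \<gamma>_def)
      then have "near (kf x) (kg y)" using H_near[OF kf_in[OF xy(1)]] by simp
      then show ?thesis unfolding matched(2) linf_dist_def near_def kf_ends[OF xy(1)] kg_ends[OF xy(2)]
        using \<open>0 \<le> \<epsilon>\<close> by (intro max.boundedI ext_dist_le) auto
    next
      case left
      let ?r = "H (kf x)"
      have "?r \<notin> G.visible"
      proof
        assume "?r \<in> G.visible"
        then obtain y where "y \<in> diagram_points ?D'" "kg y = ?r"
          using bij_betw_imp_surj_on[OF kg] by (metis imageE)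
        then have "(x, y) \<in> \<gamma>" using left(1) by (simp add: \<gamma>_def)
        then show False using left(2) by blast
      qed
      moreover have r: "?r \<in> G.generators" by (rule H_in[OF kf_in[OF left(1)]])
      ultimately have "snd (G.ends ?r) \<le> fst (G.ends ?r)" by (simp add: G.visible_def not_less)
      moreover have "near (kf x) ?r" by (rule H_near[OF kf_in[OF left(1)]])
      moreover obtain n \<sigma> where p: "kf x = (n, \<sigma>)" by (cases "kf x")
      moreover obtain m \<tau> where "?r = (m, \<tau>)" by (cases ?r)
      ultimately have "F.C.death n \<sigma> \<le> ereal (f \<sigma> + 2 * \<epsilon>)"
        by (cases "F.C.death n \<sigma>"; cases "G.C.death m \<tau>") (auto simp: near_def F.ends_def G.ends_def)
      moreover have "ereal (f \<sigma>) \<le> F.C.death n \<sigma>"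
        using kf_in[OF left(1)] p F.C.birth_le_death by (simp add: F.generators_def)
      ultimately have "diagonal_dist (F.ends (kf x)) \<le> ennreal \<epsilon>"
        unfolding p F.ends_def using diagonal_dist_le \<open>0 \<le> \<epsilon>\<close> by simp
      then show ?thesis using left kf_ends by simp
    next
      case right
      obtain p where p: "p \<in> F.generators" "H p = kg y" using H_onto[OF kg_in[OF right(1)]] by blast
      have "p \<notin> F.visible"
      proof
        assume "p \<in> F.visible"
        then obtain x where "x \<in> diagram_points ?D" "kf x = p"
          using bij_betw_imp_surj_on[OF kf] by (metis imageE)
        then have "(x, y) \<in> \<gamma>" using right(1) p(2) by (simp add: \<gamma>_def)
        then show False using right(2) by blast
      qed
      then have "snd (F.ends p) \<le> fst (F.ends p)" using p(1) by (simp add: F.visible_def not_less)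
      moreover have "near p (kg y)" using H_near[OF p(1)] p(2) by simp
      moreover obtain n \<sigma> where "p = (n, \<sigma>)" by (cases p)
      moreover obtain m \<tau> where r: "kg y = (m, \<tau>)" by (cases "kg y")
      ultimately have "G.C.death m \<tau> \<le> ereal (g \<tau> + 2 * \<epsilon>)"
        by (cases "F.C.death n \<sigma>"; cases "G.C.death m \<tau>") (auto simp: near_def F.ends_def G.ends_def)
      moreover have "ereal (g \<tau>) \<le> G.C.death m \<tau>"
        using kg_in[OF right(1)] r G.C.birth_le_death by (simp add: G.generators_def)
      ultimately have "diagonal_dist (G.ends (kg y)) \<le> ennreal \<epsilon>"
        unfolding r G.ends_def using diagonal_dist_le \<open>0 \<le> \<epsilon>\<close> by simp
      then show ?thesis using right kg_ends by simp
    qed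
  qed
  ultimately show ?thesis by (rule INF_lower2)
qed

theorem theorem3p2:
  fixes N :: nat and K :: "'v::linorder set set" and f g :: "'v set \<Rightarrow> real"
  assumes "prime N"
    and "abstract_simplicial_complex K"
    and "mono_on K f" and "mono_on K g"
    and "\<And>a. finite (sublevel K f a)" and "\<And>a. finite (sublevel K g a)"
  shows "bottleneck_distance {1..N-1} (mayer_diagram N K f) (mayer_diagram N K g)
           \<le> (SUP \<sigma>\<in>K. ennreal \<bar>f \<sigma> - g \<sigma>\<bar>)"
proof (cases "SUP \<sigma>\<in>K. ennreal \<bar>f \<sigma> - g \<sigma>\<bar>" rule: ennreal_cases)
  case (real \<epsilon>)
  then have \<epsilon>: "0 \<le> \<epsilon>" "ennreal \<epsilon> = (SUP \<sigma>\<in>K. ennreal \<bar>f \<sigma> - g \<sigma>\<bar>)" by simp_all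
  have close: "\<bar>f \<sigma> - g \<sigma>\<bar> \<le> \<epsilon>" if "\<sigma> \<in> K" for \<sigma>
  proof -
    have "ennreal \<bar>f \<sigma> - g \<sigma>\<bar> \<le> ennreal \<epsilon>" unfolding \<epsilon>(2) using that by (rule SUP_upper)
    then show ?thesis using \<epsilon>(1) by simp
  qed
  have N: "N \<ge> 2" using assms(1) by (rule prime_ge_2_nat)
  show ?thesis unfolding bottleneck_distance_def \<epsilon>(2)[symmetric]
  proof (rule SUP_least)
    fix q assume "q \<in> {1..N-1}"
    then have "q \<le> N" by (simp, linarith)
    show "(INF \<gamma>\<in>matchings (mayer_diagram N K f q) (mayer_diagram N K g q).
            matching_cost (mayer_diagram N K f q) (mayer_diagram N K g q) \<gamma>) \<le> ennreal \<epsilon>"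
    proof (rule bottleneck_le[OF _ _ close \<epsilon>(1)])
      show "mayer_filtration N K f q" by unfold_locales (use N \<open>q \<le> N\<close> assms in auto)
      show "mayer_filtration N K g q" by unfold_locales (use N \<open>q \<le> N\<close> assms in auto)
    qed
  qed
qed (simp only: top_greatest)

end
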